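(* Let $\nu$ be a compactly supported Borel probability measure on $\mathbb{R}^d$ with support contained in $(0,1]^d$ and with $\dim_\infty(\nu)>0$. Then: (1) For $r\in(0,+\infty)$, $$\frac{r\underline{F}_r}{1-\underline{F}_r}\le\underline{D}_r(\nu)\le\frac{r\underline{h}_r}{1-\underline{h}_r}\le\frac{r\overline{h}_r}{1-\overline{h}_r}=\overline{D}_r(\nu)=\frac{rq_r}{1-q_r}=\frac{r\overline{F}_r}{1-\overline{F}_r}.$$ (2) For $r\in(-\dim_\infty(\nu),0)$, (a) $\displaystyle\frac{r\overline{F}_r}{1-\overline{F}_r}=\frac{rq_r}{1-q_r}=\underline{D}_r(\nu)=\frac{r\overline{h}_r}{1-\overline{h}_r}$; (b) under the assumption $\underline{F}_r>1$, $\displaystyle\frac{r\overline{h}_r}{1-\overline{h}_r}\le\frac{r\underline{h}_r}{1-\underline{h}_r}\le\overline{D}_r(\nu)\le\frac{r\underline{F}_r}{1-\underline{F}_r}.$ (3) For $r=0$, and under the assumption that $r\mapsto q_r$ is differentiable at $0$, the function $\beta_\nu$ is differentiable at $1$, the quantization dimension $D_0(\nu)$ exists, and $$D_0(\nu)=-\beta_\nu'(1)=\dim_H(\nu).$$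
   Context: **Quantization.** $\mathbb{R}^d$ carries a fixed norm $\|\cdot\|$; $d(x,A)=\min_{y\in A}\|x-y\|$; $\mathcal{A}_n=\{A\subset\mathbb{R}^d:1\le\operatorname{card}(A)\le n\}$. For $r\in\mathbb{R}$, $$\mathfrak{e}_{n,r}(\nu)=\inf_{A\in\mathcal{A}_n}\Big(\int d(x,A)^r\,d\nu(x)\Big)^{1/r}\ (r\neq0),\qquad \mathfrak{e}_{n,0}(\nu)=\inf_{A\in\mathcal{A}_n}\exp\int\log d(x,A)\,d\nu(x),$$ with $0^r=+\infty$ and $(+\infty)^{1/r}=0$ for $r<0$. Further $$\overline{D}_r(\nu)=\limsup_{n\to\infty}\frac{\log n}{-\log\mathfrak{e}_{n,r}(\nu)},\qquad\underline{D}_r(\nu)=\liminf_{n\to\infty}\frac{\log n}{-\log\mathfrak{e}_{n,r}(\nu)}$$ (convention $1/\log0=0$), and $D_r(\nu)$ denotes the common value if they agree. **Dyadic cubes.** $\mathcal{D}_n$ is the partition of $(0,1]^d$ by half-open cubes $\prod_{i=1}^d(k_i2^{-n},(k_i+1)2^{-n}]$, $k\in\mathbb{Z}^d$; $\mathcal{D}=\bigcup_{n\in\mathbb{N}}\mathcal{D}_n$; $\mathcal{D}_n(Q)=\{Q'\in\mathcal{D}_n:Q'\subset Q\}$ and $\mathcal{D}(Q)=\bigcup_{n\in\mathbb{N}}\mathcal{D}_n(Q)$. $\Lambda$ is Lebesgue measure on $(0,1]^d$. $$\dim_\infty(\nu)=\liminf_{n\to\infty}\frac{\max_{Q\in\mathcal{D}_n}\log\nu(Q)}{\log2^{-n}}.$$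 **Partition function.** For $r>-\dim_\infty(\nu)$ and $Q\in\mathcal{D}$, $$\mathfrak{J}_{\nu,r}(Q)=\max_{Q'\in\mathcal{D}(Q)}\nu(Q')\Lambda(Q')^{r/d}.$$ For $q\ge0$, $$\tau_{\mathfrak{J}_{\nu,r}}(q)=\limsup_{n\to\infty}\frac{\log\sum_{Q\in\mathcal{D}_n,\ \mathfrak{J}_{\nu,r}(Q)>0}\mathfrak{J}_{\nu,r}(Q)^q}{\log 2^n},\qquad q_r=\inf\{q>0:\tau_{\mathfrak{J}_{\nu,r}}(q)<0\}.$$ The $L^q$-spectrum is $$\beta_\nu(q)=\limsup_{n\to\infty}\frac{\log\sum_{Q\in\mathcal{D}_n,\ \nu(Q)>0}\nu(Q)^q}{\log2^n}.$$ **Partition entropy.** Let $\Pi$ be the set of finite partitions of $(0,1]^d$ by cubes from $\mathcal{D}$, and $$\mathcal{M}_{\nu,r}(x)=\inf\{\operatorname{card}(P):P\in\Pi,\ \max_{Q\in P}\mathfrak{J}_{\nu,r}(Q)<1/x\},$$ $$\overline{h}_{\nu,r}=\limsup_{x\to\infty}\frac{\log\mathcal{M}_{\nu,r}(x)}{\log x},\qquad\underline{h}_{\nu,r}=\liminf_{x\to\infty}\frac{\log\mathcal{M}_{\nu,r}(x)}{\log x},$$ $$\overline{h}_r=\overline{h}_{\nu,r},\qquad\underline{h}_r=\lim_{\varepsilon\downarrow0}\underline{h}_{\nu,r-\varepsilon}.$$ **Coarse multifractal dimension.** For $\alpha>0$ let $\mathcal{N}_{\nu,\alpha,r}(n)=\operatorname{card}\{Q\in\mathcal{D}_n:\mathfrak{J}_{\nu,r}(Q)\ge2^{-\alpha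 n}\}$ and, with $\log^+ x=\max\{0,\log x\}$ ($\log^+0=0$), $$\overline{F}_{\nu,r}(\alpha)=\limsup_{n}\frac{\log^+\mathcal{N}_{\nu,\alpha,r}(n)}{\log2^n},\qquad\underline{F}_{\nu,r}(\alpha)=\liminf_{n}\frac{\log^+\mathcal{N}_{\nu,\alpha,r}(n)}{\log2^n},$$ $$\overline{F}_r=\sup_{\alpha>0}\frac{\overline{F}_{\nu,r}(\alpha)}{\alpha},\qquad\underline{F}_r=\sup_{\alpha>0}\frac{\underline{F}_{\nu,r}(\alpha)}{\alpha}.$$ **Hausdorff dimension.** $\dim_H(\nu)=\inf\{\dim_H(A):\nu(A)>0\}$, the infimum over Borel sets $A\subset\mathbb{R}^d$, where $\dim_H(A)$ is the Hausdorff dimension. *)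

theory Defs
  imports "HOL-Analysis.Analysis" "HOL-Probability.Probability"
begin

section \<open>Norms and extended real powers, logarithms and integrals\<close>

text \<open>
  Distances are taken with respect to an arbitrary norm on $\mathbb{R}^d$, which need not
  be the Euclidean \<open>norm\<close> of the type \<open>real ^ 'd\<close>.
\<close>

definition is_norm :: "(real ^ 'd \<Rightarrow> real) \<Rightarrow> bool" where
  "is_norm N \<longleftrightarrow>
     (\<forall>x. 0 \<le> N x) \<and> (\<forall>x. N x = 0 \<longleftrightarrow> x = 0) \<and>
     (\<forall>c x. N (c *\<^sub>R x) = \<bar>c\<bar> * N x) \<and> (\<forall>x y. N (x + y) \<le> N x + N y)"

text \<open>
  Powers on $[0,\infty]$ with $0^r = \infty$ and $\infty^r = 0$ for $r < 0$
  (unlike \<open>powr\<close>, where \<open>0 powr r = 0\<close>).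
\<close>

definition epow :: "ennreal \<Rightarrow> real \<Rightarrow> ennreal" where
  "epow x r =
     (if r = 0 then 1
      else if x = 0 then (if r < 0 then \<infinity> else 0)
      else if x = \<infinity> then (if r < 0 then 0 else \<infinity>)
      else ennreal (enn2real x powr r))"

definition elog :: "ennreal \<Rightarrow> ereal" where
  "elog x = (if x = 0 then - \<infinity> else if x = \<infinity> then \<infinity> else ereal (ln (enn2real x)))"

definition eexp :: "ereal \<Rightarrow> ennreal" where
  "eexp x =
     (if x = - \<infinity> then 0 else if x = \<infinity> then \<infinity> else ennreal (exp (real_of_ereal x)))"

text \<open>
  Integral of the positive part minus integral of the negative part; \<open>e2ennreal\<close> truncates
  at \<open>0\<close>. Below it is applied only to functions whose positive part is integrable.
\<close>

definition ereal_integral :: "'a measure \<Rightarrow> ('a \<Rightarrow> ereal) \<Rightarrow> ereal" where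
  "ereal_integral M f =
     enn2ereal (\<integral>\<^sup>+ x. e2ennreal (f x) \<partial>M) - enn2ereal (\<integral>\<^sup>+ x. e2ennreal (- f x) \<partial>M)"

text \<open>Differentiability at a point of a function that is finite near that point.\<close>

definition ereal_has_derivative_at :: "(real \<Rightarrow> ereal) \<Rightarrow> real \<Rightarrow> real \<Rightarrow> bool" where
  "ereal_has_derivative_at f D x \<longleftrightarrow>
     (\<forall>\<^sub>F y in nhds x. \<bar>f y\<bar> \<noteq> \<infinity>) \<and>
     ((\<lambda>y. real_of_ereal (f y)) has_real_derivative D) (at x)"

definition measure_support :: "'a::topological_space measure \<Rightarrow> 'a set" where
  "measure_support M = {x. \<forall>U. open U \<and> x \<in> U \<longrightarrow> emeasure M U > 0}"


section \<open>Quantization\<close>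

definition dist_set :: "(real ^ 'd \<Rightarrow> real) \<Rightarrow> real ^ 'd \<Rightarrow> (real ^ 'd) set \<Rightarrow> real" where
  "dist_set N x A = Min ((\<lambda>y. N (x - y)) ` A)"

text \<open>\<open>1 \<le> card A\<close> entails that \<open>A\<close> is finite.\<close>

definition codebooks :: "nat \<Rightarrow> (real ^ 'd) set set" where
  "codebooks n = {A. 1 \<le> card A \<and> card A \<le> n}"

definition quant_error ::
    "(real ^ 'd \<Rightarrow> real) \<Rightarrow> (real ^ 'd) measure \<Rightarrow> nat \<Rightarrow> real \<Rightarrow> ennreal" where
  "quant_error N \<nu> n r =
     (if r = 0
      then INF A\<in>codebooks n. eexp (ereal_integral \<nu> (\<lambda>x. elog (ennreal (dist_set N x A))))
      else INF A\<in>codebooks n. epow (\<integral>\<^sup>+ x. epow (ennreal (dist_set N x A)) r \<partial>\<nu>) (1 / r))"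

text \<open>
  If the error is \<open>0\<close> then the denominator below is \<open>\<infinity>\<close> and the quotient is \<open>0\<close>, in accordance
  with the convention $1/\log 0 = 0$.
\<close>

definition upper_quant_dim ::
    "(real ^ 'd \<Rightarrow> real) \<Rightarrow> (real ^ 'd) measure \<Rightarrow> real \<Rightarrow> ereal" where
  "upper_quant_dim N \<nu> r =
     limsup (\<lambda>n. ereal (ln (real n)) / (- elog (quant_error N \<nu> n r)))"

definition lower_quant_dim ::
    "(real ^ 'd \<Rightarrow> real) \<Rightarrow> (real ^ 'd) measure \<Rightarrow> real \<Rightarrow> ereal" where
  "lower_quant_dim N \<nu> r =
     liminf (\<lambda>n. ereal (ln (real n)) / (- elog (quant_error N \<nu> n r)))"


section \<open>Dyadic cubes\<close>

definition half_open_unit_cube :: "(real ^ 'd) set" where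
  "half_open_unit_cube = {x. \<forall>i. 0 < x $ i \<and> x $ i \<le> 1}"

definition dyadic_cube :: "nat \<Rightarrow> int ^ 'd \<Rightarrow> (real ^ 'd) set" where
  "dyadic_cube n k =
     {x. \<forall>i. of_int (k $ i) / 2 ^ n < x $ i \<and> x $ i \<le> (of_int (k $ i) + 1) / 2 ^ n}"

definition dyadic_cubes :: "nat \<Rightarrow> (real ^ 'd) set set" where
  "dyadic_cubes n = {Q. (\<exists>k. Q = dyadic_cube n k) \<and> Q \<subseteq> half_open_unit_cube}"

definition all_dyadic_cubes :: "(real ^ 'd) set set" where
  "all_dyadic_cubes = (\<Union>n. dyadic_cubes n)"

definition dyadic_subcubes :: "(real ^ 'd) set \<Rightarrow> (real ^ 'd) set set" where
  "dyadic_subcubes Q = (\<Union>n. {Q' \<in> dyadic_cubes n. Q' \<subseteq> Q})"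

text \<open>
  Cubes of measure \<open>0\<close> contribute $\log 0 = -\infty$ to the maximum and are left out, since
  \<open>ln 0 = 0\<close> in the library.
\<close>

definition dim_infty :: "(real ^ 'd) measure \<Rightarrow> ereal" where
  "dim_infty \<nu> =
     liminf (\<lambda>n. ereal (Max ((\<lambda>Q. ln (measure \<nu> Q)) ` {Q \<in> dyadic_cubes n. measure \<nu> Q > 0})
                         / ln (2 powr (- real n))))"


section \<open>Partition function\<close>

text \<open>
  For \<open>r > - dim_infty \<nu>\<close> the products tend to \<open>0\<close> along the subcubes of \<open>Q\<close>, so that the
  supremum is finite and is a maximum.
\<close>

definition part_fun :: "(real ^ 'd) measure \<Rightarrow> real \<Rightarrow> (real ^ 'd) set \<Rightarrow> real" where
  "part_fun \<nu> r Q =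
     (SUP Q'\<in>dyadic_subcubes Q. measure \<nu> Q' * measure lborel Q' powr (r / real CARD('d)))"

definition part_spectrum :: "(real ^ 'd) measure \<Rightarrow> real \<Rightarrow> real \<Rightarrow> ereal" where
  "part_spectrum \<nu> r q =
     limsup (\<lambda>n. ereal (ln (\<Sum>Q\<in>{Q \<in> dyadic_cubes n. part_fun \<nu> r Q > 0}. part_fun \<nu> r Q powr q)
                         / ln (2 ^ n)))"

definition crit_exp :: "(real ^ 'd) measure \<Rightarrow> real \<Rightarrow> ereal" where
  "crit_exp \<nu> r = (INF q\<in>{q. q > 0 \<and> part_spectrum \<nu> r q < 0}. ereal q)"

definition Lq_spectrum :: "(real ^ 'd) measure \<Rightarrow> real \<Rightarrow> ereal" where
  "Lq_spectrum \<nu> q =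
     limsup (\<lambda>n. ereal (ln (\<Sum>Q\<in>{Q \<in> dyadic_cubes n. measure \<nu> Q > 0}. measure \<nu> Q powr q)
                         / ln (2 ^ n)))"


section \<open>Partition entropy\<close>

definition cube_partitions :: "(real ^ 'd) set set set" where
  "cube_partitions =
     {P. finite P \<and> P \<subseteq> all_dyadic_cubes \<and> partition_on half_open_unit_cube P}"

definition min_part_card :: "(real ^ 'd) measure \<Rightarrow> real \<Rightarrow> real \<Rightarrow> nat" where
  "min_part_card \<nu> r x =
     (INF P\<in>{P \<in> cube_partitions. Max (part_fun \<nu> r ` P) < 1 / x}. card P)"

definition upper_entropy :: "(real ^ 'd) measure \<Rightarrow> real \<Rightarrow> ereal" where
  "upper_entropy \<nu> r =
     Limsup at_top (\<lambda>x::real. ereal (ln (real (min_part_card \<nu> r x)) / ln x))"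

definition lower_entropy :: "(real ^ 'd) measure \<Rightarrow> real \<Rightarrow> ereal" where
  "lower_entropy \<nu> r =
     Liminf at_top (\<lambda>x::real. ereal (ln (real (min_part_card \<nu> r x)) / ln x))"

text \<open>
  The left limit of \<open>lower_entropy \<nu>\<close> at \<open>r\<close>; it exists since \<open>lower_entropy \<nu>\<close> is
  antimonotone on \<open>r > - dim_infty \<nu>\<close>.
\<close>

definition lower_entropy_lim :: "(real ^ 'd) measure \<Rightarrow> real \<Rightarrow> ereal" where
  "lower_entropy_lim \<nu> r = Lim (at_right 0) (\<lambda>\<epsilon>. lower_entropy \<nu> (r - \<epsilon>))"


section \<open>Coarse multifractal dimension\<close>

definition coarse_count :: "(real ^ 'd) measure \<Rightarrow> real \<Rightarrow> real \<Rightarrow> nat \<Rightarrow> nat" where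
  "coarse_count \<nu> \<alpha> r n =
     card {Q \<in> dyadic_cubes n. part_fun \<nu> r Q \<ge> 2 powr (- \<alpha> * real n)}"

text \<open>In the next two definitions $\log^+ 0 = 0$ holds because \<open>ln 0 = 0\<close>.\<close>

definition upper_coarse :: "(real ^ 'd) measure \<Rightarrow> real \<Rightarrow> real \<Rightarrow> ereal" where
  "upper_coarse \<nu> r \<alpha> =
     limsup (\<lambda>n. ereal (max 0 (ln (real (coarse_count \<nu> \<alpha> r n))) / ln (2 ^ n)))"

definition lower_coarse :: "(real ^ 'd) measure \<Rightarrow> real \<Rightarrow> real \<Rightarrow> ereal" where
  "lower_coarse \<nu> r \<alpha> =
     liminf (\<lambda>n. ereal (max 0 (ln (real (coarse_count \<nu> \<alpha> r n))) / ln (2 ^ n)))"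

definition upper_coarse_dim :: "(real ^ 'd) measure \<Rightarrow> real \<Rightarrow> ereal" where
  "upper_coarse_dim \<nu> r = (SUP \<alpha>\<in>{0<..}. upper_coarse \<nu> r \<alpha> / ereal \<alpha>)"

definition lower_coarse_dim :: "(real ^ 'd) measure \<Rightarrow> real \<Rightarrow> ereal" where
  "lower_coarse_dim \<nu> r = (SUP \<alpha>\<in>{0<..}. lower_coarse \<nu> r \<alpha> / ereal \<alpha>)"


section \<open>Hausdorff dimension\<close>

text \<open>
  Covering sets are required to be bounded because \<open>diameter\<close> is meaningful only for those.
  The Euclidean diameter may be used since equivalent norms give the same dimension. Exponents
  are positive, so that the value of \<open>0 powr 0\<close> does not matter.
\<close>

definition hausdorff_premeasure :: "real \<Rightarrow> real \<Rightarrow> 'a::metric_space set \<Rightarrow> ennreal" where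
  "hausdorff_premeasure s \<delta> A =
     (INF U\<in>{U :: nat \<Rightarrow> 'a set. A \<subseteq> (\<Union>i. U i) \<and> (\<forall>i. bounded (U i) \<and> diameter (U i) \<le> \<delta>)}.
        \<Sum>i. ennreal (diameter (U i) powr s))"

definition hausdorff_measure :: "real \<Rightarrow> 'a::metric_space set \<Rightarrow> ennreal" where
  "hausdorff_measure s A = (SUP \<delta>\<in>{0<..}. hausdorff_premeasure s \<delta> A)"

definition hausdorff_dim :: "'a::metric_space set \<Rightarrow> ereal" where
  "hausdorff_dim A = (INF s\<in>{s. s > 0 \<and> hausdorff_measure s A = 0}. ereal s)"

definition hausdorff_dim_measure :: "'a::metric_space measure \<Rightarrow> ereal" where
  "hausdorff_dim_measure \<nu> = (INF A\<in>{A \<in> sets borel. emeasure \<nu> A > 0}. hausdorff_dim A)"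

end

(* A partition of the unit cube into n dyadic cubes with J(Q) < 1/x controls the integral of d(x,A)^r
   up to a factor n/x: for r > 0 through the codebook with one point per cube, for r < 0 (with a
   slightly smaller order in J) for every codebook of n points. Conversely, m cubes of one level with
   J(Q) >= 2^(-alpha n) force an integral of at least m 2^(-alpha n), for r > 0 for every codebook of
   fewer points, for r < 0 for one codebook. Both give errors of order n^(-1/phi(h)) with
   phi(h) = r h / (1 - h), where h is an entropy or a coarse multifractal dimension.

   For the upper quantities F <= h <= q <= F: a partition has to refine all cubes above the threshold,
   stopping at the threshold gives a partition counted by the sums of J^q, and those sums are split
   along a finite grid of exponents. Since the sum of J^q over level n is dominated by the sums of
   (nu(Q) 2^(-kr))^q over the levels k >= n, tau_r(q) < 0 holds iff beta(q) < r q. Hence near r = 0 the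
   critical exponent is the inverse of q |-> beta(q)/q, and beta'(1) = 1/q'(0).

   The errors increase with the order, so D_0 is squeezed between D_r for r < 0 and r > 0. The Hausdorff
   dimension follows from a Chernoff bound with Borel-Cantelli, the mass distribution principle and a
   cover by heavy cubes. *)
theory Submission
  imports Defs
begin

section \<open>Exponential growth rates\<close>

text \<open>The analysis of \<open>crit\<close> rests on one inequality, \<open>beta_shift\<close>:
  for every s below \<open>dim_infty\<close>, \<beta> falls at least with slope s. Since s can be
  chosen above -r, the function q |-> \<beta> q - r q is strictly decreasing with rate s + r, so its
  sign determines the critical exponent and shows its left continuity in r. The obstacle is r < 0:
  the integrand is infinite at the codebook points, and the codebook is arbitrary. The shells around
  these points become summable once J is controlled for an order r' < r, which gains 2^(-(r - r') k)
  on level k. For the upper quantities left continuity of \<open>crit\<close> closes this gap; for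
  the lower entropy it survives as the left limit in \<open>lower_entropy_lim\<close>. Moreover J(Q)
  may then be realised by a subcube far below Q, and the codebook point has to be placed there.
  Estimates are made for exponents strictly beyond the critical ones. The slack swallows
  multiplicative constants and the roundings between n, x and levels; continuity of phi away from h
  = 1 removes it at the end.\<close>

definition upper_rate :: "(nat \<Rightarrow> real) \<Rightarrow> ereal" where
  "upper_rate a = limsup (\<lambda>n. ereal (ln (a n) / ln (2 ^ n)))"

definition lower_rate :: "(nat \<Rightarrow> real) \<Rightarrow> ereal" where
  "lower_rate a = liminf (\<lambda>n. ereal (ln (a n) / ln (2 ^ n)))"

text \<open>Level 0 is excluded because there the denominator ln 1 is 0 and the quotient takes the
  default value 0.\<close>

lemma ln_ratio_less_iff:
  fixes a :: real
  assumes "0 < n" "0 < a"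
  shows "ln a / ln (2 ^ n) < b \<longleftrightarrow> a < 2 powr (b * real n)"
    and "b < ln a / ln (2 ^ n) \<longleftrightarrow> 2 powr (b * real n) < a"
proof -
  have *: "ln (2 ^ n :: real) = real n * ln 2" by (simp add: ln_realpow)
  have pos: "0 < real n * ln 2" using assms by simp
  have "ln a / ln (2 ^ n) < b \<longleftrightarrow> ln a < b * real n * ln 2"
    unfolding * using pos by (simp add: divide_less_eq mult.assoc)
  also have "\<dots> \<longleftrightarrow> a < exp (b * real n * ln 2)"
    using assms by (metis exp_gt_zero exp_less_cancel_iff exp_ln)
  finally show "ln a / ln (2 ^ n) < b \<longleftrightarrow> a < 2 powr (b * real n)"
    by (simp add: powr_def)
  have "b < ln a / ln (2 ^ n) \<longleftrightarrow> b * real n * ln 2 < ln a"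
    unfolding * using pos by (simp add: less_divide_eq mult.assoc)
  also have "\<dots> \<longleftrightarrow> exp (b * real n * ln 2) < a"
    using assms by (metis exp_gt_zero exp_less_cancel_iff exp_ln)
  finally show "b < ln a / ln (2 ^ n) \<longleftrightarrow> 2 powr (b * real n) < a"
    by (simp add: powr_def)
qed

text \<open>A gap in the exponents beats every positive constant; this is how multiplicative
  constants disappear from growth rates.\<close>

lemma eventually_powr_less:
  fixes b b' c :: real
  assumes "b' < b" "0 < c"
  shows "\<forall>\<^sub>F n in sequentially. 2 powr (b' * real n) < c * 2 powr (b * real n)"
proof -
  define q where "q = 2 powr (b' - b)"
  have q: "0 < q" "q < 1" using assms unfolding q_def by (auto simp: powr_less_one)
  have "(\<lambda>n. q ^ n) \<longlonglongrightarrow> 0" using q by (intro LIMSEQ_power_zero) auto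
  then have "\<forall>\<^sub>F n in sequentially. q ^ n < c" using assms(2) by (rule order_tendstoD(2))
  then show ?thesis
  proof eventually_elim
    case (elim n)
    have "q ^ n = 2 powr (b' * real n) / 2 powr (b * real n)"
      unfolding q_def by (simp add: powr_diff[symmetric] powr_power algebra_simps)
    with elim show ?case by (simp add: divide_less_eq)
  qed
qed

lemma upper_rate_lessD:
  assumes "upper_rate a < ereal b" "\<And>n. 0 < a n"
  shows "\<forall>\<^sub>F n in sequentially. a n < 2 powr (b * real n)"
  using Limsup_lessD[OF assms(1)[unfolded upper_rate_def]] eventually_gt_at_top[of 0]
proof eventually_elim
  case (elim n)
  from elim(1) have "ln (a n) / ln (2 ^ n) < b" by (simp only: less_ereal.simps)
  with elim(2) assms(2)[of n] show ?case by (simp only: ln_ratio_less_iff)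
qed

lemma lower_rate_greaterD:
  assumes "ereal b < lower_rate a" "\<And>n. 0 < a n"
  shows "\<forall>\<^sub>F n in sequentially. 2 powr (b * real n) < a n"
  using less_LiminfD[OF assms(1)[unfolded lower_rate_def]] eventually_gt_at_top[of 0]
proof eventually_elim
  case (elim n)
  from elim(1) have "b < ln (a n) / ln (2 ^ n)" by (simp only: less_ereal.simps)
  with elim(2) assms(2)[of n] show ?case by (simp only: ln_ratio_less_iff)
qed

lemma upper_rate_greaterD:
  assumes "ereal b < upper_rate a" "\<And>n. 0 < a n"
  shows "\<exists>\<^sub>F n in sequentially. 2 powr (b * real n) < a n"
proof (rule ccontr)
  assume "\<not> ?thesis"
  then have "\<forall>\<^sub>F n in sequentially. \<not> 2 powr (b * real n) < a n"
    by (simp add: not_frequently)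
  then have "\<forall>\<^sub>F n in sequentially. ereal (ln (a n) / ln (2 ^ n)) \<le> ereal b"
    using eventually_gt_at_top[of 0]
  proof eventually_elim
    case (elim n)
    with assms(2)[of n] have "\<not> b < ln (a n) / ln (2 ^ n)" by (simp only: ln_ratio_less_iff) simp
    then show ?case by (simp only: ereal_less_eq not_less)
  qed
  then have "upper_rate a \<le> ereal b"
    unfolding upper_rate_def by (rule Limsup_bounded)
  with assms(1) show False by simp
qed

lemma upper_rate_geI:
  assumes "\<exists>\<^sub>F n in sequentially. c * 2 powr (b * real n) \<le> a n" "0 < c" "\<And>n. 0 < a n"
  shows "ereal b \<le> upper_rate a"
proof (rule ccontr)
  assume "\<not> ?thesis"
  then obtain b' where b': "upper_rate a < ereal b'" "b' < b"
    by (metis ereal_dense2 ereal_less(2) less_ereal.simps(1) not_le)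
  from upper_rate_lessD[OF b'(1) assms(3)] eventually_powr_less[OF b'(2) assms(2)]
  have "\<forall>\<^sub>F n in sequentially. \<not> c * 2 powr (b * real n) \<le> a n"
    by eventually_elim auto
  with assms(1) show False by (simp add: frequently_def)
qed

lemma upper_rate_leI:
  assumes "\<forall>\<^sub>F n in sequentially. a n \<le> c * 2 powr (b * real n)" "\<And>n. 0 < a n"
  shows "upper_rate a \<le> ereal b"
proof (rule ccontr)
  assume "\<not> ?thesis"
  then obtain b' where b': "ereal b' < upper_rate a" "b < b'"
    by (metis ereal_dense2 less_ereal.simps(1) not_le)
  \<comment> \<open>No sign is assumed for c, whereas \<open>eventually_powr_less\<close> asks for a
    positive factor.\<close>
  define c' where "c' = max c 1"
  have c': "0 < 1 / c'" unfolding c'_def by simp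
  have "\<forall>\<^sub>F n in sequentially. \<not> 2 powr (b' * real n) < a n"
    using assms(1) eventually_powr_less[OF b'(2) c']
  proof eventually_elim
    case (elim n)
    have "a n \<le> c' * 2 powr (b * real n)"
      using elim(1) by (smt (verit) c'_def mult_right_mono powr_ge_zero)
    also have "\<dots> \<le> 2 powr (b' * real n)"
      using elim(2) c' by (simp add: field_simps)
    finally show ?case by simp
  qed
  with upper_rate_greaterD[OF b'(1) assms(2)] show False by (simp add: frequently_def)
qed

section \<open>Geometry of dyadic cubes\<close>

text \<open>Right-closed intervals lead to the ceiling: x lies in (k / 2^n, (k + 1) / 2^n] exactly
  if the ceiling of 2^n x is k + 1, hence the shift by one.\<close>

definition cube_at :: "nat \<Rightarrow> real ^ 'd \<Rightarrow> (real ^ 'd) set" where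
  "cube_at n x = dyadic_cube n (\<chi> i. \<lceil>2 ^ n * x $ i\<rceil> - 1)"

lemma mem_dyadic_cube_iff: "x \<in> dyadic_cube n k \<longleftrightarrow> (\<chi> i. \<lceil>2 ^ n * x $ i\<rceil> - 1) = k"
proof -
  have "of_int (k $ i) / 2 ^ n < x $ i \<and> x $ i \<le> (of_int (k $ i) + 1) / 2 ^ n
      \<longleftrightarrow> \<lceil>2 ^ n * x $ i\<rceil> = k $ i + 1" for i
    by (auto simp: ceiling_eq_iff field_simps)
  then show ?thesis
    unfolding dyadic_cube_def by (auto simp: vec_eq_iff diff_eq_eq)
qed

lemma mem_cube_at: "x \<in> cube_at n x"
  by (simp add: cube_at_def mem_dyadic_cube_iff)

lemma mem_cube_at_iff: "y \<in> cube_at n x \<longleftrightarrow> (\<forall>i. \<lceil>2 ^ n * y $ i\<rceil> = \<lceil>2 ^ n * x $ i\<rceil>)"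
  by (simp add: cube_at_def mem_dyadic_cube_iff vec_eq_iff)

lemma cube_at_eq: "y \<in> cube_at n x \<Longrightarrow> cube_at n y = cube_at n x"
  by (simp add: cube_at_def mem_dyadic_cube_iff)

text \<open>The index of a dyadic interval determines that of its parent by an integer division.
  This is the reason why the cubes are nested.\<close>

lemma ceiling_half: "\<lceil>u\<rceil> = (\<lceil>2 * u\<rceil> + 1) div 2" for u :: real
proof (rule ceiling_unique)
  define c where "c = \<lceil>2 * u\<rceil>"
  have c: "of_int c - 1 < 2 * u" "2 * u \<le> of_int c"
    unfolding c_def by linarith+
  have "2 * ((c + 1) div 2) \<le> c + 1" "c \<le> 2 * ((c + 1) div 2)" by presburger+
  then have "real_of_int (2 * ((c + 1) div 2)) \<le> real_of_int (c + 1)"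
       "real_of_int c \<le> real_of_int (2 * ((c + 1) div 2))"
    by (simp_all only: of_int_le_iff)
  with c have "of_int ((c + 1) div 2) - 1 < u" "u \<le> of_int ((c + 1) div 2)"
    unfolding of_int_mult of_int_add by (linarith+)
  then show "of_int ((\<lceil>2 * u\<rceil> + 1) div 2) - 1 < u" "u \<le> of_int ((\<lceil>2 * u\<rceil> + 1) div 2)"
    unfolding c_def .
qed

lemma cube_at_antimono:
  assumes "m \<le> n"
  shows "cube_at n x \<subseteq> cube_at m x"
  using assms
proof (induction n rule: dec_induct)
  case (step n)
  have "cube_at (Suc n) x \<subseteq> cube_at n x"
  proof
    fix y assume "y \<in> cube_at (Suc n) x"
    then have "\<lceil>2 ^ Suc n * y $ i\<rceil> = \<lceil>2 ^ Suc n * x $ i\<rceil>" for i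
      by (simp only: mem_cube_at_iff)
    then have "\<lceil>2 ^ n * y $ i\<rceil> = \<lceil>2 ^ n * x $ i\<rceil>" for i
      using ceiling_half[of "2 ^ n * y $ i"] ceiling_half[of "2 ^ n * x $ i"]
      by (simp add: mult.assoc)
    then show "y \<in> cube_at n x" by (simp add: mem_cube_at_iff)
  qed
  with step.IH show ?case by blast
qed simp

lemma cube_at_0: "x \<in> half_open_unit_cube \<Longrightarrow> cube_at 0 x = half_open_unit_cube"
proof -
  assume "x \<in> half_open_unit_cube"
  then have x: "\<lceil>x $ i\<rceil> = 1" for i
    by (simp add: half_open_unit_cube_def ceiling_eq_iff)
  show ?thesis
    by (auto simp: mem_cube_at_iff x half_open_unit_cube_def ceiling_eq_iff)
qed

lemma cube_at_in_dyadic_cubes: "x \<in> half_open_unit_cube \<Longrightarrow> cube_at n x \<in> dyadic_cubes n"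
  using cube_at_antimono[of 0 n x] cube_at_0[of x]
  by (auto simp: dyadic_cubes_def cube_at_def)

lemma dyadic_cube_eq_cube_at: "Q \<in> dyadic_cubes n \<Longrightarrow> x \<in> Q \<Longrightarrow> Q = cube_at n x"
  by (auto simp: dyadic_cubes_def cube_at_def mem_dyadic_cube_iff)

lemma dyadic_cubes_subset: "Q \<in> dyadic_cubes n \<Longrightarrow> Q \<subseteq> half_open_unit_cube"
  by (simp add: dyadic_cubes_def)

lemma dyadic_cubes_nonempty:
  assumes "Q \<in> dyadic_cubes n"
  obtains x where "x \<in> Q" "x \<in> half_open_unit_cube" "Q = cube_at n x"
proof -
  obtain k where k: "Q = dyadic_cube n k" using assms by (auto simp: dyadic_cubes_def)
  \<comment> \<open>The upper corner belongs to a right-closed cube.\<close>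
  have "(\<chi> i. (of_int (k $ i) + 1) / 2 ^ n) \<in> Q"
    unfolding k dyadic_cube_def by (auto simp: divide_strict_right_mono)
  with that[OF this] assms show ?thesis
    using dyadic_cube_eq_cube_at dyadic_cubes_subset by blast
qed

lemma dyadic_cubes_conv: "dyadic_cubes n = cube_at n ` half_open_unit_cube"
  using dyadic_cubes_nonempty cube_at_in_dyadic_cubes by blast

lemma dyadic_cubes_nested:
  assumes "Q \<in> dyadic_cubes m" "Q' \<in> dyadic_cubes n" "m \<le> n" "x \<in> Q" "x \<in> Q'"
  shows "Q' \<subseteq> Q"
  using assms cube_at_antimono dyadic_cube_eq_cube_at by blast

lemma disjoint_dyadic_cubes: "disjoint (dyadic_cubes n)"
proof (rule disjointI)
  fix a b assume ab: "a \<in> dyadic_cubes n" "b \<in> dyadic_cubes n" "a \<noteq> b"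
  show "a \<inter> b = {}"
  proof (rule ccontr)
    assume "a \<inter> b \<noteq> {}"
    then obtain x where "x \<in> a" "x \<in> b" by blast
    with ab dyadic_cube_eq_cube_at[of a n x] dyadic_cube_eq_cube_at[of b n x] show False by simp
  qed
qed

lemma dyadic_cubes_0: "dyadic_cubes 0 = {half_open_unit_cube :: (real ^ 'd) set}"
proof -
  have "(1 :: real ^ 'd) \<in> half_open_unit_cube" by (simp add: half_open_unit_cube_def)
  then show ?thesis unfolding dyadic_cubes_conv using cube_at_0 by blast
qed

lemma sets_dyadic_cube: "dyadic_cube n k \<in> sets borel"
proof -
  have "dyadic_cube n k = (\<Inter>i. {x. of_int (k $ i) / 2 ^ n < x $ i} \<inter> {x. x $ i \<le> (of_int (k $ i) + 1) / 2 ^ n})"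
    by (auto simp: dyadic_cube_def)
  also have "\<dots> \<in> sets borel"
    by (intro sets.finite_INT sets.Int borel_open borel_closed open_Collect_less closed_Collect_le
        continuous_intros) auto
  finally show ?thesis .
qed

lemma sets_dyadic_cubes: "Q \<in> dyadic_cubes n \<Longrightarrow> Q \<in> sets borel"
  using sets_dyadic_cube by (auto simp: dyadic_cubes_def)

lemma sets_half_open_unit_cube: "half_open_unit_cube \<in> sets borel"
  by (rule sets_dyadic_cubes[of _ 0]) (simp add: dyadic_cubes_0)

section \<open>Volumes of cubes and packing bounds\<close>

lemma content_cbox_vec:
  fixes l u :: "real ^ 'd"
  assumes "\<And>i. l $ i \<le> u $ i"
  shows "emeasure lborel (cbox l u) = ennreal (\<Prod>i\<in>UNIV. u $ i - l $ i)"
proof -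
  have "cbox l u \<noteq> {}" using assms by (auto simp: interval_ne_empty_cart)
  then have "measure lborel (cbox l u) = (\<Prod>i\<in>UNIV. u $ i - l $ i)"
    by (rule content_cbox_cart)
  then show ?thesis
    using emeasure_lborel_cbox_finite[of l u]
    by (simp add: emeasure_eq_ennreal_measure less_top)
qed

text \<open>The faces are null: the cube lies between an open and a closed box of the same
  volume.\<close>

lemma emeasure_lborel_dyadic_cube:
  "emeasure lborel (dyadic_cube n k :: (real ^ 'd) set) = ennreal ((1 / 2 ^ n) ^ CARD('d))"
proof -
  define l u :: "real ^ 'd"
    where "l = (\<chi> i. of_int (k $ i) / 2 ^ n)" and "u = (\<chi> i. (of_int (k $ i) + 1) / 2 ^ n)"
  have lu: "l $ i \<le> u $ i" for i unfolding l_def u_def by (simp add: divide_right_mono)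
  have "(\<Prod>i\<in>UNIV. u $ i - l $ i) = (1 / 2 ^ n) ^ CARD('d)"
    unfolding l_def u_def by (simp add: diff_divide_distrib[symmetric])
  then have c: "emeasure lborel (cbox l u) = ennreal ((1 / 2 ^ n) ^ CARD('d))"
    using content_cbox_vec[OF lu] by simp
  have "\<And>b. b \<in> Basis \<Longrightarrow> l \<bullet> b \<le> u \<bullet> b"
    using lu by (auto simp: Basis_vec_def inner_axis)
  then have b: "emeasure lborel (box l u) = emeasure lborel (cbox l u)"
    by (simp add: emeasure_lborel_box emeasure_lborel_cbox)
  have "box l u \<subseteq> dyadic_cube n k" "dyadic_cube n k \<subseteq> cbox l u"
    by (auto simp: mem_box_cart dyadic_cube_def l_def u_def less_imp_le)
  then have "emeasure lborel (box l u) \<le> emeasure lborel (dyadic_cube n k)"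
    "emeasure lborel (dyadic_cube n k) \<le> emeasure lborel (cbox l u)"
    using sets_dyadic_cube by (auto intro!: emeasure_mono)
  with b c show ?thesis by simp
qed

lemma measure_lborel_dyadic_cubes:
  "Q \<in> dyadic_cubes n \<Longrightarrow> measure lborel (Q :: (real ^ 'd) set) = (1 / 2 ^ n) ^ CARD('d)"
  unfolding dyadic_cubes_def by (auto simp: measure_def emeasure_lborel_dyadic_cube)

lemma measure_lborel_powr:
  assumes "(Q :: (real ^ 'd) set) \<in> dyadic_cubes n"
  shows "measure lborel Q powr (r / real CARD('d)) = 2 powr (- (real n * r))"
proof -
  have "1 / 2 ^ n = (2::real) powr (- real n)"
    by (simp add: powr_minus powr_realpow divide_inverse)
  then have "measure lborel Q = 2 powr (- real n * real CARD('d))"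
    unfolding measure_lborel_dyadic_cubes[OF assms] by (simp only: powr_power) (simp add: mult.commute)
  then have "measure lborel Q powr (r / real CARD('d)) = 2 powr (- real n * real CARD('d) * (r / real CARD('d)))"
    by (simp only: powr_powr)
  also have "- real n * real CARD('d) * (r / real CARD('d)) = - (real n * r)" by simp
  finally show ?thesis .
qed

text \<open>Packing by volume: disjoint cubes of volume 2^(-nd) inside B. The bound is proved for
  finite subfamilies because finiteness of F is itself part of the conclusion. It yields the number
  of all cubes of a level, of children, and of cubes near a point.\<close>

lemma card_cubes_le:
  fixes F :: "(real ^ 'd) set set"
  assumes F: "F \<subseteq> dyadic_cubes n" and sub: "\<And>Q. Q \<in> F \<Longrightarrow> Q \<subseteq> B"
    and B: "B \<in> sets lborel" "emeasure lborel B \<le> ennreal (real K * (1 / 2 ^ n) ^ CARD('d))"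
  shows "finite F \<and> card F \<le> K"
proof (rule finite_if_finite_subsets_card_bdd)
  fix G assume G: "G \<subseteq> F" "finite G"
  have GQ: "Q \<in> dyadic_cubes n" if "Q \<in> G" for Q using that G F by auto
  have e: "emeasure lborel Q = ennreal ((1 / 2 ^ n) ^ CARD('d))" if "Q \<in> G" for Q
    using GQ[OF that] by (auto simp: dyadic_cubes_def emeasure_lborel_dyadic_cube)
  have "disjoint_family_on (\<lambda>Q. Q) G"
    using disjoint_dyadic_cubes[of n] GQ unfolding disjoint_family_on_def disjoint_def by blast
  then have "(\<Sum>Q\<in>G. emeasure lborel Q) = emeasure lborel (\<Union>Q\<in>G. Q)"
    using G(2) GQ sets_dyadic_cubes by (intro sum_emeasure) auto
  also have "\<dots> \<le> emeasure lborel B"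
    using sub G(1) B by (intro emeasure_mono) auto
  also note B(2)
  finally have "ennreal (real (card G) * (1 / 2 ^ n) ^ CARD('d)) \<le> ennreal (real K * (1 / 2 ^ n) ^ CARD('d))"
    using e by (simp add: ennreal_mult ennreal_of_nat_eq_real_of_nat)
  then have "real (card G) * (1 / 2 ^ n) ^ CARD('d) \<le> real K * (1 / 2 ^ n) ^ CARD('d)"
    by (subst (asm) ennreal_le_iff) auto
  then have "real (card G) \<le> real K" by (simp add: field_simps)
  then show "card G \<le> K" by simp
qed

lemma card_dyadic_cubes:
  "finite (dyadic_cubes n :: (real ^ 'd) set set)"
  "card (dyadic_cubes n :: (real ^ 'd) set set) \<le> 2 ^ (n * CARD('d))"
proof -
  have "emeasure lborel (half_open_unit_cube :: (real ^ 'd) set) = 1"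
  proof -
    have "(half_open_unit_cube :: (real ^ 'd) set) \<in> dyadic_cubes 0" by (simp add: dyadic_cubes_0)
    then obtain k where "(half_open_unit_cube :: (real ^ 'd) set) = dyadic_cube 0 k"
      unfolding dyadic_cubes_def by blast
    then show ?thesis using emeasure_lborel_dyadic_cube[of 0 k] by simp
  qed
  moreover have "real (2 ^ (n * CARD('d))) * (1 / 2 ^ n) ^ CARD('d) = 1"
  proof -
    define p :: real where "p = 2 ^ n"
    have "real (2 ^ (n * CARD('d))) = p ^ CARD('d)" unfolding p_def by (simp add: power_mult)
    then show ?thesis unfolding p_def[symmetric] by (simp add: power_one_over) (simp add: p_def)
  qed
  ultimately have "finite (dyadic_cubes n :: (real ^ 'd) set set) \<and> card (dyadic_cubes n :: (real ^ 'd) set set) \<le> 2 ^ (n * CARD('d))"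
    using sets_half_open_unit_cube dyadic_cubes_subset by (intro card_cubes_le) auto
  then show "finite (dyadic_cubes n :: (real ^ 'd) set set)"
  "card (dyadic_cubes n :: (real ^ 'd) set set) \<le> 2 ^ (n * CARD('d))" by auto
qed

declare card_dyadic_cubes(1) [simp]

lemma card_dyadic_cubes_powr:
  "real (card (dyadic_cubes n :: (real ^ 'd) set set)) \<le> 2 powr (real CARD('d) * real n)"
proof -
  have "real (card (dyadic_cubes n :: (real ^ 'd) set set)) \<le> real (2 ^ (n * CARD('d)))"
    using card_dyadic_cubes(2) by (intro of_nat_mono)
  also have "\<dots> = 2 powr (real (n * CARD('d)))" by (subst powr_realpow) auto
  also have "\<dots> = 2 powr (real CARD('d) * real n)" by (simp add: mult.commute)
  finally show ?thesis .
qed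

lemma card_children:
  assumes "(Q :: (real ^ 'd) set) \<in> dyadic_cubes n"
  shows "card {Q' \<in> dyadic_cubes (Suc n). Q' \<subseteq> Q} \<le> 2 ^ CARD('d)"
proof -
  have "emeasure lborel Q = ennreal ((1 / 2 ^ n) ^ CARD('d))"
    using assms by (auto simp: dyadic_cubes_def emeasure_lborel_dyadic_cube)
  moreover have "(1 / 2 ^ n) ^ CARD('d) = real (2 ^ CARD('d)) * (1 / 2 ^ Suc n) ^ CARD('d)"
  proof -
    have "(1 / 2 ^ n :: real) = 2 * (1 / 2 ^ Suc n)" by simp
    then have "(1 / 2 ^ n :: real) ^ CARD('d) = 2 ^ CARD('d) * (1 / 2 ^ Suc n) ^ CARD('d)"
      by (simp only: power_mult_distrib)
    then show ?thesis by (simp only: of_nat_power of_nat_numeral)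
  qed
  ultimately have e: "emeasure lborel Q \<le> ennreal (real (2 ^ CARD('d)) * (1 / 2 ^ Suc n) ^ CARD('d))"
    by (simp only: order_refl)
  have "finite {Q' \<in> dyadic_cubes (Suc n). Q' \<subseteq> Q} \<and> card {Q' \<in> dyadic_cubes (Suc n). Q' \<subseteq> Q} \<le> 2 ^ CARD('d)"
    by (rule card_cubes_le[OF _ _ _ e]) (use assms sets_dyadic_cubes in auto)
  then show ?thesis ..
qed

text \<open>Made for a dichotomy at scale 2^(-n): a point within 2^(-n) of a in all coordinates has
  its cube here, and every point of a cube outside differs from a by at least 2^(-n) in some
  coordinate.\<close>

definition near_cubes :: "nat \<Rightarrow> real ^ 'd \<Rightarrow> (real ^ 'd) set set" where
  "near_cubes n a = {Q \<in> dyadic_cubes n. \<exists>x\<in>Q. \<forall>i. \<bar>x $ i - a $ i\<bar> < 1 / 2 ^ n}"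

lemma dyadic_cubes_dist:
  assumes "Q \<in> dyadic_cubes n" "x \<in> Q" "y \<in> Q"
  shows "\<bar>x $ i - y $ i\<bar> \<le> 1 / 2 ^ n"
proof -
  obtain k where "Q = dyadic_cube n k" using assms by (auto simp: dyadic_cubes_def)
  with assms have "of_int (k $ i) / 2 ^ n < x $ i" "x $ i \<le> (of_int (k $ i) + 1) / 2 ^ n"
    "of_int (k $ i) / 2 ^ n < y $ i" "y $ i \<le> (of_int (k $ i) + 1) / 2 ^ n"
    by (auto simp: dyadic_cube_def)
  then show ?thesis by (simp add: add_divide_distrib)
qed

lemma card_near_cubes:
  fixes a :: "real ^ 'd"
  shows "finite (near_cubes n a)" "card (near_cubes n a) \<le> 4 ^ CARD('d)"
proof -
  define e :: real where "e = 1 / 2 ^ n"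
  have e: "0 \<le> e" unfolding e_def by simp
  \<comment> \<open>A near cube has side e and a point within e of a, so it stays within 2 e of a.
    The box of side 4 e has room for 4 ^ d cubes.\<close>
  define l u where "l = (\<chi> i. a $ i - 2 * e)" and "u = (\<chi> i. a $ i + 2 * e)"
  have "emeasure lborel (cbox l u) = ennreal (\<Prod>i\<in>(UNIV::'d set). u $ i - l $ i)"
    unfolding l_def u_def by (rule content_cbox_vec) (simp add: e)
  also have "(\<Prod>i\<in>(UNIV::'d set). u $ i - l $ i) = real (4 ^ CARD('d)) * e ^ CARD('d)"
    unfolding l_def u_def by (simp add: power_mult_distrib)
  finally have m: "emeasure lborel (cbox l u) \<le> ennreal (real (4 ^ CARD('d)) * (1 / 2 ^ n) ^ CARD('d))"
    unfolding e_def by simp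
  have "Q \<subseteq> cbox l u" if "Q \<in> near_cubes n a" for Q
  proof
    fix y assume y: "y \<in> Q"
    from that obtain x where Q: "Q \<in> dyadic_cubes n" "x \<in> Q" and x: "\<And>i. \<bar>x $ i - a $ i\<bar> < e"
      unfolding near_cubes_def e_def by auto
    have "\<bar>y $ i - a $ i\<bar> \<le> 2 * e" for i
      using dyadic_cubes_dist[OF Q(1) y Q(2), of i] x[of i] unfolding e_def[symmetric] by linarith
    then show "y \<in> cbox l u" unfolding l_def u_def mem_box_cart by (simp add: abs_le_iff algebra_simps)
  qed
  then have "finite (near_cubes n a) \<and> card (near_cubes n a) \<le> 4 ^ CARD('d)"
    using m by (intro card_cubes_le) (auto simp: near_cubes_def)
  then show "finite (near_cubes n a)" "card (near_cubes n a) \<le> 4 ^ CARD('d)" by auto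
qed

section \<open>The spectrum of a measure of positive lower dimension\<close>

lemma Union_dyadic_cubes: "\<Union>(dyadic_cubes n) = half_open_unit_cube"
proof
  show "\<Union>(dyadic_cubes n) \<subseteq> half_open_unit_cube"
    using dyadic_cubes_subset by (intro Union_least)
  show "half_open_unit_cube \<subseteq> \<Union>(dyadic_cubes n)"
    using cube_at_in_dyadic_cubes mem_cube_at by (intro subsetI) (rule UnionI)
qed

text \<open>Cubes are bare sets that carry no level; comparing volumes recovers the order of the
  levels.\<close>

lemma level_le_of_subset:
  assumes "Q' \<in> dyadic_cubes m" "Q \<in> dyadic_cubes n" "(Q' :: (real ^ 'd) set) \<subseteq> Q"
  shows "n \<le> m"
proof -
  have f: "emeasure lborel Q < \<infinity>"
    using assms(2) unfolding dyadic_cubes_def by (auto simp: emeasure_lborel_dyadic_cube)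
  have "Q \<in> fmeasurable lborel"
    using f sets_dyadic_cubes[OF assms(2)] by (intro fmeasurableI) auto
  then have "measure lborel Q' \<le> measure lborel Q"
    using assms sets_dyadic_cubes[OF assms(1)] by (intro measure_mono_fmeasurable) auto
  then have "(1 / 2 ^ m :: real) ^ CARD('d) \<le> (1 / 2 ^ n) ^ CARD('d)"
    by (simp only: measure_lborel_dyadic_cubes[OF assms(1)] measure_lborel_dyadic_cubes[OF assms(2)])
  then have "(1 / 2 ^ m :: real) \<le> 1 / 2 ^ n"
    by (subst (asm) power_mono_iff) auto
  then have "(2::real) ^ n \<le> 2 ^ m" by (simp add: field_simps)
  then show ?thesis by simp
qed

lemma powr_level: "2 powr (- (c * real n)) = (2 powr (- c)) ^ n" for c :: real
  by (simp add: powr_power mult.commute)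

lemma sum_geometric_tail_le:
  fixes x :: real
  assumes "0 < x" "x < 1"
  shows "(\<Sum>k=n..L. x ^ k) \<le> x ^ n / (1 - x)"
  using assms by (auto simp: sum_gp intro!: divide_right_mono)

definition weight :: "(real ^ 'd) measure \<Rightarrow> real \<Rightarrow> (real ^ 'd) set \<Rightarrow> real" where
  "weight \<nu> r Q = measure \<nu> Q * measure lborel Q powr (r / real CARD('d))"

lemma weight_eq: "Q \<in> dyadic_cubes n \<Longrightarrow> weight \<nu> r Q = measure \<nu> Q * 2 powr (- (real n * r))"
  unfolding weight_def by (simp add: measure_lborel_powr)

lemma weight_nonneg: "0 \<le> weight \<nu> r Q"
  unfolding weight_def by simp

lemma part_fun_eq_SUP_weight: "part_fun \<nu> r Q = (SUP Q'\<in>dyadic_subcubes Q. weight \<nu> r Q')"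
  unfolding part_fun_def weight_def ..

text \<open>Cubes of measure 0 may stay in the sum: \<open>0 powr q = 0\<close> for every q,
  including q = 0.\<close>

definition moment_sum :: "(real ^ 'd) measure \<Rightarrow> nat \<Rightarrow> real \<Rightarrow> real" where
  "moment_sum \<nu> n q = (\<Sum>Q\<in>dyadic_cubes n. measure \<nu> Q powr q)"

definition part_moment_sum :: "(real ^ 'd) measure \<Rightarrow> real \<Rightarrow> nat \<Rightarrow> real \<Rightarrow> real" where
  "part_moment_sum \<nu> r n q = (\<Sum>Q\<in>dyadic_cubes n. part_fun \<nu> r Q powr q)"

locale quant_measure = prob_space \<nu> for \<nu> :: "(real ^ 'd) measure" +
  assumes sets_nu: "sets \<nu> = sets borel"
    and conc: "measure \<nu> half_open_unit_cube = 1"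
    and dim_pos: "dim_infty \<nu> > 0"
begin

abbreviation "admissible r \<equiv> - dim_infty \<nu> < ereal r"

lemma sets_nu_cubes: "Q \<in> dyadic_cubes n \<Longrightarrow> Q \<in> sets \<nu>"
  using sets_dyadic_cubes sets_nu by blast

lemma sum_measure_cubes: "(\<Sum>Q\<in>dyadic_cubes n. measure \<nu> Q) = 1"
proof -
  have "(\<Sum>Q\<in>dyadic_cubes n. measure \<nu> Q) = measure \<nu> (\<Union>Q\<in>dyadic_cubes n. Q)"
    using sets_nu_cubes disjoint_dyadic_cubes[of n]
    by (intro finite_measure_finite_Union[symmetric]) (auto simp: disjoint_family_on_def disjoint_def)
  also have "(\<Union>Q\<in>dyadic_cubes n. Q) = half_open_unit_cube"
    using Union_dyadic_cubes by simp
  finally show ?thesis by (simp add: conc)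
qed

lemma measure_le_1: "measure \<nu> A \<le> 1" by (rule prob_le_1)

lemma exists_charged_cube: "\<exists>Q\<in>dyadic_cubes n. 0 < measure \<nu> Q"
proof (rule ccontr)
  assume "\<not> ?thesis"
  then have "(\<Sum>Q\<in>dyadic_cubes n. measure \<nu> Q) = 0"
    by (intro sum.neutral) (auto simp: not_less measure_le_0_iff)
  then show False by (simp add: sum_measure_cubes)
qed

text \<open>The liminf in \<open>dim_infty\<close> bounds the largest cube from some level on; C
  makes the bound uniform over all levels.\<close>

lemma measure_decay:
  assumes s: "ereal s < dim_infty \<nu>"
  obtains C where "1 \<le> C" "\<And>n Q. Q \<in> dyadic_cubes n \<Longrightarrow> measure \<nu> Q \<le> C * 2 powr (- (s * real n))"
proof -
  from less_LiminfD[OF s[unfolded dim_infty_def]] obtain n0 where n0: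
    "\<And>n. n0 \<le> n \<Longrightarrow> s < Max ((\<lambda>Q. ln (measure \<nu> Q)) ` {Q \<in> dyadic_cubes n. measure \<nu> Q > 0}) / ln (2 powr (- real n))"
    unfolding eventually_sequentially by auto
  \<comment> \<open>On the first levels the bound comes from total mass 1, so C has to outweigh 2
    powr (- (s n)) up to level n0, for either sign of s.\<close>
  define C where "C = 2 powr (\<bar>s\<bar> * real n0)"
  have C: "1 \<le> C" unfolding C_def by (rule ge_one_powr_ge_zero) auto
  have "measure \<nu> Q \<le> C * 2 powr (- (s * real n))" if Q: "Q \<in> dyadic_cubes n" for n Q
  \<comment> \<open>The strict inequality also excludes level 0, where the denominator in
    \<open>dim_infty\<close> vanishes.\<close>
  proof (cases "n0 < n \<and> 0 < measure \<nu> Q")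
    case True
    let ?M = "Max ((\<lambda>Q. ln (measure \<nu> Q)) ` {Q \<in> dyadic_cubes n. measure \<nu> Q > 0})"
    have l: "ln (2 powr (- real n)) = - (real n * ln 2)" by (simp add: ln_powr)
    have npos: "0 < real n * ln 2" using True by simp
    have "s < ?M / (- (real n * ln 2))" using n0[of n] True unfolding l by simp
    then have "?M < - (s * (real n * ln 2))"
      using npos by (simp only: less_divide_eq) (simp add: algebra_simps)
    moreover have "ln (measure \<nu> Q) \<le> ?M"
      using True Q by (intro Max_ge) auto
    ultimately have "ln (measure \<nu> Q) \<le> - (s * real n) * ln 2" by simp
    then have "measure \<nu> Q \<le> 2 powr (- (s * real n))"
      using True by (simp add: powr_def ln_ge_iff ln_le_cancel_iff[symmetric] del: ln_le_cancel_iff)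
    also have "\<dots> \<le> C * 2 powr (- (s * real n))" using C by simp
    finally show ?thesis .
  next
    case False
    show ?thesis
    proof (cases "0 < measure \<nu> Q")
      case True
      with False have n: "n \<le> n0" by simp
      have "s * real n \<le> \<bar>s\<bar> * real n0" using n by (intro mult_mono) auto
      then have "1 \<le> 2 powr (\<bar>s\<bar> * real n0 + - (s * real n))" by (intro ge_one_powr_ge_zero) auto
      also have "\<dots> = C * 2 powr (- (s * real n))" unfolding C_def powr_add ..
      finally show ?thesis by (rule order_trans[OF measure_le_1])
    next
      case False
      then have "measure \<nu> Q = 0" by (simp add: zero_less_measure_iff)
      then show ?thesis using C by simp
    qed
  qed
  with C that show ?thesis by blast
qed

text \<open>The number s + r > 0 is the decay rate of the weights and the rate at which q |->
  \<beta> q - r q decreases.\<close>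

lemma dim_infty_dense:
  assumes "admissible r"
  obtains s where "0 < s" "0 < s + r" "ereal s < dim_infty \<nu>"
proof -
  have "ereal (- r) < dim_infty \<nu>" using assms by (metis ereal_minus_less_minus ereal_uminus_uminus uminus_ereal.simps(1))
  with dim_pos have "ereal (max 0 (- r)) < dim_infty \<nu>" by (auto simp: max_def zero_ereal_def)
  then obtain s where "ereal (max 0 (- r)) < ereal s" "ereal s < dim_infty \<nu>"
    using ereal_dense2 by blast
  then show ?thesis by (intro that[of s]) auto
qed

section \<open>Moment sums and the spectrum on the nonnegative half line\<close>

lemma moment_sum_pos: "0 < moment_sum \<nu> n q"
proof -
  obtain Q where Q: "Q \<in> dyadic_cubes n" "0 < measure \<nu> Q" using exists_charged_cube by blast
  then have "0 < measure \<nu> Q powr q" by simp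
  also have "\<dots> \<le> moment_sum \<nu> n q"
    unfolding moment_sum_def using Q by (intro member_le_sum) auto
  finally show ?thesis .
qed

lemma Lq_spectrum_eq_rate: "Lq_spectrum \<nu> q = upper_rate (\<lambda>n. moment_sum \<nu> n q)"
proof -
  have "(\<Sum>Q\<in>{Q \<in> dyadic_cubes n. measure \<nu> Q > 0}. measure \<nu> Q powr q) = moment_sum \<nu> n q" for n
    unfolding moment_sum_def 
    by (intro sum.mono_neutral_left) (auto simp: zero_less_measure_iff)
  then show ?thesis unfolding Lq_spectrum_def upper_rate_def by simp
qed

lemma moment_sum_1: "moment_sum \<nu> n 1 = 1"
  unfolding moment_sum_def by (simp add: sum_measure_cubes)

text \<open>Hoelder's inequality up to the factor 2, by cutting at the mass e that a cube has under
  the uniform distribution. Lighter cubes give at most e powr q each, heavier ones at most m e powr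
  (q - 1), and both groups sum to the same power of 2.\<close>

lemma moment_sum_upper:
  assumes "0 \<le> q" "q \<le> 1"
  shows "moment_sum \<nu> n q \<le> 2 * 2 powr (real CARD('d) * (1 - q) * real n)"
proof -
  define e where "e = 2 powr (- (real CARD('d) * real n))"
  have e: "0 < e" unfolding e_def by simp
  have "measure \<nu> Q powr q \<le> e powr q + measure \<nu> Q * e powr (q - 1)" for Q
  proof (cases "measure \<nu> Q \<le> e")
    case True
    then have "measure \<nu> Q powr q \<le> e powr q" using assms by (intro powr_mono2) auto
    then show ?thesis by (smt (verit) measure_nonneg mult_nonneg_nonneg powr_ge_zero)
  next
    case False
    with e have p: "0 < measure \<nu> Q" by linarith
    have "measure \<nu> Q powr q = measure \<nu> Q * measure \<nu> Q powr (q - 1)"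
      using p by (simp add: powr_mult_base)
    also have "\<dots> \<le> measure \<nu> Q * e powr (q - 1)"
      using False assms e p by (intro mult_left_mono powr_mono2') auto
    finally show ?thesis by (smt (verit) powr_ge_zero)
  qed
  then have "moment_sum \<nu> n q \<le> (\<Sum>Q\<in>dyadic_cubes n. e powr q + measure \<nu> Q * e powr (q - 1))"
    unfolding moment_sum_def by (intro sum_mono)
  also have "\<dots> = real (card (dyadic_cubes n :: (real ^ 'd) set set)) * e powr q + e powr (q - 1)"
    by (simp add: sum.distrib sum_distrib_right[symmetric] sum_measure_cubes)
  also have "\<dots> \<le> 2 powr (real CARD('d) * real n) * e powr q + e powr (q - 1)"
    by (intro add_right_mono mult_right_mono card_dyadic_cubes_powr) simp
  also have "2 powr (real CARD('d) * real n) * e powr q = 2 powr (real CARD('d) * (1 - q) * real n)"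
    unfolding e_def by (simp add: powr_powr powr_add[symmetric] algebra_simps)
  also have "e powr (q - 1) = 2 powr (real CARD('d) * (1 - q) * real n)"
    unfolding e_def by (simp add: powr_powr algebra_simps)
  finally show ?thesis by simp
qed

text \<open>Each term satisfies m powr q \<ge> (m - e) e powr (q - 1), trivially so if m \<le> e;
  the right side is linear in m and can be summed.\<close>

lemma moment_sum_lower:
  assumes "1 \<le> q"
  shows "(1/2) powr q * 2 powr (- (real CARD('d) * (q - 1)) * real n) \<le> moment_sum \<nu> n q"
proof -
  \<comment> \<open>Half of the uniform mass: subtracting e on at most 2 ^ (d n) cubes costs at most
    half of the total mass.\<close>
  define e where "e = 2 powr (- (real CARD('d) * real n)) / 2"
  have e: "0 < e" unfolding e_def by simp
  have "(measure \<nu> Q - e) * e powr (q - 1) \<le> measure \<nu> Q powr q" for Q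
  proof (cases "measure \<nu> Q \<le> e")
    case True
    then have "(measure \<nu> Q - e) * e powr (q - 1) \<le> 0" by (intro mult_nonpos_nonneg) auto
    then show ?thesis by (smt (verit) powr_ge_zero)
  next
    case False
    with e have p: "0 < measure \<nu> Q" by linarith
    have "(measure \<nu> Q - e) * e powr (q - 1) \<le> measure \<nu> Q * measure \<nu> Q powr (q - 1)"
      using False assms e p by (intro mult_mono powr_mono2) auto
    also have "\<dots> = measure \<nu> Q powr q" using p by (simp add: powr_mult_base)
    finally show ?thesis .
  qed
  then have "(\<Sum>Q\<in>dyadic_cubes n. (measure \<nu> Q - e) * e powr (q - 1)) \<le> moment_sum \<nu> n q"
    unfolding moment_sum_def by (intro sum_mono)
  moreover have "(\<Sum>Q\<in>dyadic_cubes n. (measure \<nu> Q - e) * e powr (q - 1))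
      = (1 - real (card (dyadic_cubes n :: (real ^ 'd) set set)) * e) * e powr (q - 1)"
    by (simp add: sum_subtractf sum_distrib_right[symmetric] sum_measure_cubes)
  moreover have "real (card (dyadic_cubes n :: (real ^ 'd) set set)) \<le> 2 powr (real CARD('d) * real n)"
    by (rule card_dyadic_cubes_powr)
  then have "real (card (dyadic_cubes n :: (real ^ 'd) set set)) * e \<le> 2 powr (real CARD('d) * real n) * e"
    using e by (intro mult_right_mono) auto
  then have "1 / 2 \<le> 1 - real (card (dyadic_cubes n :: (real ^ 'd) set set)) * e"
    unfolding e_def by (simp add: powr_minus field_simps)
  then have "1 / 2 * e powr (q - 1) \<le> (1 - real (card (dyadic_cubes n :: (real ^ 'd) set set)) * e) * e powr (q - 1)"
    by (intro mult_right_mono) auto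
  moreover have "1 / 2 * e powr (q - 1) = (1/2) powr q * 2 powr (- (real CARD('d) * (q - 1)) * real n)"
  proof -
    have "e powr (q - 1) = (1/2) powr (q - 1) * 2 powr (- (real CARD('d) * (q - 1)) * real n)"
      unfolding e_def by (simp add: powr_divide powr_powr algebra_simps)
    then show ?thesis by (simp add: powr_diff)
  qed
  ultimately show ?thesis by linarith
qed

text \<open>Each term gives up the factor \<open>measure \<nu> Q powr (q2 - q1)\<close>, which
  decays with rate s uniformly over the level.\<close>

lemma moment_sum_shift:
  assumes s: "ereal s < dim_infty \<nu>" and q: "q1 \<le> q2"
  obtains C where "0 < C" "\<And>n. moment_sum \<nu> n q2 \<le> C * 2 powr (- (s * (q2 - q1)) * real n) * moment_sum \<nu> n q1"
proof -
  from measure_decay[OF s] obtain C where C: "1 \<le> C"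
    "\<And>n Q. Q \<in> dyadic_cubes n \<Longrightarrow> measure \<nu> Q \<le> C * 2 powr (- (s * real n))" by blast
  have "moment_sum \<nu> n q2 \<le> C powr (q2 - q1) * 2 powr (- (s * (q2 - q1)) * real n) * moment_sum \<nu> n q1" for n
    unfolding moment_sum_def sum_distrib_left
  proof (intro sum_mono)
    fix Q :: "(real ^ 'd) set" assume Q: "Q \<in> dyadic_cubes n"
    have "measure \<nu> Q powr q2 = measure \<nu> Q powr (q2 - q1) * measure \<nu> Q powr q1"
      by (simp add: powr_add[symmetric])
    also have "\<dots> \<le> (C * 2 powr (- (s * real n))) powr (q2 - q1) * measure \<nu> Q powr q1"
      using C(2)[OF Q] q by (intro mult_right_mono powr_mono2) auto
    also have "(C * 2 powr (- (s * real n))) powr (q2 - q1) = C powr (q2 - q1) * 2 powr (- (s * (q2 - q1)) * real n)"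
      using C(1) by (simp add: powr_mult powr_powr algebra_simps)
    finally show "measure \<nu> Q powr q2 \<le> C powr (q2 - q1) * 2 powr (- (s * (q2 - q1)) * real n) * measure \<nu> Q powr q1" .
  qed
  with C(1) show ?thesis by (intro that[of "C powr (q2 - q1)"]) auto
qed

text \<open>The spectrum as a real function. For q \<ge> 0, where \<open>Lq_spectrum_eq\<close>
  shows finiteness, no information is lost.\<close>

definition \<beta> :: "real \<Rightarrow> real" where "\<beta> q = real_of_ereal (Lq_spectrum \<nu> q)"

lemma Lq_spectrum_le_1: "0 \<le> q \<Longrightarrow> q \<le> 1 \<Longrightarrow> Lq_spectrum \<nu> q \<le> ereal (real CARD('d) * (1 - q))"
  unfolding Lq_spectrum_eq_rate using moment_sum_upper moment_sum_pos
  by (intro upper_rate_leI[where c=2]) auto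

lemma Lq_spectrum_ge_1: "1 \<le> q \<Longrightarrow> ereal (- (real CARD('d) * (q - 1))) \<le> Lq_spectrum \<nu> q"
  unfolding Lq_spectrum_eq_rate using moment_sum_lower moment_sum_pos
  by (intro upper_rate_geI[where c="(1/2) powr q"]) (auto intro!: eventually_frequently)

lemma Lq_spectrum_eq: "0 \<le> q \<Longrightarrow> Lq_spectrum \<nu> q = ereal (\<beta> q)"
proof -
  assume q: "0 \<le> q"
  have le: "Lq_spectrum \<nu> q \<le> ereal (if q \<le> 1 then real CARD('d) * (1 - q) else 0)"
  proof (cases "q \<le> 1")
    case False
    have "moment_sum \<nu> n q \<le> moment_sum \<nu> n 1" for n
      unfolding moment_sum_def using False measure_le_1 by (intro sum_mono powr_mono') auto
    with False show ?thesis unfolding Lq_spectrum_eq_rate using moment_sum_pos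
      by (intro upper_rate_leI[where c=1]) (auto simp: moment_sum_1)
  qed (use q Lq_spectrum_le_1 in auto)
  have ge: "ereal (if q \<le> 1 then 0 else - (real CARD('d) * (q - 1))) \<le> Lq_spectrum \<nu> q"
  proof (cases "q \<le> 1")
    case True
    have "moment_sum \<nu> n 1 \<le> moment_sum \<nu> n q" for n
      unfolding moment_sum_def using True measure_le_1 by (intro sum_mono powr_mono') auto
    with True show ?thesis unfolding Lq_spectrum_eq_rate using moment_sum_pos
      by (intro upper_rate_geI[where c=1]) (auto simp: moment_sum_1 intro!: eventually_frequently)
  qed (use Lq_spectrum_ge_1 in auto)
  from le ge have "\<bar>Lq_spectrum \<nu> q\<bar> \<noteq> \<infinity>" by (cases "Lq_spectrum \<nu> q") auto
  then show ?thesis unfolding \<beta>_def by (simp add: ereal_real')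
qed

lemma beta_le: "0 \<le> q \<Longrightarrow> q \<le> 1 \<Longrightarrow> \<beta> q \<le> real CARD('d) * (1 - q)"
  using Lq_spectrum_le_1[of q] Lq_spectrum_eq[of q] by simp

lemma beta_ge: "1 \<le> q \<Longrightarrow> - (real CARD('d) * (q - 1)) \<le> \<beta> q"
  using Lq_spectrum_ge_1[of q] Lq_spectrum_eq[of q] by simp

lemma beta_1: "\<beta> 1 = 0"
  using beta_le[of 1] beta_ge[of 1] by simp

lemma moment_sum_le:
  assumes "0 \<le> q" "\<beta> q < b"
  shows "\<forall>\<^sub>F n in sequentially. moment_sum \<nu> n q < 2 powr (b * real n)"
  using assms moment_sum_pos Lq_spectrum_eq[of q] by (intro upper_rate_lessD) (auto simp: Lq_spectrum_eq_rate)

lemma moment_sum_ge: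
  assumes "0 \<le> q" "b < \<beta> q"
  shows "\<exists>\<^sub>F n in sequentially. 2 powr (b * real n) < moment_sum \<nu> n q"
  using assms moment_sum_pos Lq_spectrum_eq[of q] by (intro upper_rate_greaterD) (auto simp: Lq_spectrum_eq_rate)

lemma beta_shift:
  assumes s: "ereal s < dim_infty \<nu>" and q: "0 \<le> q1" "q1 \<le> q2"
  shows "\<beta> q2 \<le> \<beta> q1 - s * (q2 - q1)"
proof (rule field_le_epsilon)
  fix e :: real assume e: "0 < e"
  from moment_sum_shift[OF s q(2)] obtain C where C: "0 < C"
    "\<And>n. moment_sum \<nu> n q2 \<le> C * 2 powr (- (s * (q2 - q1)) * real n) * moment_sum \<nu> n q1" by blast
  have "\<forall>\<^sub>F n in sequentially. moment_sum \<nu> n q2 \<le> C * 2 powr ((\<beta> q1 - s * (q2 - q1) + e) * real n)"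
  proof -
    have "\<forall>\<^sub>F n in sequentially. moment_sum \<nu> n q1 < 2 powr ((\<beta> q1 + e) * real n)"
      using e by (intro moment_sum_le q(1)) simp
    then show ?thesis
    proof eventually_elim
    case (elim n)
    have "moment_sum \<nu> n q2 \<le> C * 2 powr (- (s * (q2 - q1)) * real n) * 2 powr ((\<beta> q1 + e) * real n)"
      using C elim by (intro order_trans[OF C(2)] mult_left_mono) auto
    also have "\<dots> = C * 2 powr ((\<beta> q1 - s * (q2 - q1) + e) * real n)"
      by (simp add: powr_add[symmetric] algebra_simps)
    finally show ?case .
    qed
  qed
  then have "Lq_spectrum \<nu> q2 \<le> ereal (\<beta> q1 - s * (q2 - q1) + e)"
    unfolding Lq_spectrum_eq_rate using moment_sum_pos by (intro upper_rate_leI) auto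
  then show "\<beta> q2 \<le> \<beta> q1 - s * (q2 - q1) + e" using q Lq_spectrum_eq[of q2] by simp
qed

end

section \<open>The partition function and its critical exponent\<close>

lemma eventually_geometric_bound:
  fixes a :: "nat \<Rightarrow> real"
  assumes "\<forall>\<^sub>F n in sequentially. a n \<le> x ^ n" "0 < x"
  obtains C where "1 \<le> C" "\<And>n. a n \<le> C * x ^ n"
proof -
  from assms(1) obtain n0 where n0: "\<And>n. n0 \<le> n \<Longrightarrow> a n \<le> x ^ n"
    unfolding eventually_sequentially by auto
  define C where "C = 1 + (\<Sum>k<n0. \<bar>a k\<bar> / x ^ k)"
  have s: "0 \<le> (\<Sum>k<n0. \<bar>a k\<bar> / x ^ k)" using assms(2) by (intro sum_nonneg) auto
  have C: "1 \<le> C" unfolding C_def using s by simp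
  have "a n \<le> C * x ^ n" for n
  proof (cases "n0 \<le> n")
    case True
    have "x ^ n \<le> C * x ^ n" using C assms(2) by simp
    with n0[OF True] show ?thesis by linarith
  next
    case False
    have "\<bar>a n\<bar> / x ^ n \<le> (\<Sum>k<n0. \<bar>a k\<bar> / x ^ k)"
      using False assms(2) by (intro member_le_sum) auto
    then have "\<bar>a n\<bar> / x ^ n \<le> C" unfolding C_def by simp
    then have "\<bar>a n\<bar> \<le> C * x ^ n" using assms(2) by (simp add: field_simps)
    then show ?thesis by simp
  qed
  with C that show ?thesis by blast
qed

lemma mem_dyadic_subcubes: "Q' \<in> dyadic_subcubes Q \<longleftrightarrow> (\<exists>m. Q' \<in> dyadic_cubes m \<and> Q' \<subseteq> Q)"
  unfolding dyadic_subcubes_def by auto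

context quant_measure
begin

text \<open>This is the use of admissibility: weights decay with the level, so the supremum in
  \<open>part_fun\<close> is finite and J decays as well.\<close>

lemma weight_decay:
  assumes "admissible r"
  obtains \<kappa> C where "0 < \<kappa>" "1 \<le> C"
    "\<And>n Q. Q \<in> dyadic_cubes n \<Longrightarrow> weight \<nu> r Q \<le> C * 2 powr (- (\<kappa> * real n))"
proof -
  from dim_infty_dense[OF assms] obtain s where s: "0 < s" "0 < s + r" "ereal s < dim_infty \<nu>" by blast
  from measure_decay[OF s(3)] obtain C where C: "1 \<le> C"
    "\<And>n Q. Q \<in> dyadic_cubes n \<Longrightarrow> measure \<nu> Q \<le> C * 2 powr (- (s * real n))" by blast
  have "weight \<nu> r Q \<le> C * 2 powr (- ((s + r) * real n))" if Q: "Q \<in> dyadic_cubes n" for n Q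
  proof -
    have "weight \<nu> r Q \<le> C * 2 powr (- (s * real n)) * 2 powr (- (real n * r))"
      unfolding weight_eq[OF Q] using C(2)[OF Q] by (intro mult_right_mono) auto
    also have "\<dots> = C * 2 powr (- ((s + r) * real n))"
      by (simp add: mult.assoc powr_add[symmetric] algebra_simps)
    finally show ?thesis .
  qed
  with that[OF s(2) C(1)] show ?thesis by blast
qed

lemma bdd_above_weight:
  assumes "admissible r"
  shows "bdd_above (weight \<nu> r ` dyadic_subcubes Q)"
proof -
  from weight_decay[OF assms] obtain \<kappa> C where k: "0 < \<kappa>" "1 \<le> C"
    "\<And>n Q. Q \<in> dyadic_cubes n \<Longrightarrow> weight \<nu> r Q \<le> C * 2 powr (- (\<kappa> * real n))" by metis
  have "weight \<nu> r Q' \<le> C" if Q': "Q' \<in> dyadic_cubes m" for Q' m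
  proof -
    have "2 powr (- (\<kappa> * real m)) \<le> 2 powr 0" using k(1) by (intro powr_mono) auto
    then have "2 powr (- (\<kappa> * real m)) \<le> 1" by simp
    then have "C * 2 powr (- (\<kappa> * real m)) \<le> C" using k(2) by simp
    with k(3)[OF Q'] show ?thesis by linarith
  qed
  then show ?thesis by (intro bdd_aboveI2[where M=C]) (auto simp: mem_dyadic_subcubes)
qed

lemma weight_le_part_fun:
  assumes "admissible r" "Q' \<in> dyadic_cubes m" "Q' \<subseteq> Q"
  shows "weight \<nu> r Q' \<le> part_fun \<nu> r Q"
  unfolding part_fun_eq_SUP_weight using assms bdd_above_weight[OF assms(1)]
  by (intro cSUP_upper) (auto simp: mem_dyadic_subcubes)

lemma part_fun_leI:
  assumes "Q \<in> dyadic_cubes n"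
    "\<And>m Q'. Q' \<in> dyadic_cubes m \<Longrightarrow> Q' \<subseteq> Q \<Longrightarrow> n \<le> m \<Longrightarrow> weight \<nu> r Q' \<le> c"
  shows "part_fun \<nu> r Q \<le> c"
  unfolding part_fun_eq_SUP_weight
proof (rule cSUP_least)
  show "dyadic_subcubes Q \<noteq> {}" using assms(1) by (auto simp: dyadic_subcubes_def)
  fix Q' :: "(real ^ 'd) set" assume "Q' \<in> dyadic_subcubes Q"
  then obtain m where "Q' \<in> dyadic_cubes m" "Q' \<subseteq> Q" by (auto simp: mem_dyadic_subcubes)
  with assms level_le_of_subset show "weight \<nu> r Q' \<le> c" by blast
qed

lemma part_fun_nonneg:
  assumes "admissible r" "Q \<in> dyadic_cubes n"
  shows "0 \<le> part_fun \<nu> r Q"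
  using weight_nonneg weight_le_part_fun[OF assms order_refl] by (rule order_trans)

lemma part_fun_mono:
  assumes "admissible r" "Q' \<in> dyadic_cubes m" "Q' \<subseteq> Q"
  shows "part_fun \<nu> r Q' \<le> part_fun \<nu> r Q"
  using assms weight_le_part_fun by (intro part_fun_leI) blast+

lemma part_fun_antimono:
  assumes "admissible r" "r \<le> r'" "Q \<in> dyadic_cubes n"
  shows "part_fun \<nu> r' Q \<le> part_fun \<nu> r Q"
proof (rule part_fun_leI[OF assms(3)])
  fix m and Q' :: "(real ^ 'd) set" assume Q': "Q' \<in> dyadic_cubes m" "Q' \<subseteq> Q"
  have "weight \<nu> r' Q' \<le> weight \<nu> r Q'"
    unfolding weight_eq[OF Q'(1)] using assms(2) by (intro mult_left_mono) (auto intro: mult_left_mono)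
  also have "\<dots> \<le> part_fun \<nu> r Q" by (rule weight_le_part_fun[OF assms(1) Q'])
  finally show "weight \<nu> r' Q' \<le> part_fun \<nu> r Q" .
qed

lemma part_fun_decay:
  assumes "admissible r"
  obtains \<kappa> C where "0 < \<kappa>" "1 \<le> C"
    "\<And>n Q. Q \<in> dyadic_cubes n \<Longrightarrow> part_fun \<nu> r Q \<le> C * 2 powr (- (\<kappa> * real n))"
proof -
  from weight_decay[OF assms] obtain \<kappa> C where k: "0 < \<kappa>" "1 \<le> C"
    "\<And>n Q. Q \<in> dyadic_cubes n \<Longrightarrow> weight \<nu> r Q \<le> C * 2 powr (- (\<kappa> * real n))" by metis
  have "part_fun \<nu> r Q \<le> C * 2 powr (- (\<kappa> * real n))" if Q: "Q \<in> dyadic_cubes n" for n Q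
  proof (rule part_fun_leI[OF Q])
    fix m and Q' :: "(real ^ 'd) set" assume Q': "Q' \<in> dyadic_cubes m" "n \<le> m"
    have "weight \<nu> r Q' \<le> C * 2 powr (- (\<kappa> * real m))" by (rule k(3)[OF Q'(1)])
    also have "\<dots> \<le> C * 2 powr (- (\<kappa> * real n))"
      using k Q'(2) by (intro mult_left_mono) auto
    finally show "weight \<nu> r Q' \<le> C * 2 powr (- (\<kappa> * real n))" .
  qed
  with that[OF k(1,2)] show ?thesis by blast
qed

lemma part_fun_approx:
  assumes "admissible r" "Q \<in> dyadic_cubes n" "c < part_fun \<nu> r Q"
  obtains m Q' where "n \<le> m" "Q' \<in> dyadic_cubes m" "Q' \<subseteq> Q" "c < weight \<nu> r Q'"
proof -
  have "dyadic_subcubes Q \<noteq> {}" using assms(2) by (auto simp: dyadic_subcubes_def)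
  then obtain Q' where Q': "Q' \<in> dyadic_subcubes Q" "c < weight \<nu> r Q'"
    using assms(3) less_cSUP_iff[OF _ bdd_above_weight[OF assms(1)]]
    unfolding part_fun_eq_SUP_weight by blast
  from Q'(1) obtain m where m: "Q' \<in> dyadic_cubes m" "Q' \<subseteq> Q" by (auto simp: mem_dyadic_subcubes)
  show ?thesis by (rule that[OF level_le_of_subset[OF m(1) assms(2) m(2)] m Q'(2)])
qed

lemma sum_weight_powr:
  "(\<Sum>Q\<in>dyadic_cubes n. weight \<nu> r Q powr q) = moment_sum \<nu> n q * 2 powr (- (r * q) * real n)"
  unfolding moment_sum_def sum_distrib_right
  by (intro sum.cong) (auto simp: weight_eq powr_mult powr_powr algebra_simps)

lemma sum_weight_le_part_moment_sum:
  assumes "admissible r" "0 \<le> q"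
  shows "(\<Sum>Q\<in>dyadic_cubes n. weight \<nu> r Q powr q) \<le> part_moment_sum \<nu> r n q"
  unfolding part_moment_sum_def
  using assms weight_le_part_fun weight_nonneg by (intro sum_mono powr_mono2) auto

lemma part_moment_sum_pos:
  assumes "admissible r" "0 \<le> q"
  shows "0 < part_moment_sum \<nu> r n q"
  using sum_weight_le_part_moment_sum[OF assms, of n] moment_sum_pos[of n q]
  unfolding sum_weight_powr by (smt (verit) powr_gt_zero mult_pos_pos)

text \<open>Every Q of level n is charged to a subcube S Q that realises J(Q) up to the factor 2. As
  the Q are disjoint, S is injective, so the charges on a level k \<ge> n are at most the full sum W
  k, and these sums are geometrically small.\<close>

lemma part_moment_sum_decay:
  assumes r: "admissible r" and q: "0 < q" "\<beta> q < r * q"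
  obtains x C where "0 < x" "x < 1" "0 < C" "\<And>n. part_moment_sum \<nu> r n q \<le> C * x ^ n"
proof -
  from dense[OF q(2)] obtain b where b: "\<beta> q < b" "b < r * q" by blast
  define x where "x = 2 powr (b - r * q)"
  have x: "0 < x" "x < 1" using b unfolding x_def by (auto simp: powr_less_one)
  define W where "W k = (\<Sum>Q\<in>dyadic_cubes k. weight \<nu> r Q powr q)" for k
  have "\<forall>\<^sub>F n in sequentially. W n \<le> x ^ n"
    using moment_sum_le[OF less_imp_le[OF q(1)] b(1)]
  proof eventually_elim
    case (elim n)
    have "W n \<le> 2 powr (b * real n) * 2 powr (- (r * q) * real n)"
      unfolding W_def sum_weight_powr using elim by (intro mult_right_mono) auto
    also have "\<dots> = x ^ n"
      unfolding x_def by (simp add: powr_add[symmetric] powr_power algebra_simps)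
    finally show ?case .
  qed
  from eventually_geometric_bound[OF this x(1)] obtain C where C: "1 \<le> C" "\<And>n. W n \<le> C * x ^ n" by blast
  have "part_moment_sum \<nu> r n q \<le> 2 powr q * (C / (1 - x)) * x ^ n" for n
  proof -
    \<comment> \<open>Halving gives the strict inequality for a near-maximiser if J(Q) > 0;
      otherwise Q itself serves.\<close>
    have "\<exists>m Q'. n \<le> m \<and> Q' \<in> dyadic_cubes m \<and> Q' \<subseteq> Q \<and> part_fun \<nu> r Q \<le> 2 * weight \<nu> r Q'"
      if Q: "Q \<in> dyadic_cubes n" for Q
    proof (cases "part_fun \<nu> r Q \<le> 0")
      case True
      then have "part_fun \<nu> r Q \<le> 2 * weight \<nu> r Q" using weight_nonneg[of \<nu> r Q] by linarith
      with Q show ?thesis by blast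
    next
      case False
      then have "part_fun \<nu> r Q / 2 < part_fun \<nu> r Q" by simp
      from part_fun_approx[OF r Q this] obtain m Q' where
        "n \<le> m" "Q' \<in> dyadic_cubes m" "Q' \<subseteq> Q" "part_fun \<nu> r Q / 2 < weight \<nu> r Q'" by blast
      then show ?thesis by (intro exI[of _ m] exI[of _ Q']) auto
    qed
    then obtain K S where KS: "\<And>Q. Q \<in> dyadic_cubes n \<Longrightarrow> n \<le> K Q \<and> S Q \<in> dyadic_cubes (K Q) \<and> S Q \<subseteq> Q
        \<and> part_fun \<nu> r Q \<le> 2 * weight \<nu> r (S Q)"
      by metis
    \<comment> \<open>Finitely many cubes have a deepest charged level, so grouping by level uses
      finite sums.\<close>
    define L where "L = Max (K ` dyadic_cubes n)"
    have L: "K Q \<le> L" if "Q \<in> dyadic_cubes n" for Q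
      unfolding L_def using that by (intro Max_ge) auto
    define g where "g Q = weight \<nu> r Q powr q" for Q
    have inj: "inj_on S (dyadic_cubes n)"
    proof (rule inj_onI)
      fix Q1 Q2 assume Q: "Q1 \<in> dyadic_cubes n" "Q2 \<in> dyadic_cubes n" "S Q1 = S Q2"
      obtain y where "y \<in> S Q1" using KS[OF Q(1)] dyadic_cubes_nonempty by blast
      then have "y \<in> Q1" "y \<in> Q2" using KS[OF Q(1)] KS[OF Q(2)] Q(3) by auto
      then show "Q1 = Q2" using dyadic_cube_eq_cube_at Q(1,2) by blast
    qed
    have "part_moment_sum \<nu> r n q \<le> (\<Sum>Q\<in>dyadic_cubes n. 2 powr q * g (S Q))"
      unfolding part_moment_sum_def
    proof (rule sum_mono)
      fix Q assume Q: "Q \<in> (dyadic_cubes n :: (real ^ 'd) set set)"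
      have "part_fun \<nu> r Q powr q \<le> (2 * weight \<nu> r (S Q)) powr q"
        using KS[OF Q] q(1) part_fun_nonneg[OF r Q] by (intro powr_mono2) auto
      then show "part_fun \<nu> r Q powr q \<le> 2 powr q * g (S Q)"
        unfolding g_def by (simp add: powr_mult weight_nonneg)
    qed
    also have "\<dots> = 2 powr q * (\<Sum>Q\<in>dyadic_cubes n. g (S Q))" by (simp add: sum_distrib_left)
    also have "(\<Sum>Q\<in>dyadic_cubes n. g (S Q)) = (\<Sum>k=n..L. \<Sum>Q\<in>{Q \<in> dyadic_cubes n. K Q = k}. g (S Q))"
      using KS L by (intro sum.group[symmetric]) auto
    also have "\<dots> \<le> (\<Sum>k=n..L. W k)"
    proof (rule sum_mono)
      fix k
      have "(\<Sum>Q\<in>{Q \<in> dyadic_cubes n. K Q = k}. g (S Q)) = (\<Sum>Q\<in>S ` {Q \<in> dyadic_cubes n. K Q = k}. g Q)"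
        by (subst sum.reindex) (auto intro: inj_on_subset[OF inj])
      also have "\<dots> \<le> W k"
        unfolding W_def g_def using KS by (intro sum_mono2) auto
      finally show "(\<Sum>Q\<in>{Q \<in> dyadic_cubes n. K Q = k}. g (S Q)) \<le> W k" .
    qed
    also have "\<dots> \<le> (\<Sum>k=n..L. C * x ^ k)" using C(2) by (intro sum_mono)
    also have "\<dots> = C * (\<Sum>k=n..L. x ^ k)" by (simp add: sum_distrib_left)
    also have "\<dots> \<le> C * (x ^ n / (1 - x))"
      using C(1) x by (intro mult_left_mono sum_geometric_tail_le) auto
    finally show ?thesis by (simp add: mult.assoc)
  qed
  then show ?thesis using x C(1) by (intro that[of x "2 powr q * (C / (1 - x))"]) auto
qed

lemma part_spectrum_eq_rate:
  assumes "admissible r"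
  shows "part_spectrum \<nu> r q = upper_rate (\<lambda>n. part_moment_sum \<nu> r n q)"
proof -
  have "(\<Sum>Q\<in>{Q \<in> dyadic_cubes n. part_fun \<nu> r Q > 0}. part_fun \<nu> r Q powr q) = part_moment_sum \<nu> r n q" for n
    unfolding part_moment_sum_def using part_fun_nonneg[OF assms]
    by (intro sum.mono_neutral_left) (auto simp: less_le)
  then show ?thesis unfolding part_spectrum_def upper_rate_def by simp
qed

text \<open>The sum of J powers lies above the weight sum of its own level and below a geometric
  tail of weight sums, so both have the same sign of exponent.\<close>

lemma part_spectrum_neg_iff:
  assumes r: "admissible r" and q: "0 < q"
  shows "part_spectrum \<nu> r q < 0 \<longleftrightarrow> \<beta> q < r * q"
proof
  assume "\<beta> q < r * q"
  from part_moment_sum_decay[OF r q this] obtain x C where xC: "0 < x" "x < 1" "0 < C"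
    "\<And>n. part_moment_sum \<nu> r n q \<le> C * x ^ n" by metis
  have "x ^ n = 2 powr (log 2 x * real n)" for n
    using xC(1) by (simp add: powr_powr[symmetric] powr_realpow)
  then have "part_spectrum \<nu> r q \<le> ereal (log 2 x)"
    unfolding part_spectrum_eq_rate[OF r] using xC part_moment_sum_pos[OF r] q
    by (intro upper_rate_leI[where c=C]) auto
  also have "\<dots> < 0" using xC by (simp add: zero_ereal_def)
  finally show "part_spectrum \<nu> r q < 0" .
next
  assume neg: "part_spectrum \<nu> r q < 0"
  show "\<beta> q < r * q"
  proof (rule ccontr)
    assume n: "\<not> ?thesis"
    \<comment> \<open>With e strictly between the spectrum and 0, e + r q lies below \<beta> q, so
      the moment sums exceed 2 powr ((e + r q) n) infinitely often.\<close>
    from neg obtain e where e: "part_spectrum \<nu> r q < ereal e" "ereal e < 0" using ereal_dense2 by blast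
    then have "e + r * q < \<beta> q" using n by (simp add: zero_ereal_def)
    from moment_sum_ge[OF _ this] q have "\<exists>\<^sub>F n in sequentially. 2 powr ((e + r * q) * real n) < moment_sum \<nu> n q" by simp
    then have "\<exists>\<^sub>F n in sequentially. 1 * 2 powr (e * real n) \<le> part_moment_sum \<nu> r n q"
    proof (rule frequently_elim1)
      fix n assume "2 powr ((e + r * q) * real n) < moment_sum \<nu> n q"
      then have "2 powr ((e + r * q) * real n) * 2 powr (- (r * q) * real n) \<le> moment_sum \<nu> n q * 2 powr (- (r * q) * real n)"
        by (intro mult_right_mono) auto
      also have "\<dots> \<le> part_moment_sum \<nu> r n q"
        using sum_weight_le_part_moment_sum[OF r, of q n] q unfolding sum_weight_powr by simp
      also have "2 powr ((e + r * q) * real n) * 2 powr (- (r * q) * real n) = 2 powr (e * real n)"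
        by (simp add: powr_add[symmetric] algebra_simps)
      finally show "1 * 2 powr (e * real n) \<le> part_moment_sum \<nu> r n q" by simp
    qed
    then have "ereal e \<le> part_spectrum \<nu> r q"
      unfolding part_spectrum_eq_rate[OF r] using part_moment_sum_pos[OF r] q
      by (intro upper_rate_geI[where c=1]) auto
    with e show False by simp
  qed
qed

section \<open>The critical exponent as sign change of q |-> \<beta> q - r q\<close>

definition crit :: "real \<Rightarrow> real" where "crit r = real_of_ereal (crit_exp \<nu> r)"

lemma crit_exp_eq_Inf:
  assumes r: "admissible r"
  defines "A \<equiv> {q. 0 < q \<and> \<beta> q < r * q}"
  shows "A \<noteq> {}" "bdd_below A" "crit_exp \<nu> r = ereal (Inf A)"
proof -
  from dim_infty_dense[OF r] obtain s where s: "0 < s" "0 < s + r" "ereal s < dim_infty \<nu>" by blast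
  \<comment> \<open>From 0 the inequality \<open>beta_shift\<close> gives \<beta> q - r q \<le>
    \<beta> 0 - (s + r) q, which is negative at this q.\<close>
  define q where "q = 1 + \<bar>\<beta> 0\<bar> / (s + r)"
  have q: "1 \<le> q" unfolding q_def using s(2) by simp
  have "(s + r) * q = s + r + \<bar>\<beta> 0\<bar>" unfolding q_def using s(2) by (simp add: distrib_left)
  then have "\<beta> 0 < (s + r) * q" using s(2) by linarith
  moreover have "\<beta> q \<le> \<beta> 0 - s * q" using beta_shift[OF s(3), of 0 q] q by simp
  ultimately have "\<beta> q < r * q" by (simp add: algebra_simps)
  then show ne: "A \<noteq> {}" unfolding A_def using q by (auto intro!: exI[of _ q])
  show bdd: "bdd_below A" unfolding A_def by (rule bdd_belowI[of _ 0]) auto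
  have "{q. q > 0 \<and> part_spectrum \<nu> r q < 0} = A"
    unfolding A_def using part_spectrum_neg_iff[OF r] by blast
  then have "crit_exp \<nu> r = (INF q\<in>A. ereal q)" unfolding crit_exp_def by simp
  also have "\<dots> = ereal (Inf A)"
  proof -
    have "\<bar>INF q\<in>A. ereal q\<bar> \<noteq> \<infinity>"
    proof -
      obtain a where "a \<in> A" using ne by blast
      then have "(INF q\<in>A. ereal q) \<le> ereal a" by (rule INF_lower)
      moreover have "ereal 0 \<le> (INF q\<in>A. ereal q)" by (rule INF_greatest) (auto simp: A_def)
      ultimately show ?thesis by (cases "INF q\<in>A. ereal q") auto
    qed
    then show ?thesis by (rule ereal_Inf[symmetric])
  qed
  finally show "crit_exp \<nu> r = ereal (Inf A)" .
qed

lemma crit_exp_eq: "admissible r \<Longrightarrow> crit_exp \<nu> r = ereal (crit r)"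
  unfolding crit_def using crit_exp_eq_Inf(3)[of r] by simp

lemma beta_less_above_crit:
  assumes r: "admissible r" and q: "crit r < q"
  shows "0 < q" "\<beta> q < r * q"
proof -
  have "Inf {q. 0 < q \<and> \<beta> q < r * q} < q" using q crit_exp_eq_Inf(3)[OF r] unfolding crit_def by simp
  then obtain q0 where q0: "0 < q0" "\<beta> q0 < r * q0" "q0 < q"
    using cInf_lessD[OF crit_exp_eq_Inf(1)[OF r]] by auto
  then show "0 < q" by simp
  from dim_infty_dense[OF r] obtain s where s: "0 < s" "0 < s + r" "ereal s < dim_infty \<nu>" by blast
  have "\<beta> q \<le> \<beta> q0 - s * (q - q0)" using beta_shift[OF s(3)] q0 by simp
  moreover have "0 < (s + r) * (q - q0)" using s q0 by simp
  ultimately show "\<beta> q < r * q" using q0 by (simp add: algebra_simps)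
qed

lemma beta_greater_below_crit:
  assumes r: "admissible r" and q: "0 < q" "q < crit r"
  shows "r * q < \<beta> q"
proof -
  \<comment> \<open>At the midpoint the infimum yields only \<beta> q1 \<ge> r q1; moving down to q
    gains (s + r) (q1 - q) and makes it strict.\<close>
  define q1 where "q1 = (q + crit r) / 2"
  have q1: "q < q1" "q1 < crit r" using q unfolding q1_def by auto
  have "crit r = Inf {q. 0 < q \<and> \<beta> q < r * q}" using crit_exp_eq_Inf(3)[OF r] unfolding crit_def by simp
  then have "\<not> \<beta> q1 < r * q1"
    using q q1 cInf_lower[OF _ crit_exp_eq_Inf(2)[OF r], of q1] by auto
  moreover from dim_infty_dense[OF r] obtain s where s: "0 < s" "0 < s + r" "ereal s < dim_infty \<nu>" by blast
  have "\<beta> q1 \<le> \<beta> q - s * (q1 - q)" using beta_shift[OF s(3)] q q1 by simp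
  moreover have "0 < (s + r) * (q1 - q)" using s q1 by simp
  ultimately show ?thesis by (simp add: algebra_simps)
qed

lemma crit_pos:
  assumes r: "admissible r"
  shows "0 < crit r"
proof (rule ccontr)
  assume n: "\<not> 0 < crit r"
  from dim_infty_dense[OF r] obtain s where s: "0 < s" "0 < s + r" "ereal s < dim_infty \<nu>" by blast
  \<comment> \<open>Up to s / (s + r) the line s (1 - q) stays above r q, and \<beta> lies above
    that line on [0, 1].\<close>
  define q where "q = min 1 (s / (s + r))"
  have q: "0 < q" "q \<le> 1" "q \<le> s / (s + r)" using s unfolding q_def by auto
  have "(s + r) * q \<le> (s + r) * (s / (s + r))" using s q by (intro mult_left_mono) auto
  then have q3: "(s + r) * q \<le> s" using s by simp
  have "\<beta> 1 \<le> \<beta> q - s * (1 - q)" using beta_shift[OF s(3), of q 1] q by simp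
  then have "r * q \<le> \<beta> q" using q3 beta_1 by (simp add: algebra_simps)
  moreover have "\<beta> q < r * q" using beta_less_above_crit(2)[OF r, of q] n q(1) by simp
  ultimately show False by simp
qed

text \<open>The sign change is strict on both sides, so a positive zero of q |-> \<beta> q - r q can
  only be the critical exponent. It is later applied with r = \<beta> q / q.\<close>

lemma crit_eqI:
  assumes r: "admissible r" and q: "0 < q" "\<beta> q = r * q"
  shows "crit r = q"
  using beta_less_above_crit(2)[OF r, of q] beta_greater_below_crit[OF r, of q] q
  by (metis less_irrefl linorder_neqE_linordered_idom)

lemma neg_dim_infty_less: "0 \<le> r \<Longrightarrow> admissible r"
  using dim_pos by (cases "dim_infty \<nu>") auto

lemma crit_0: "crit 0 = 1"
  using beta_1 neg_dim_infty_less by (intro crit_eqI) auto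

lemma crit_le:
  assumes "admissible r" "0 < q" "\<beta> q < r * q"
  shows "crit r \<le> q"
  using beta_greater_below_crit[OF assms(1), of q] assms by force

lemma crit_ge:
  assumes "admissible r" "r * q \<le> \<beta> q"
  shows "q \<le> crit r"
  using beta_less_above_crit[OF assms(1), of q] assms by force

text \<open>At d / (d + r) the line d (1 - q), which dominates \<beta> on [0, 1], meets r q. The
  slack e produces the strict inequality that \<open>crit_le\<close> asks for; if it leads beyond 1,
  then \<beta> 1 = 0 < r suffices.\<close>

lemma crit_less_1:
  assumes "0 < r"
  shows "crit r \<le> real CARD('d) / (real CARD('d) + r)"
proof (rule field_le_epsilon)
  fix e :: real assume e: "0 < e"
  have r: "admissible r" using assms by (intro neg_dim_infty_less) simp
  define u where "u = real CARD('d) / (real CARD('d) + r)"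
  have q: "0 < u" "u < 1" using assms unfolding u_def by auto
  have cu: "(real CARD('d) + r) * u = real CARD('d)" unfolding u_def using assms by simp
  have "crit r \<le> u + e"
  proof (cases "u + e \<le> 1")
    case True
    have "0 < (real CARD('d) + r) * e" using assms e by (intro mult_pos_pos) auto
    then have "real CARD('d) * (1 - (u + e)) < r * (u + e)"
      using cu by (simp add: algebra_simps)
    moreover have "\<beta> (u + e) \<le> real CARD('d) * (1 - (u + e))" using q(1) e True by (intro beta_le) auto
    ultimately have "\<beta> (u + e) < r * (u + e)" by linarith
    then show ?thesis using r q(1) e by (intro crit_le) auto
  next
    case False
    have "crit r \<le> 1" using r assms beta_1 by (intro crit_le) auto
    with False show ?thesis by simp
  qed
  then show "crit r \<le> real CARD('d) / (real CARD('d) + r) + e" unfolding u_def .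
qed

lemma crit_greater_1:
  assumes r: "admissible r" and "r < 0"
  shows "1 < crit r"
proof -
  \<comment> \<open>The solution of r = - d (q - 1): there the lower bound of \<beta> equals r, and
    r q \<le> r.\<close>
  define q where "q = 1 + - r / real CARD('d)"
  have q: "1 < q" using assms unfolding q_def by (simp add: divide_less_0_iff)
  have "r * q \<le> r" using assms q by (simp add: mult_le_cancel_left1)
  also have "r = - (real CARD('d) * (q - 1))" unfolding q_def by simp
  also have "\<dots> \<le> \<beta> q" using q by (intro beta_ge) auto
  finally show ?thesis using crit_ge[OF r, of q] q by simp
qed

end

section \<open>Partition entropy and coarse multifractal dimension\<close>

lemma ln_ratio_x:
  fixes m x h :: real
  assumes "1 < x" "0 < m"
  shows "ln m / ln x < h \<longleftrightarrow> m < x powr h" "h < ln m / ln x \<longleftrightarrow> x powr h < m"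
proof -
  have l: "0 < ln x" using assms by simp
  have "ln m / ln x < h \<longleftrightarrow> ln m < h * ln x" using l by (simp add: divide_less_eq)
  also have "\<dots> \<longleftrightarrow> m < exp (h * ln x)" using assms by (metis exp_gt_zero exp_less_cancel_iff exp_ln)
  finally show "ln m / ln x < h \<longleftrightarrow> m < x powr h" using assms by (simp add: powr_def)
  have "h < ln m / ln x \<longleftrightarrow> h * ln x < ln m" using l by (simp add: less_divide_eq)
  also have "\<dots> \<longleftrightarrow> exp (h * ln x) < m" using assms by (metis exp_gt_zero exp_less_cancel_iff exp_ln)
  finally show "h < ln m / ln x \<longleftrightarrow> x powr h < m" using assms by (simp add: powr_def)
qed

lemma eventually_mult_powr_less:
  fixes C h h' :: real
  assumes "h < h'"
  shows "\<forall>\<^sub>F x in at_top. C * x powr h < x powr h'"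
proof -
  have "\<forall>\<^sub>F x in at_top. C < x powr (h' - h)"
    using eventually_gt_at_top[of "max 1 C powr (1 / (h' - h))"]
  proof eventually_elim
    case (elim x)
    have "C \<le> (max 1 C powr (1 / (h' - h))) powr (h' - h)"
      using assms by (simp add: powr_powr)
    also have "\<dots> < x powr (h' - h)"
      using elim assms by (intro powr_less_mono2) auto
    finally show ?case .
  qed
  then show ?thesis using eventually_gt_at_top[of 0]
  proof eventually_elim
    case (elim x)
    then have "C * x powr h < x powr (h' - h) * x powr h" by (intro mult_strict_right_mono) auto
    then show ?case by (simp add: powr_add[symmetric])
  qed
qed

section \<open>Stopping partitions and minimal cardinalities\<close>

context quant_measure
begin

text \<open>Uniform decay of J makes the stopping rule end at a level that does not depend on the
  point.\<close>

lemma part_fun_small: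
  assumes "admissible r" "0 < x"
  obtains L where "\<And>n Q. L \<le> n \<Longrightarrow> Q \<in> dyadic_cubes n \<Longrightarrow> part_fun \<nu> r Q < x"
proof -
  from part_fun_decay[OF assms(1)] obtain \<kappa> C where k: "0 < \<kappa>" "1 \<le> C"
    "\<And>n Q. Q \<in> dyadic_cubes n \<Longrightarrow> part_fun \<nu> r Q \<le> C * 2 powr (- (\<kappa> * real n))" by metis
  have "\<forall>\<^sub>F n in sequentially. 2 powr (- \<kappa> * real n) < x / C * 2 powr (0 * real n)"
    using assms(2) k by (intro eventually_powr_less) auto
  then obtain L where L: "\<And>n. L \<le> n \<Longrightarrow> 2 powr (- \<kappa> * real n) < x / C"
    unfolding eventually_sequentially by auto
  have "part_fun \<nu> r Q < x" if "L \<le> n" "Q \<in> dyadic_cubes n" for n Q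
    using k(3)[OF that(2)] L[OF that(1)] k(2) by (simp add: field_simps)
  with that show ?thesis by blast
qed

text \<open>The cubes at which the partition function first drops below the threshold form a partition,
  and all of them are children of cubes that are still above the threshold.\<close>

lemma stopping_partition:
  assumes r: "admissible r" and x: "0 < x"
  obtains P L where "P \<in> cube_partitions" "\<And>Q. Q \<in> P \<Longrightarrow> part_fun \<nu> r Q < 1 / x"
    "card P \<le> 1 + 2 ^ CARD('d) * (\<Sum>n<L. card {Q \<in> dyadic_cubes n. 1 / x \<le> part_fun \<nu> r Q})"
proof -
  let ?U = "half_open_unit_cube :: (real ^ 'd) set"
  from part_fun_small[OF r, of "1 / x"] x obtain L where
    L: "\<And>n Q. L \<le> n \<Longrightarrow> Q \<in> dyadic_cubes n \<Longrightarrow> part_fun \<nu> r Q < 1 / x" by auto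
  define lev where "lev y = (LEAST n. part_fun \<nu> r (cube_at n y) < 1 / x)" for y :: "real ^ 'd"
  have lev: "part_fun \<nu> r (cube_at (lev y) y) < 1 / x" "lev y \<le> L" if "y \<in> ?U" for y
  proof -
    have s: "part_fun \<nu> r (cube_at L y) < 1 / x" using L cube_at_in_dyadic_cubes[OF that] by blast
    then show "part_fun \<nu> r (cube_at (lev y) y) < 1 / x" unfolding lev_def by (rule LeastI)
    from s show "lev y \<le> L" unfolding lev_def by (rule Least_le)
  qed
  have before: "1 / x \<le> part_fun \<nu> r (cube_at m y)" if "m < lev y" for m y
    using not_less_Least[of m "\<lambda>n. part_fun \<nu> r (cube_at n y) < 1 / x"] that unfolding lev_def by simp
  \<comment> \<open>The stopping level is decided by the cubes around y up to that level, and all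
    points of the stopped cube share them. Hence two stopped cubes are equal or disjoint.\<close>
  have same: "cube_at (lev z) z = cube_at (lev y) y" if z: "z \<in> cube_at (lev y) y" and y: "y \<in> ?U" for y z
  proof -
    have eq: "cube_at m z = cube_at m y" if "m \<le> lev y" for m
      using z cube_at_antimono[OF that, of y] by (intro cube_at_eq) auto
    have "lev z = lev y"
      unfolding lev_def[of z]
    proof (rule Least_equality)
      show "part_fun \<nu> r (cube_at (lev y) z) < 1 / x" using lev(1)[OF y] eq by simp
      fix m assume "part_fun \<nu> r (cube_at m z) < 1 / x"
      then show "lev y \<le> m" using before[of m y] eq[of m] by (cases "m < lev y") auto
    qed
    then show ?thesis using eq by simp
  qed
  define P where "P = (\<lambda>y. cube_at (lev y) y) ` ?U"
  define G where "G n = {Q \<in> dyadic_cubes n. 1 / x \<le> part_fun \<nu> r Q}" for n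
  define B where "B = (\<Union>n<L. \<Union>Q\<in>G n. {Q' \<in> dyadic_cubes (Suc n). Q' \<subseteq> Q})"
  \<comment> \<open>A point stopped at level 0 has no parent cube; its cube is the whole unit cube,
    which accounts for the summand 1 in the cardinality bound.\<close>
  have sub: "P \<subseteq> insert ?U B"
  proof
    fix Q assume "Q \<in> P"
    then obtain y where y: "y \<in> ?U" "Q = cube_at (lev y) y" unfolding P_def by auto
    show "Q \<in> insert ?U B"
    proof (cases "lev y")
      case 0
      then show ?thesis using y cube_at_0[OF y(1)] by simp
    next
      case (Suc m)
      then have "cube_at m y \<in> G m" unfolding G_def using y cube_at_in_dyadic_cubes before by simp
      moreover have "Q \<in> dyadic_cubes (Suc m)" "Q \<subseteq> cube_at m y" "m < L"
        using y Suc cube_at_in_dyadic_cubes cube_at_antimono[of m "Suc m" y] lev(2)[OF y(1)] by auto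
      ultimately show ?thesis unfolding B_def by blast
    qed
  qed
  have finB: "finite B" unfolding B_def G_def by auto
  have "card P \<le> card (insert ?U B)" using sub finB by (intro card_mono) auto
  also have "\<dots> \<le> 1 + card B" using card_insert_le_m1 by (simp add: card_insert_if finB)
  also have "card B \<le> (\<Sum>n<L. card (\<Union>Q\<in>G n. {Q' \<in> dyadic_cubes (Suc n). Q' \<subseteq> Q}))"
    unfolding B_def by (intro card_UN_le) simp
  also have "\<dots> \<le> (\<Sum>n<L. 2 ^ CARD('d) * card (G n))"
  proof (rule sum_mono)
    fix n
    have "card (\<Union>Q\<in>G n. {Q' \<in> dyadic_cubes (Suc n). Q' \<subseteq> Q}) \<le> (\<Sum>Q\<in>G n. card {Q' \<in> dyadic_cubes (Suc n). Q' \<subseteq> Q})"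
      unfolding G_def by (intro card_UN_le) simp
    also have "\<dots> \<le> (\<Sum>Q\<in>G n. 2 ^ CARD('d))"
      unfolding G_def by (intro sum_mono card_children) auto
    finally show "card (\<Union>Q\<in>G n. {Q' \<in> dyadic_cubes (Suc n). Q' \<subseteq> Q}) \<le> 2 ^ CARD('d) * card (G n)"
      by (simp add: mult.commute)
  qed
  finally have card: "card P \<le> 1 + 2 ^ CARD('d) * (\<Sum>n<L. card (G n))"
    by (simp add: sum_distrib_left)
  have part: "partition_on ?U P"
  proof (rule partition_onI)
    show "\<Union> P = ?U"
    proof
      show "\<Union> P \<subseteq> ?U" unfolding P_def using cube_at_in_dyadic_cubes dyadic_cubes_subset by blast
      show "?U \<subseteq> \<Union> P" unfolding P_def using mem_cube_at by blast
    qed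
    show "{} \<notin> P" using mem_cube_at unfolding P_def by blast
    show "disjnt p q" if pq: "p \<in> P" "q \<in> P" "p \<noteq> q" for p q
    proof (rule ccontr)
      assume "\<not> disjnt p q"
      then obtain z where z: "z \<in> p" "z \<in> q" by (auto simp: disjnt_def)
      from pq(1,2) obtain y y' where y: "y \<in> ?U" "p = cube_at (lev y) y" "y' \<in> ?U" "q = cube_at (lev y') y'"
        unfolding P_def by auto
      from same[of z y] same[of z y'] z y have "p = q" by simp
      with pq(3) show False by simp
    qed
  qed
  have "P \<subseteq> all_dyadic_cubes" unfolding P_def all_dyadic_cubes_def using cube_at_in_dyadic_cubes by blast
  moreover have "finite P" using sub finB finite_subset by blast
  ultimately have "P \<in> cube_partitions" unfolding cube_partitions_def using part by simp
  moreover have "part_fun \<nu> r Q < 1 / x" if "Q \<in> P" for Q using that lev(1) unfolding P_def by auto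
  ultimately show ?thesis using card unfolding G_def by (intro that[of P L]) auto
qed

lemma cube_partition_nonempty: "P \<in> cube_partitions \<Longrightarrow> finite P \<and> P \<noteq> ({} :: (real ^ 'd) set set)"
proof -
  assume P: "P \<in> (cube_partitions :: (real ^ 'd) set set set)"
  have "(1 :: real ^ 'd) \<in> half_open_unit_cube" by (simp add: half_open_unit_cube_def)
  then have "(1 :: real ^ 'd) \<in> \<Union> P" using P unfolding cube_partitions_def partition_on_def by simp
  then show ?thesis using P unfolding cube_partitions_def by auto
qed

lemma min_part_card_set:
  "{P \<in> cube_partitions. Max (part_fun \<nu> r ` P) < 1 / x} = {P \<in> cube_partitions. \<forall>Q\<in>P. part_fun \<nu> r Q < 1 / x}"
proof -
  have "Max (part_fun \<nu> r ` P) < 1 / x \<longleftrightarrow> (\<forall>Q\<in>P. part_fun \<nu> r Q < 1 / x)" if "P \<in> cube_partitions" for P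
    using cube_partition_nonempty[OF that] by (subst Max_less_iff) auto
  then show ?thesis by auto
qed

lemma min_part_card_le:
  assumes "P \<in> cube_partitions" "\<And>Q. Q \<in> P \<Longrightarrow> part_fun \<nu> r Q < 1 / x"
  shows "min_part_card \<nu> r x \<le> card P"
  unfolding min_part_card_def min_part_card_set using assms by (intro cINF_lower) auto

text \<open>A partition below the threshold exists by \<open>stopping_partition\<close>, and the
  infimum of a nonempty set of naturals is a member.\<close>

lemma min_part_card_attained:
  assumes "admissible r" "0 < x"
  obtains P where "P \<in> cube_partitions" "\<And>Q. Q \<in> P \<Longrightarrow> part_fun \<nu> r Q < 1 / x" "card P = min_part_card \<nu> r x"
proof -
  let ?S = "{P \<in> cube_partitions. \<forall>Q\<in>P. part_fun \<nu> r Q < 1 / x}"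
  obtain P0 where "P0 \<in> ?S"
  proof (rule stopping_partition[OF assms])
    fix P L assume "P \<in> cube_partitions" "\<And>Q. Q \<in> P \<Longrightarrow> part_fun \<nu> r Q < 1 / x"
    then have "P \<in> ?S" by simp
    then show ?thesis by (rule that)
  qed
  then have "card ` ?S \<noteq> {}" by blast
  then have "Inf (card ` ?S) \<in> card ` ?S" by (rule Inf_nat_def1)
  then have "min_part_card \<nu> r x \<in> card ` ?S" unfolding min_part_card_def min_part_card_set .
  then show ?thesis using that by auto
qed

lemma min_part_card_pos:
  assumes "admissible r" "0 < x"
  shows "1 \<le> min_part_card \<nu> r x"
proof (rule min_part_card_attained[OF assms])
  fix P assume "P \<in> (cube_partitions :: (real ^ 'd) set set set)" "card P = min_part_card \<nu> r x"
  with cube_partition_nonempty[of P] show ?thesis by (metis One_nat_def Suc_leI card_gt_0_iff)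
qed

lemma min_part_card_mono:
  assumes "admissible r" "0 < x" "x \<le> y"
  shows "min_part_card \<nu> r x \<le> min_part_card \<nu> r y"
proof -
  have y: "0 < y" using assms by simp
  from min_part_card_attained[OF assms(1) y] obtain P where P: "P \<in> cube_partitions"
    "\<And>Q. Q \<in> P \<Longrightarrow> part_fun \<nu> r Q < 1 / y" "card P = min_part_card \<nu> r y" by metis
  have "1 / y \<le> 1 / x" using assms by (intro divide_left_mono) auto
  then have "part_fun \<nu> r Q < 1 / x" if "Q \<in> P" for Q using P(2)[OF that] by linarith
  then show ?thesis using min_part_card_le[OF P(1), of r x] P(3) by simp
qed

lemma min_part_card_antimono:
  assumes "admissible r" "r \<le> r'" "0 < x"
  shows "min_part_card \<nu> r' x \<le> min_part_card \<nu> r x"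
proof -
  from min_part_card_attained[OF assms(1,3)] obtain P where P: "P \<in> cube_partitions"
    "\<And>Q. Q \<in> P \<Longrightarrow> part_fun \<nu> r Q < 1 / x" "card P = min_part_card \<nu> r x" by metis
  have "part_fun \<nu> r' Q < 1 / x" if Q: "Q \<in> P" for Q
  proof -
    obtain n where "Q \<in> dyadic_cubes n" using P(1) Q unfolding cube_partitions_def all_dyadic_cubes_def by auto
    with part_fun_antimono[OF assms(1,2)] P(2)[OF Q] show ?thesis by force
  qed
  then show ?thesis using min_part_card_le[OF P(1), of r' x] P(3) by simp
qed

section \<open>Entropies, coarse counts and the critical exponent\<close>

lemma upper_entropy_lessD:
  assumes r: "admissible r" and "upper_entropy \<nu> r < ereal h"
  shows "\<forall>\<^sub>F x in at_top. real (min_part_card \<nu> r x) < x powr h"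
  using Limsup_lessD[OF assms(2)[unfolded upper_entropy_def]] eventually_gt_at_top[of 1]
proof eventually_elim
  case (elim x)
  have "0 < real (min_part_card \<nu> r x)" using min_part_card_pos[OF r, of x] elim by simp
  with elim show ?case by (simp only: less_ereal.simps ln_ratio_x)
qed

lemma lower_entropy_lessD:
  assumes r: "admissible r" and "lower_entropy \<nu> r < ereal h"
  shows "\<exists>\<^sub>F x in at_top. real (min_part_card \<nu> r x) < x powr h"
proof (rule ccontr)
  assume "\<not> ?thesis"
  then have "\<forall>\<^sub>F x in at_top. \<not> real (min_part_card \<nu> r x) < x powr h" by (simp only: not_frequently not_not)
  then have "\<forall>\<^sub>F x in at_top. ereal h \<le> ereal (ln (real (min_part_card \<nu> r x)) / ln x)"
    using eventually_gt_at_top[of 1]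
  proof eventually_elim
    case (elim x)
    have "0 < real (min_part_card \<nu> r x)" using min_part_card_pos[OF r, of x] elim by simp
    with elim have "\<not> ln (real (min_part_card \<nu> r x)) / ln x < h" by (simp only: ln_ratio_x not_False_eq_True)
    then show ?case by (simp only: ereal_less_eq not_less)
  qed
  then have "ereal h \<le> lower_entropy \<nu> r" unfolding lower_entropy_def by (rule Liminf_bounded)
  with assms(2) show False by simp
qed

lemma upper_entropy_leI:
  assumes r: "admissible r" and "\<forall>\<^sub>F x in at_top. real (min_part_card \<nu> r x) \<le> C * x powr h"
  shows "upper_entropy \<nu> r \<le> ereal h"
proof (rule dense_ge)
  fix z assume "ereal h < z"
  show "upper_entropy \<nu> r \<le> z"
  proof (cases z)
    case (real h')
    then have "h < h'" using \<open>ereal h < z\<close> by simp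
    from assms(2) eventually_mult_powr_less[OF this, of C] eventually_gt_at_top[of 1]
    have "\<forall>\<^sub>F x in at_top. ereal (ln (real (min_part_card \<nu> r x)) / ln x) \<le> ereal h'"
    proof eventually_elim
      case (elim x)
      have "0 < real (min_part_card \<nu> r x)" using min_part_card_pos[OF r, of x] elim by simp
      moreover have "real (min_part_card \<nu> r x) < x powr h'" using elim by linarith
      ultimately have "ln (real (min_part_card \<nu> r x)) / ln x < h'" using elim(3) by (simp only: ln_ratio_x)
      then show ?case by simp
    qed
    then show ?thesis unfolding upper_entropy_def real by (rule Limsup_bounded)
  qed (use \<open>ereal h < z\<close> in auto)
qed

lemma lower_entropy_geI:
  assumes r: "admissible r" and c: "0 < c"
    and "\<forall>\<^sub>F x in at_top. c * x powr h \<le> real (min_part_card \<nu> r x)"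
  shows "ereal h \<le> lower_entropy \<nu> r"
proof (rule dense_le)
  fix z assume "z < ereal h"
  show "z \<le> lower_entropy \<nu> r"
  proof (cases z)
    case (real h')
    then have "h' < h" using \<open>z < ereal h\<close> by simp
    from assms(3) eventually_mult_powr_less[OF this, of "1 / c"] eventually_gt_at_top[of 1]
    have "\<forall>\<^sub>F x in at_top. ereal h' \<le> ereal (ln (real (min_part_card \<nu> r x)) / ln x)"
    proof eventually_elim
      case (elim x)
      have "0 < real (min_part_card \<nu> r x)" using min_part_card_pos[OF r, of x] elim by simp
      moreover have "x powr h' < c * x powr h" using elim(2) c by (simp add: field_simps)
      then have "x powr h' < real (min_part_card \<nu> r x)" using elim by linarith
      ultimately have "h' < ln (real (min_part_card \<nu> r x)) / ln x" using elim(3) by (simp only: ln_ratio_x)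
      then show ?case by simp
    qed
    then show ?thesis unfolding lower_entropy_def real by (rule Liminf_bounded)
  qed (use \<open>z < ereal h\<close> in auto)
qed

lemma lower_entropy_nonneg:
  assumes r: "admissible r"
  shows "0 \<le> lower_entropy \<nu> r"
proof -
  have "ereal 0 \<le> lower_entropy \<nu> r"
  proof (rule lower_entropy_geI[OF r, of 1])
    show "\<forall>\<^sub>F x in at_top. 1 * x powr 0 \<le> real (min_part_card \<nu> r x)"
      using eventually_gt_at_top[of 1]
    proof eventually_elim
      case (elim x)
      then show ?case using min_part_card_pos[OF r, of x] by simp
    qed
  qed simp
  then show ?thesis by (simp add: zero_ereal_def)
qed

lemma lower_entropy_le_upper: "lower_entropy \<nu> r \<le> upper_entropy \<nu> r"
  unfolding lower_entropy_def upper_entropy_def by (rule Liminf_le_Limsup) simp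

text \<open>For q above the critical exponent Markov's inequality bounds the cubes of level n above
  the threshold 1 / x by x powr q * C * y ^ n with y < 1. The geometric series makes the bound
  independent of the stopping depth L.\<close>

lemma upper_entropy_le_crit:
  assumes r: "admissible r"
  shows "upper_entropy \<nu> r \<le> ereal (crit r)"
proof (rule dense_ge)
  fix z assume z: "ereal (crit r) < z"
  show "upper_entropy \<nu> r \<le> z"
  proof (cases z)
    case (real q)
    then have q: "0 < q" "\<beta> q < r * q" using z beta_less_above_crit[OF r, of q] by auto
    from part_moment_sum_decay[OF r q] obtain y C where y: "0 < y" "y < 1" "0 < C"
      "\<And>n. part_moment_sum \<nu> r n q \<le> C * y ^ n" by metis
    define K where "K = 1 + 2 ^ CARD('d) * (C / (1 - y))"
    have K: "real (min_part_card \<nu> r x) \<le> K * x powr q" if x: "1 < x" for x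
    proof -
      from stopping_partition[OF r, of x] x obtain P L where P: "P \<in> cube_partitions"
        "\<And>Q. Q \<in> P \<Longrightarrow> part_fun \<nu> r Q < 1 / x"
        "card P \<le> 1 + 2 ^ CARD('d) * (\<Sum>n<L. card {Q \<in> dyadic_cubes n. 1 / x \<le> part_fun \<nu> r Q})"
        by auto
      have c: "real (card {Q \<in> dyadic_cubes n. 1 / x \<le> part_fun \<nu> r Q}) \<le> x powr q * (C * y ^ n)" for n
      proof -
        have "real (card {Q \<in> dyadic_cubes n. 1 / x \<le> part_fun \<nu> r Q})
          = (\<Sum>Q\<in>{Q \<in> dyadic_cubes n. 1 / x \<le> part_fun \<nu> r Q}. 1)" by simp
        also have "\<dots> \<le> (\<Sum>Q\<in>{Q \<in> dyadic_cubes n. 1 / x \<le> part_fun \<nu> r Q}. x powr q * part_fun \<nu> r Q powr q)"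
        proof (rule sum_mono)
          fix Q assume "Q \<in> {Q \<in> dyadic_cubes n. 1 / x \<le> part_fun \<nu> r Q}"
          then have "1 \<le> x * part_fun \<nu> r Q" using x by (simp add: field_simps)
          then have "1 \<le> (x * part_fun \<nu> r Q) powr q" using q(1) by (intro ge_one_powr_ge_zero) auto
          then show "1 \<le> x powr q * part_fun \<nu> r Q powr q" by (simp add: powr_mult)
        qed
        also have "\<dots> \<le> (\<Sum>Q\<in>dyadic_cubes n. x powr q * part_fun \<nu> r Q powr q)"
          by (intro sum_mono2) auto
        also have "\<dots> = x powr q * part_moment_sum \<nu> r n q"
          unfolding part_moment_sum_def by (simp add: sum_distrib_left)
        also have "\<dots> \<le> x powr q * (C * y ^ n)" using y(4) by (intro mult_left_mono) auto
        finally show ?thesis .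
      qed
      have "real (min_part_card \<nu> r x) \<le> real (card P)" using min_part_card_le[OF P(1,2)] by simp
      also have "\<dots> \<le> real (1 + 2 ^ CARD('d) * (\<Sum>n<L. card {Q \<in> dyadic_cubes n. 1 / x \<le> part_fun \<nu> r Q}))"
        using P(3) by (intro of_nat_mono)
      also have "\<dots> = 1 + 2 ^ CARD('d) * (\<Sum>n<L. real (card {Q \<in> dyadic_cubes n. 1 / x \<le> part_fun \<nu> r Q}))"
        by simp
      also have "\<dots> \<le> 1 + 2 ^ CARD('d) * (\<Sum>n<L. x powr q * (C * y ^ n))"
        using c by (intro add_left_mono mult_left_mono sum_mono) auto
      also have "(\<Sum>n<L. x powr q * (C * y ^ n)) = x powr q * C * (\<Sum>n<L. y ^ n)"
        by (simp add: sum_distrib_left mult.assoc)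
      also have "\<dots> \<le> x powr q * C * (1 / (1 - y))"
      proof (intro mult_left_mono)
        show "(\<Sum>n<L. y ^ n) \<le> 1 / (1 - y)" using y by (subst sum_gp_strict) (auto intro!: divide_right_mono)
      qed (use y in auto)
      \<comment> \<open>Since x > 1, the contribution of the unit cube is absorbed into x powr
        q.\<close>
      also have "1 + 2 ^ CARD('d) * (x powr q * C * (1 / (1 - y))) \<le> x powr q + 2 ^ CARD('d) * (x powr q * C * (1 / (1 - y)))"
        using x q(1) ge_one_powr_ge_zero[of x q] by simp
      also have "\<dots> = K * x powr q" unfolding K_def by (simp add: algebra_simps)
      finally show ?thesis by simp
    qed
    have "\<forall>\<^sub>F x in at_top. real (min_part_card \<nu> r x) \<le> K * x powr q"
      using K by (rule eventually_mono[OF eventually_gt_at_top[of 1]])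
    from upper_entropy_leI[OF r this] show ?thesis unfolding real .
  qed (use z in auto)
qed

text \<open>Follow a point of a heavy cube Q into its partition cube R. Monotonicity of J forbids Q
  \<subseteq> R, so R lies inside Q; heavy cubes of one level are disjoint and receive different
  R.\<close>

lemma coarse_count_le_min_part_card:
  assumes r: "admissible r"
  shows "coarse_count \<nu> \<alpha> r n \<le> min_part_card \<nu> r (2 powr (\<alpha> * real n))"
proof -
  have "0 < 2 powr (\<alpha> * real n)" by simp
  from min_part_card_attained[OF r this] obtain P where P: "P \<in> cube_partitions"
    "\<And>Q. Q \<in> P \<Longrightarrow> part_fun \<nu> r Q < 1 / 2 powr (\<alpha> * real n)" "card P = min_part_card \<nu> r (2 powr (\<alpha> * real n))"
    by metis
  let ?S = "{Q \<in> dyadic_cubes n. part_fun \<nu> r Q \<ge> 2 powr (- \<alpha> * real n)}"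
  have "\<exists>R\<in>P. R \<subseteq> Q" if Q: "Q \<in> ?S" for Q
  proof -
    from Q have "Q \<in> dyadic_cubes n" by simp
    from dyadic_cubes_nonempty[OF this] obtain y where y: "y \<in> Q" "y \<in> half_open_unit_cube" by metis
    then have "y \<in> \<Union> P" using P(1) unfolding cube_partitions_def partition_on_def by simp
    then obtain R where R: "R \<in> P" "y \<in> R" by blast
    then obtain m where m: "R \<in> dyadic_cubes m" using P(1) unfolding cube_partitions_def all_dyadic_cubes_def by auto
    have "\<not> Q \<subseteq> R"
    proof
      assume "Q \<subseteq> R"
      then have "part_fun \<nu> r Q \<le> part_fun \<nu> r R" using Q by (intro part_fun_mono[OF r]) auto
      also have "\<dots> < 1 / 2 powr (\<alpha> * real n)" by (rule P(2)[OF R(1)])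
      finally show False using Q by (simp add: powr_minus field_simps)
    qed
    have "n \<le> m"
    proof (rule ccontr)
      assume "\<not> n \<le> m"
      then have "Q \<subseteq> R" using dyadic_cubes_nested[of R m Q n y] m Q R(2) y(1) by simp
      with \<open>\<not> Q \<subseteq> R\<close> show False by simp
    qed
    then have "R \<subseteq> Q" using dyadic_cubes_nested[of Q n R m y] Q R(2) y(1) m by simp
    with R(1) show ?thesis by blast
  qed
  then obtain f where f: "\<And>Q. Q \<in> ?S \<Longrightarrow> f Q \<in> P \<and> f Q \<subseteq> Q" by metis
  have "inj_on f ?S"
  proof (rule inj_onI)
    fix Q1 Q2 assume Q: "Q1 \<in> ?S" "Q2 \<in> ?S" "f Q1 = f Q2"
    have "f Q1 \<noteq> {}" using f[OF Q(1)] P(1) unfolding cube_partitions_def partition_on_def by auto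
    then obtain y where "y \<in> Q1" "y \<in> Q2" using f[OF Q(1)] f[OF Q(2)] Q(3) by auto
    then show "Q1 = Q2" using dyadic_cube_eq_cube_at[of Q1 n y] dyadic_cube_eq_cube_at[of Q2 n y] Q(1,2) by simp
  qed
  then have "card ?S \<le> card P" using f cube_partition_nonempty[OF P(1)] by (intro card_inj_on_le) auto
  then show ?thesis unfolding coarse_count_def P(3) .
qed

text \<open>Turns log^+ into the logarithm of a positive quantity, so that the rate lemmas apply
  also to a count of 0.\<close>

lemma max_0_ln_of_nat: "max 0 (ln (real k)) = ln (max 1 (real k))"
  by (cases "k = 0") (auto simp: max_def)

lemma upper_coarse_eq_rate: "upper_coarse \<nu> r \<alpha> = upper_rate (\<lambda>n. max 1 (real (coarse_count \<nu> \<alpha> r n)))"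
  unfolding upper_coarse_def upper_rate_def max_0_ln_of_nat ..

lemma lower_coarse_eq_rate: "lower_coarse \<nu> r \<alpha> = lower_rate (\<lambda>n. max 1 (real (coarse_count \<nu> \<alpha> r n)))"
  unfolding lower_coarse_def lower_rate_def max_0_ln_of_nat ..

lemma ereal_divide_le_iff: "0 < a \<Longrightarrow> x / ereal a \<le> ereal h \<longleftrightarrow> x \<le> ereal (h * a)"
  by (cases x) (auto simp: field_simps)

lemma ereal_less_divide_iff: "0 < a \<Longrightarrow> ereal h < x / ereal a \<longleftrightarrow> ereal (h * a) < x"
  by (cases x) (auto simp: field_simps)

lemma filterlim_two_powr: "0 < \<alpha> \<Longrightarrow> filterlim (\<lambda>n. 2 powr (\<alpha> * real n)) at_top sequentially"
proof -
  assume "0 < \<alpha>"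
  then have "filterlim (\<lambda>n. \<alpha> * real n) at_top sequentially"
    by (intro filterlim_tendsto_pos_mult_at_top[OF tendsto_const] filterlim_real_sequentially)
  then have "filterlim (\<lambda>n. exp (\<alpha> * real n * ln 2)) at_top sequentially"
    by (intro filterlim_compose[OF exp_at_top] filterlim_at_top_mult_tendsto_pos[OF tendsto_const]) auto
  then show ?thesis by (simp add: powr_def)
qed

lemma upper_coarse_dim_le_upper_entropy:
  assumes r: "admissible r"
  shows "upper_coarse_dim \<nu> r \<le> upper_entropy \<nu> r"
  unfolding upper_coarse_dim_def
proof (rule SUP_least)
  fix \<alpha> :: real assume "\<alpha> \<in> {0<..}"
  then have \<alpha>: "0 < \<alpha>" by simp
  show "upper_coarse \<nu> r \<alpha> / ereal \<alpha> \<le> upper_entropy \<nu> r"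
  proof (rule dense_ge)
    fix z assume z: "upper_entropy \<nu> r < z"
    show "upper_coarse \<nu> r \<alpha> / ereal \<alpha> \<le> z"
    proof (cases z)
      case (real h)
      have u: "upper_entropy \<nu> r < ereal h" using z real by simp
      have "\<forall>\<^sub>F n in sequentially. real (min_part_card \<nu> r (2 powr (\<alpha> * real n))) < (2 powr (\<alpha> * real n)) powr h"
        by (rule eventually_compose_filterlim[OF upper_entropy_lessD[OF r u] filterlim_two_powr[OF \<alpha>]])
      then have "\<forall>\<^sub>F n in sequentially. max 1 (real (coarse_count \<nu> \<alpha> r n)) \<le> 1 * 2 powr (h * \<alpha> * real n)"
      proof eventually_elim
        case (elim n)
        have "1 \<le> real (min_part_card \<nu> r (2 powr (\<alpha> * real n)))"
          using min_part_card_pos[OF r, of "2 powr (\<alpha> * real n)"] by simp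
        moreover have "real (coarse_count \<nu> \<alpha> r n) \<le> real (min_part_card \<nu> r (2 powr (\<alpha> * real n)))"
          using coarse_count_le_min_part_card[OF r] by simp
        moreover have "(2 powr (\<alpha> * real n)) powr h = 2 powr (h * \<alpha> * real n)"
          by (simp add: powr_powr algebra_simps)
        ultimately show ?case using elim by simp
      qed
      then have "upper_coarse \<nu> r \<alpha> \<le> ereal (h * \<alpha>)"
        unfolding upper_coarse_eq_rate by (rule upper_rate_leI) simp
      then show ?thesis unfolding real using \<alpha> by (simp add: ereal_divide_le_iff)
    qed (use z in auto)
  qed
qed

text \<open>The liminf of the entropy runs over all real x, the counts only over x = 2 powr
  (\<alpha> n). Rounding the level down costs the constant 2 powr (- (f \<alpha>)), by monotonicity
  of \<open>min_part_card\<close>. Nonpositive bounds are trivial, so f > 0 may be assumed.\<close>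

lemma lower_coarse_dim_le_lower_entropy:
  assumes r: "admissible r"
  shows "lower_coarse_dim \<nu> r \<le> lower_entropy \<nu> r"
  unfolding lower_coarse_dim_def
proof (rule SUP_least)
  fix \<alpha> :: real assume "\<alpha> \<in> {0<..}"
  then have \<alpha>: "0 < \<alpha>" by simp
  show "lower_coarse \<nu> r \<alpha> / ereal \<alpha> \<le> lower_entropy \<nu> r"
  proof (rule dense_le)
    fix z assume z: "z < lower_coarse \<nu> r \<alpha> / ereal \<alpha>"
    show "z \<le> lower_entropy \<nu> r"
    proof (cases "z \<le> 0")
      case True
      then show ?thesis using lower_entropy_nonneg[OF r] by (rule order_trans)
    next
      case False
      then obtain f where f: "z = ereal f" "0 < f" using z by (cases z) auto
      have "ereal (f * \<alpha>) < lower_coarse \<nu> r \<alpha>" using z \<alpha> unfolding f by (simp add: ereal_less_divide_iff)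
      then have "\<forall>\<^sub>F n in sequentially. 2 powr (f * \<alpha> * real n) < max 1 (real (coarse_count \<nu> \<alpha> r n))"
        unfolding lower_coarse_eq_rate by (rule lower_rate_greaterD) simp
      then obtain n0 where n0: "\<And>n. n0 \<le> n \<Longrightarrow> 2 powr (f * \<alpha> * real n) < max 1 (real (coarse_count \<nu> \<alpha> r n))"
        unfolding eventually_sequentially by auto
      have "ereal f \<le> lower_entropy \<nu> r"
      proof (rule lower_entropy_geI[OF r, of "2 powr (- (f * \<alpha>))"])
        show "\<forall>\<^sub>F x in at_top. 2 powr (- (f * \<alpha>)) * x powr f \<le> real (min_part_card \<nu> r x)"
          using eventually_ge_at_top[of "2 powr (\<alpha> * (real n0 + 1))"] eventually_gt_at_top[of 1]
        proof eventually_elim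
          case (elim x)
          \<comment> \<open>The largest level whose threshold 2 powr (\<alpha> n) does not exceed x;
            the lower bound on x puts it past n0.\<close>
          define n where "n = nat \<lfloor>log 2 x / \<alpha>\<rfloor>"
          have lx: "0 < log 2 x" using elim by simp
          have "\<alpha> * (real n0 + 1) \<le> log 2 x" using elim by (simp add: le_log_iff)
          then have "real n0 + 1 \<le> log 2 x / \<alpha>" using \<alpha> by (simp add: field_simps)
          then have n: "n0 \<le> n" unfolding n_def by linarith
          have "real n \<le> log 2 x / \<alpha>" "log 2 x / \<alpha> \<le> real n + 1"
            unfolding n_def using lx \<alpha> by (auto simp: less_imp_le)
          then have an: "\<alpha> * real n \<le> log 2 x" "log 2 x \<le> \<alpha> * real n + \<alpha>"
            using \<alpha> by (auto simp: field_simps)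
          have x: "x = 2 powr (log 2 x)" using elim by simp
          have "1 \<le> 2 powr (f * \<alpha> * real n)" using f \<alpha> by (intro ge_one_powr_ge_zero) auto
          with n0[OF n] have "2 powr (f * \<alpha> * real n) \<le> real (coarse_count \<nu> \<alpha> r n)" by (simp add: max_def split: if_splits)
          also have "\<dots> \<le> real (min_part_card \<nu> r (2 powr (\<alpha> * real n)))"
            using coarse_count_le_min_part_card[OF r] by simp
          also have "\<dots> \<le> real (min_part_card \<nu> r x)"
            using an(1) by (subst x, intro of_nat_mono min_part_card_mono[OF r] powr_mono) auto
          finally have "2 powr (f * \<alpha> * real n) \<le> real (min_part_card \<nu> r x)" .
          moreover have "2 powr (- (f * \<alpha>)) * x powr f \<le> 2 powr (f * \<alpha> * real n)"
          proof -
            have "2 powr (- (f * \<alpha>)) * x powr f = 2 powr (f * log 2 x - f * \<alpha>)"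
              by (subst x, simp only: powr_powr powr_add[symmetric]) (simp add: algebra_simps)
            also have "f * (log 2 x - \<alpha>) \<le> f * (\<alpha> * real n)" using an f by (intro mult_left_mono) auto
            then have "2 powr (f * log 2 x - f * \<alpha>) \<le> 2 powr (f * \<alpha> * real n)"
              by (intro powr_mono) (auto simp: algebra_simps)
            finally show ?thesis .
          qed
          ultimately show ?case by linarith
        qed
      qed simp
      then show ?thesis unfolding f .
    qed
  qed
qed

text \<open>For an arithmetic grid \<open>a\<close> of exponents the number of layers does not depend on the scale \<open>n\<close>.\<close>

lemma powr_le_sum_layers:
  fixes v q n :: real and a :: "nat \<Rightarrow> real"
  assumes v: "0 \<le> v" "v \<le> 2 powr (- a 0 * n)" and q: "0 < q"
  shows "v powr q \<le> (\<Sum>j<J. (if 2 powr (- a (Suc j) * n) \<le> v then (2 powr (- a j * n)) powr q else 0))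
    + (2 powr (- a J * n)) powr q"
proof (induction J)
  case 0
  have "v powr q \<le> (2 powr (- a 0 * n)) powr q" using v q by (intro powr_mono2) auto
  then show ?case by simp
next
  case (Suc J)
  show ?case
  proof (cases "2 powr (- a (Suc J) * n) \<le> v")
    case True
    then show ?thesis using Suc by (simp add: add_increasing2)
  next
    case False
    then have "v powr q \<le> (2 powr (- a (Suc J) * n)) powr q" using v q by (intro powr_mono2) auto
    moreover have "0 \<le> (\<Sum>j<Suc J. (if 2 powr (- a (Suc j) * n) \<le> v then (2 powr (- a j * n)) powr q else 0))"
      by (intro sum_nonneg) auto
    ultimately show ?thesis by linarith
  qed
qed

text \<open>Suppose c lies strictly between the coarse dimension and the critical exponent, and q
  between c and the latter. In layer j at most 2 powr (c a(j+1) n) cubes contribute at most 2 powr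
  (- a(j) q n) each, so on a suitable grid every layer sums to at most 1. The weight sums then stay
  bounded, against their growth below the critical exponent.\<close>

lemma crit_le_upper_coarse_dim:
  assumes r: "admissible r"
  shows "ereal (crit r) \<le> upper_coarse_dim \<nu> r"
proof (rule ccontr)
  assume n: "\<not> ?thesis"
  \<comment> \<open>The maximum with 0 makes c positive; the grid step below is divided by
    c.\<close>
  then have "max 0 (upper_coarse_dim \<nu> r) < ereal (crit r)" using crit_pos[OF r] by simp
  then obtain c where c: "max 0 (upper_coarse_dim \<nu> r) < ereal c" "ereal c < ereal (crit r)"
    using ereal_dense2 by blast
  then have c0: "0 < c" "c < crit r" "upper_coarse_dim \<nu> r < ereal c" by (auto simp: zero_ereal_def)
  obtain q where q: "c < q" "q < crit r" using dense[OF c0(2)] by blast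
  have q0: "0 < q" using q c0 by simp
  obtain b where b: "r * q < b" "b < \<beta> q" using dense[OF beta_greater_below_crit[OF r q0 q(2)]] by blast
  from weight_decay[OF r] obtain \<kappa> C where k: "0 < \<kappa>" "1 \<le> C"
    "\<And>n Q. Q \<in> dyadic_cubes n \<Longrightarrow> weight \<nu> r Q \<le> C * 2 powr (- (\<kappa> * real n))" by metis
  \<comment> \<open>The step solves c (\<kappa>/2 + \<delta>) = q \<kappa>/2; later steps have even
    more room because c < q.\<close>
  define \<delta> where "\<delta> = (q - c) * (\<kappa> / 2) / c"
  have \<delta>: "0 < \<delta>" "c * \<delta> = (q - c) * (\<kappa> / 2)" unfolding \<delta>_def using q c0 k by auto
  define a where "a j = \<kappa> / 2 + real j * \<delta>" for j
  have a_pos: "0 < a j" for j unfolding a_def using k \<delta> by (simp add: add_pos_nonneg)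
  have a_step: "c * a (Suc j) \<le> q * a j" for j
  proof -
    have "c * a (Suc j) = c * (\<kappa> / 2) + c * (real j * \<delta>) + c * \<delta>" unfolding a_def by (simp add: algebra_simps)
    also have "\<dots> = (c + (q - c)) * (\<kappa> / 2) + c * (real j * \<delta>)" unfolding \<delta>(2) by (simp only: distrib_right add_ac)
    also have "\<dots> = q * (\<kappa> / 2) + c * (real j * \<delta>)" by simp
    also have "\<dots> \<le> q * (\<kappa> / 2) + q * (real j * \<delta>)" using q \<delta>(1) by (intro add_left_mono mult_right_mono) auto
    finally show ?thesis unfolding a_def by (simp add: algebra_simps)
  qed
  \<comment> \<open>Weights below 2 powr (- a J n) have q-th powers of at most 2 powr (- d n), so
    all cubes of the level together add at most 1.\<close>
  obtain J where J: "real CARD('d) / q / \<delta> < real J" using reals_Archimedean2 by blast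
  have aJ: "real CARD('d) \<le> a J * q"
  proof -
    have "real CARD('d) / q / \<delta> * (\<delta> * q) \<le> real J * (\<delta> * q)"
      using J q0 \<delta>(1) by (intro mult_right_mono) auto
    then have "real CARD('d) \<le> real J * \<delta> * q" using q0 \<delta>(1) by (simp add: mult.assoc)
    also have "\<dots> \<le> a J * q" unfolding a_def using k q0 by (intro mult_right_mono) auto
    finally show ?thesis .
  qed
  have "\<forall>\<^sub>F n in sequentially. real (coarse_count \<nu> (a (Suc j)) r n) \<le> 2 powr (a j * q * real n)" for j
  proof -
    have "upper_coarse \<nu> r (a (Suc j)) / ereal (a (Suc j)) \<le> upper_coarse_dim \<nu> r"
      unfolding upper_coarse_dim_def using a_pos by (intro SUP_upper) auto
    also note c0(3)
    finally have "upper_coarse \<nu> r (a (Suc j)) < ereal (c * a (Suc j))"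
      using a_pos[of "Suc j"] by (cases "upper_coarse \<nu> r (a (Suc j))") (auto simp: divide_less_eq)
    then have "\<forall>\<^sub>F n in sequentially. max 1 (real (coarse_count \<nu> (a (Suc j)) r n)) < 2 powr (c * a (Suc j) * real n)"
      unfolding upper_coarse_eq_rate by (rule upper_rate_lessD) simp
    then show ?thesis
    proof eventually_elim
      case (elim n)
      have "2 powr (c * a (Suc j) * real n) \<le> 2 powr (a j * q * real n)"
        using a_step[of j] by (intro powr_mono mult_right_mono) (auto simp: mult.commute)
      with elim show ?case by linarith
    qed
  qed
  then have cnt: "\<forall>\<^sub>F n in sequentially. \<forall>j\<in>{..<J}. real (coarse_count \<nu> (a (Suc j)) r n) \<le> 2 powr (a j * q * real n)"
    by (intro eventually_ball_finite) auto
  \<comment> \<open>Starting the grid at \<kappa>/2 instead of \<kappa> leaves room for the constant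
    C.\<close>
  have small: "\<forall>\<^sub>F n in sequentially. 2 powr (- \<kappa> * real n) < 1 / C * 2 powr (- (\<kappa> / 2) * real n)"
    using k by (intro eventually_powr_less) auto
  have big: "\<forall>\<^sub>F n in sequentially. 2 powr (0 * real n) < 1 / (real J + 1) * 2 powr ((b - r * q) * real n)"
    using b by (intro eventually_powr_less) auto
  have "\<forall>\<^sub>F n in sequentially. moment_sum \<nu> n q \<le> 2 powr (b * real n)"
    using cnt small big
  proof eventually_elim
    case (elim n)
    define G where "G j = {Q \<in> dyadic_cubes n. 2 powr (- a (Suc j) * real n) \<le> weight \<nu> r Q}" for j
    have cG: "real (card (G j)) \<le> 2 powr (a j * q * real n)" if "j < J" for j
    proof -
      \<comment> \<open>Layers are formed by \<open>weight\<close>, whose powers sum to the moment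
        sums, and counted through \<open>part_fun\<close>, which dominates it.\<close>
      have "card (G j) \<le> coarse_count \<nu> (a (Suc j)) r n"
        unfolding G_def coarse_count_def using weight_le_part_fun[OF r]
        by (intro card_mono) (auto intro: order_trans)
      with elim(1) that show ?thesis by (auto intro: order_trans[OF of_nat_mono])
    qed
    have "(\<Sum>Q\<in>dyadic_cubes n. weight \<nu> r Q powr q)
      \<le> (\<Sum>Q\<in>dyadic_cubes n. (\<Sum>j<J. (if 2 powr (- a (Suc j) * real n) \<le> weight \<nu> r Q then (2 powr (- a j * real n)) powr q else 0))
        + (2 powr (- a J * real n)) powr q)"
    proof (rule sum_mono)
      fix Q :: "(real ^ 'd) set" assume Q: "Q \<in> dyadic_cubes n"
      have "weight \<nu> r Q \<le> C * 2 powr (- \<kappa> * real n)" using k(3)[OF Q] by simp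
      also have "\<dots> \<le> 2 powr (- a 0 * real n)" using elim(2) k(2) unfolding a_def by (simp add: field_simps)
      finally show "weight \<nu> r Q powr q \<le> (\<Sum>j<J. (if 2 powr (- a (Suc j) * real n) \<le> weight \<nu> r Q then (2 powr (- a j * real n)) powr q else 0))
        + (2 powr (- a J * real n)) powr q"
        by (intro powr_le_sum_layers weight_nonneg q0)
    qed
    also have "\<dots> = (\<Sum>j<J. \<Sum>Q\<in>dyadic_cubes n. (if 2 powr (- a (Suc j) * real n) \<le> weight \<nu> r Q then (2 powr (- a j * real n)) powr q else 0))
        + real (card (dyadic_cubes n :: (real ^ 'd) set set)) * (2 powr (- a J * real n)) powr q"
      by (simp add: sum.distrib sum.swap[of _ "dyadic_cubes n"])
    also have "\<dots> = (\<Sum>j<J. real (card (G j)) * (2 powr (- a j * real n)) powr q)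
        + real (card (dyadic_cubes n :: (real ^ 'd) set set)) * (2 powr (- a J * real n)) powr q"
      unfolding G_def by (simp add: sum.If_cases Int_def)
    also have "\<dots> \<le> (\<Sum>j<J. 1) + 1"
    proof (intro add_mono sum_mono)
      fix j assume "j \<in> {..<J}"
      then have "real (card (G j)) * (2 powr (- a j * real n)) powr q \<le> 2 powr (a j * q * real n) * (2 powr (- a j * real n)) powr q"
        using cG by (intro mult_right_mono) auto
      also have "\<dots> = 1" by (simp add: powr_powr powr_add[symmetric] algebra_simps)
      finally show "real (card (G j)) * (2 powr (- a j * real n)) powr q \<le> 1" .
    next
      have "real (card (dyadic_cubes n :: (real ^ 'd) set set)) * (2 powr (- a J * real n)) powr q
        \<le> 2 powr (real CARD('d) * real n) * (2 powr (- a J * real n)) powr q"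
        by (intro mult_right_mono card_dyadic_cubes_powr) simp
      also have "\<dots> = 2 powr ((real CARD('d) - a J * q) * real n)"
        by (simp add: powr_powr powr_add[symmetric] algebra_simps)
      also have "\<dots> \<le> 2 powr 0" using aJ by (intro powr_mono mult_nonpos_nonneg) auto
      finally show "real (card (dyadic_cubes n :: (real ^ 'd) set set)) * (2 powr (- a J * real n)) powr q \<le> 1" by simp
    qed
    also have "\<dots> = real J + 1" by simp
    also have "\<dots> \<le> 2 powr ((b - r * q) * real n)" using elim(3) by (simp add: field_simps)
    finally have "moment_sum \<nu> n q * 2 powr (- (r * q) * real n) \<le> 2 powr ((b - r * q) * real n)"
      unfolding sum_weight_powr .
    also have "\<dots> = 2 powr (b * real n) * 2 powr (- (r * q) * real n)"
      by (simp add: powr_add[symmetric] algebra_simps)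
    finally show ?case by simp
  qed
  then have "\<not> (\<exists>\<^sub>F n in sequentially. 2 powr (b * real n) < moment_sum \<nu> n q)"
    by (simp add: not_frequently not_less)
  with moment_sum_ge[OF less_imp_le[OF q0] b(2)] show False by simp
qed

lemma upper_coarse_dim_eq:
  assumes "admissible r"
  shows "upper_coarse_dim \<nu> r = ereal (crit r)"
  using crit_le_upper_coarse_dim[OF assms] upper_coarse_dim_le_upper_entropy[OF assms]
    upper_entropy_le_crit[OF assms] by simp

lemma upper_entropy_eq:
  assumes "admissible r"
  shows "upper_entropy \<nu> r = ereal (crit r)"
  using crit_le_upper_coarse_dim[OF assms] upper_coarse_dim_le_upper_entropy[OF assms]
    upper_entropy_le_crit[OF assms] by simp

end

section \<open>Estimates for the quantization error\<close>

lemma is_norm_upper: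
  fixes N :: "real ^ 'd \<Rightarrow> real"
  assumes "is_norm N"
  obtains C where "0 < C" "\<And>x. N x \<le> C * norm x"
proof -
  have tri: "N (x + y) \<le> N x + N y" and hom: "N (c *\<^sub>R x) = \<bar>c\<bar> * N x" and nn: "0 \<le> N x" and z: "N 0 = 0" for x y c
    using assms unfolding is_norm_def by auto
  have sum: "N (\<Sum>i\<in>I. f i) \<le> (\<Sum>i\<in>I. N (f i))" if "finite I" for I :: "'d set" and f
    using that
  proof (induction I rule: finite_induct)
    case (insert i I)
    then show ?case using tri[of "f i" "\<Sum>i\<in>I. f i"] by simp
  qed (simp add: z)
  have "N x \<le> (1 + (\<Sum>i\<in>UNIV. N (axis i 1))) * norm x" for x
  proof -
    have "x = (\<Sum>i\<in>UNIV. (x $ i) *\<^sub>R axis i 1)"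
      using basis_expansion[of x] by (simp add: scalar_mult_eq_scaleR)
    then have "N x = N (\<Sum>i\<in>UNIV. (x $ i) *\<^sub>R axis i 1)" by simp
    also have "\<dots> \<le> (\<Sum>i\<in>UNIV. N ((x $ i) *\<^sub>R axis i 1))" by (rule sum) simp
    also have "\<dots> \<le> (\<Sum>i\<in>UNIV. norm x * N (axis i 1))"
      unfolding hom using component_le_norm_cart nn by (intro sum_mono mult_right_mono) auto
    also have "\<dots> = (\<Sum>i\<in>UNIV. N (axis i 1)) * norm x" by (simp add: sum_distrib_left mult.commute)
    finally show ?thesis by (simp add: distrib_right add_increasing)
  qed
  moreover have "0 < 1 + (\<Sum>i\<in>UNIV. N (axis i (1::real)))" using nn by (intro add_pos_nonneg sum_nonneg) auto
  ultimately show ?thesis using that by blast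
qed

lemma is_norm_continuous:
  fixes N :: "real ^ 'd \<Rightarrow> real"
  assumes "is_norm N"
  shows "continuous_on UNIV N"
proof -
  from is_norm_upper[OF assms] obtain C where C: "0 < C" "\<And>x. N x \<le> C * norm x" by blast
  have tri: "N (x + y) \<le> N x + N y" and hom: "N (c *\<^sub>R x) = \<bar>c\<bar> * N x" for x y c
    using assms unfolding is_norm_def by auto
  have d: "N x - N y \<le> C * norm (x - y)" for x y
    using tri[of y "x - y"] C(2)[of "x - y"] by simp
  have "\<bar>N x - N y\<bar> \<le> C * norm (x - y)" for x y
    using d[of x y] d[of y x] by (auto simp: norm_minus_commute abs_le_iff)
  then have "C-lipschitz_on UNIV N"
    using C(1) by (intro lipschitz_onI) (auto simp: dist_norm dist_real_def)
  then show ?thesis by (rule lipschitz_on_continuous_on)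
qed

lemma is_norm_lower:
  fixes N :: "real ^ 'd \<Rightarrow> real"
  assumes "is_norm N"
  obtains c where "0 < c" "\<And>x. c * norm x \<le> N x"
proof -
  have hom: "N (c *\<^sub>R x) = \<bar>c\<bar> * N x" and nn: "0 \<le> N x" and z: "N x = 0 \<longleftrightarrow> x = 0" for x c
    using assms unfolding is_norm_def by auto
  have "sphere (0 :: real ^ 'd) 1 \<noteq> {}" by simp
  moreover have "continuous_on (sphere 0 1) N"
    using is_norm_continuous[OF assms] continuous_on_subset by blast
  ultimately obtain u where u: "u \<in> sphere 0 1" "\<And>y. y \<in> sphere 0 1 \<Longrightarrow> N u \<le> N y"
    using continuous_attains_inf[of "sphere (0 :: real ^ 'd) 1" N] compact_sphere by blast
  have "0 < N u" using nn[of u] z[of u] u(1) by (cases "N u = 0") auto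
  moreover have "N u * norm x \<le> N x" for x
  proof (cases "x = 0")
    case False
    have "N u \<le> N ((1 / norm x) *\<^sub>R x)" using False by (intro u(2)) simp
    then show ?thesis unfolding hom using False by (simp add: field_simps)
  qed (simp add: nn)
  ultimately show ?thesis using that by blast
qed

lemma divide_two_power_powr:
  fixes c :: real
  assumes "0 < c"
  shows "(c / 2 ^ l) powr r = c powr r * 2 powr (- (real l * r))"
proof -
  have "c / 2 ^ l = c * 2 powr (- real l)" by (simp add: powr_minus powr_realpow divide_inverse)
  then show ?thesis using assms by (simp only: powr_mult powr_powr) simp
qed

lemma epow_ennreal: "s \<noteq> 0 \<Longrightarrow> 0 < b \<Longrightarrow> epow (ennreal b) s = ennreal (b powr s)"
  unfolding epow_def by (simp add: ennreal_eq_0_iff not_le)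

lemma epow_mono: "0 < s \<Longrightarrow> x \<le> y \<Longrightarrow> epow x s \<le> epow y s"
  unfolding epow_def
  by (cases x; cases y) (auto simp: top_unique ennreal_le_iff intro!: powr_mono2 ennreal_leI)

lemma epow_antimono: "s < 0 \<Longrightarrow> x \<le> y \<Longrightarrow> epow y s \<le> epow x s"
  unfolding epow_def
  by (cases x; cases y) (auto simp: top_unique ennreal_le_iff intro!: powr_mono2' ennreal_leI)

lemma codebooksD: "A \<in> codebooks n \<Longrightarrow> finite A \<and> A \<noteq> {}"
  unfolding codebooks_def by (auto intro: card_ge_0_finite)

lemma dist_set_le: "finite A \<Longrightarrow> a \<in> A \<Longrightarrow> dist_set N x A \<le> N (x - a)"
  unfolding dist_set_def by (intro Min_le) auto

lemma dist_set_attained: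
  assumes "finite A" "A \<noteq> {}"
  obtains a where "a \<in> A" "dist_set N x A = N (x - a)"
proof -
  have "dist_set N x A \<in> (\<lambda>y. N (x - y)) ` A" unfolding dist_set_def using assms by (intro Min_in) auto
  then show ?thesis using that by auto
qed

definition quant_integral :: "(real ^ 'd \<Rightarrow> real) \<Rightarrow> (real ^ 'd) measure \<Rightarrow> real \<Rightarrow> (real ^ 'd) set \<Rightarrow> ennreal" where
  "quant_integral N \<nu> r A = (\<integral>\<^sup>+ x. epow (ennreal (dist_set N x A)) r \<partial>\<nu>)"

text \<open>Finds the dyadic shell that contains \<delta>. The conclusion l \<le> k ensures that a
  cube of the scale of the shell fits into a cube of level l around the same point.\<close>

lemma dyadic_scale:
  fixes c \<delta> :: real
  assumes "0 < \<delta>" "0 < c" "\<delta> < c / 2 ^ l"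
  obtains k where "l \<le> k" "c / 2 ^ Suc k \<le> \<delta>" "\<delta> < c / 2 ^ k"
proof -
  have "\<exists>m. c / 2 ^ Suc m \<le> \<delta>"
  proof -
    obtain m where "(1 / 2) ^ m < \<delta> / c" using real_arch_pow_inv[of "\<delta> / c" "1 / 2"] assms by auto
    then have "c * (1 / 2) ^ m < \<delta>" using assms by (simp add: field_simps)
    moreover have "c / 2 ^ Suc m \<le> c * (1 / 2) ^ m" using assms by (simp add: power_one_over field_simps)
    ultimately have "c / 2 ^ Suc m \<le> \<delta>" by linarith
    then show ?thesis by blast
  qed
  define k where "k = (LEAST m. c / 2 ^ Suc m \<le> \<delta>)"
  have k: "c / 2 ^ Suc k \<le> \<delta>" unfolding k_def by (rule LeastI_ex) fact
  have "c / 2 ^ Suc k < c / 2 ^ l" using k assms by linarith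
  then have "(2::real) ^ l < 2 ^ Suc k" using assms by (simp add: field_simps)
  then have "l < Suc k" by (rule power_less_imp_less_exp[rotated]) simp
  then have lk: "l \<le> k" by simp
  have "\<delta> < c / 2 ^ k"
  proof (cases "k = l")
    case False
    with lk obtain m where m: "k = Suc m" by (cases k) auto
    then have "\<not> c / 2 ^ Suc m \<le> \<delta>" using not_less_Least[of m "\<lambda>m. c / 2 ^ Suc m \<le> \<delta>"] unfolding k_def[symmetric] by simp
    then show ?thesis unfolding m by simp
  qed (use assms in simp)
  with k lk that show ?thesis by blast
qed

context quant_measure
begin

lemma AE_unit_cube: "AE x in \<nu>. x \<in> half_open_unit_cube"
  using sets_half_open_unit_cube sets_nu conc by (subst prob_eq_1[symmetric]) auto

text \<open>Positive lower dimension excludes atoms. Integrands of order r \<le> 0 are infinite at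
  the codebook points, so these have to be null.\<close>

lemma measure_singleton: "measure \<nu> {a} = 0"
proof (cases "a \<in> half_open_unit_cube")
  case False
  have "AE x in \<nu>. x \<notin> {a}" using AE_unit_cube False by (auto elim: eventually_mono)
  then show ?thesis using sets_nu by (subst prob_eq_0) auto
next
  case True
  obtain s where s: "0 < s" "ereal s < dim_infty \<nu>" using dim_infty_dense[OF neg_dim_infty_less[of 0]] by auto
  from measure_decay[OF s(2)] obtain C where C: "1 \<le> C"
    "\<And>n Q. Q \<in> dyadic_cubes n \<Longrightarrow> measure \<nu> Q \<le> C * 2 powr (- (s * real n))" by blast
  have le: "measure \<nu> {a} \<le> C * (2 powr (- s)) ^ n" for n
  proof -
    have "measure \<nu> {a} \<le> measure \<nu> (cube_at n a)"
      using mem_cube_at sets_nu_cubes[OF cube_at_in_dyadic_cubes[OF True]] by (intro finite_measure_mono) auto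
    also have "\<dots> \<le> C * 2 powr (- (s * real n))" by (rule C(2)[OF cube_at_in_dyadic_cubes[OF True]])
    finally show ?thesis by (simp add: powr_level)
  qed
  have "2 powr (- s) < 1" using s(1) by (intro powr_less_one) auto
  then have "(\<lambda>n. C * (2 powr (- s)) ^ n) \<longlonglongrightarrow> C * 0"
    by (intro tendsto_intros LIMSEQ_power_zero) auto
  then have "measure \<nu> {a} \<le> 0" using le by (intro LIMSEQ_le_const) auto
  then show ?thesis by (simp add: measure_le_0_iff)
qed

end

section \<open>Integrals of distance powers against partitions and heavy cubes\<close>

locale quantization = quant_measure \<nu> for \<nu> :: "(real ^ 'd) measure" +
  fixes N :: "real ^ 'd \<Rightarrow> real"
  assumes norm_N: "is_norm N"
begin

lemma N_nonneg: "0 \<le> N x" and N_eq_0: "N x = 0 \<longleftrightarrow> x = 0"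
  using norm_N unfolding is_norm_def by auto

text \<open>Here \<open>C0\<close>, and in \<open>N_component\<close> \<open>c0\<close>, tie the
  arbitrary norm to the scale 2^(-n) of the cubes, from above and from below.\<close>

lemma N_diam:
  obtains C0 where "0 < C0" "\<And>n Q x y. Q \<in> dyadic_cubes n \<Longrightarrow> x \<in> Q \<Longrightarrow> y \<in> Q \<Longrightarrow> N (x - y) \<le> C0 / 2 ^ n"
proof -
  from is_norm_upper[OF norm_N] obtain C where C: "0 < C" "\<And>x. N x \<le> C * norm x" by blast
  have "N (x - y) \<le> (C * real CARD('d)) / 2 ^ n" if Q: "Q \<in> dyadic_cubes n" "x \<in> Q" "y \<in> Q" for n Q x y
  proof -
    have "norm (x - y) \<le> (\<Sum>i\<in>UNIV. \<bar>(x - y) $ i\<bar>)" by (rule norm_le_l1_cart)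
    also have "\<dots> \<le> (\<Sum>i\<in>(UNIV :: 'd set). 1 / 2 ^ n)"
      using dyadic_cubes_dist[OF Q] by (intro sum_mono) simp
    finally have "C * norm (x - y) \<le> C * (real CARD('d) / 2 ^ n)"
      using C(1) by (intro mult_left_mono) auto
    with C(2)[of "x - y"] show ?thesis by simp
  qed
  moreover have "0 < C * real CARD('d)" using C(1) by simp
  ultimately show ?thesis using that by blast
qed

lemma N_component:
  obtains c0 where "0 < c0" "\<And>x i. c0 * \<bar>x $ i\<bar> \<le> N x"
proof -
  from is_norm_lower[OF norm_N] obtain c where c: "0 < c" "\<And>x. c * norm x \<le> N x" by blast
  have "c * \<bar>x $ i\<bar> \<le> N x" for x i
    using c component_le_norm_cart[of x i] by (intro order_trans[OF _ c(2)] mult_left_mono) auto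
  with c(1) that show ?thesis by blast
qed

lemma dist_set_pos: "A \<in> codebooks n \<Longrightarrow> x \<notin> A \<Longrightarrow> 0 < dist_set N x A"
proof -
  assume A: "A \<in> codebooks n" "x \<notin> A"
  from codebooksD[OF A(1)] obtain a where a: "a \<in> A" "dist_set N x A = N (x - a)"
    using dist_set_attained[of A N x] by metis
  then have "N (x - a) \<noteq> 0" using A(2) N_eq_0[of "x - a"] by auto
  with a N_nonneg[of "x - a"] show ?thesis by simp
qed

lemma AE_not_in_finite: "finite A \<Longrightarrow> AE x in \<nu>. x \<notin> A"
proof -
  assume A: "finite A"
  have "AE x in \<nu>. x \<noteq> a" for a
  proof -
    have "AE x in \<nu>. x \<notin> {a}" using measure_singleton[of a] sets_nu by (subst (asm) prob_eq_0) auto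
    then show ?thesis by simp
  qed
  then have "AE x in \<nu>. \<forall>a\<in>A. x \<noteq> a" using A by (intro AE_finite_allI) auto
  then show ?thesis by eventually_elim auto
qed

lemma borel_measurable_dist_set:
  assumes "A \<in> codebooks n"
  shows "(\<lambda>x. dist_set N x A) \<in> borel_measurable \<nu>"
proof -
  have "(\<lambda>x. Min ((\<lambda>y. N (x - y)) ` A)) \<in> borel_measurable borel"
  proof (rule borel_measurable_Min)
    show "finite A" using codebooksD[OF assms] by simp
    fix a
    have "continuous_on UNIV (\<lambda>x. N (x - a))"
      by (rule continuous_on_compose2[OF is_norm_continuous[OF norm_N]]) (auto intro: continuous_intros)
    then show "(\<lambda>x. N (x - a)) \<in> borel_measurable borel" by (rule borel_measurable_continuous_onI)
  qed
  then show ?thesis unfolding dist_set_def using sets_nu measurable_cong_sets by blast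
qed

lemma nn_integral_cube_sum:
  assumes "finite T" "\<And>i. i \<in> T \<Longrightarrow> S i \<in> sets \<nu>" "\<And>i. i \<in> T \<Longrightarrow> 0 \<le> c i"
  shows "(\<integral>\<^sup>+ x. (\<Sum>i\<in>T. ennreal (c i) * indicator (S i) x) \<partial>\<nu>) = ennreal (\<Sum>i\<in>T. c i * measure \<nu> (S i))"
proof -
  have "(\<integral>\<^sup>+ x. (\<Sum>i\<in>T. ennreal (c i) * indicator (S i) x) \<partial>\<nu>) = (\<Sum>i\<in>T. \<integral>\<^sup>+ x. ennreal (c i) * indicator (S i) x \<partial>\<nu>)"
    using assms by (intro nn_integral_sum) auto
  also have "\<dots> = (\<Sum>i\<in>T. ennreal (c i * measure \<nu> (S i)))"
    using assms by (intro sum.cong) (auto simp: nn_integral_cmult_indicator emeasure_eq_measure ennreal_mult)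
  also have "\<dots> = ennreal (\<Sum>i\<in>T. c i * measure \<nu> (S i))"
    using assms by (intro sum_ennreal) auto
  finally show ?thesis .
qed

lemma nn_integral_ge_cube_sum:
  assumes T: "finite T" "\<And>i. i \<in> T \<Longrightarrow> S i \<in> sets \<nu>" "\<And>i. i \<in> T \<Longrightarrow> 0 \<le> c i"
    and dj: "disjoint_family_on S T"
    and le: "\<And>i x. i \<in> T \<Longrightarrow> x \<in> S i \<Longrightarrow> ennreal (c i) \<le> f x"
  shows "ennreal (\<Sum>i\<in>T. c i * measure \<nu> (S i)) \<le> (\<integral>\<^sup>+ x. f x \<partial>\<nu>)"
proof -
  have "(\<Sum>i\<in>T. ennreal (c i) * indicator (S i) x) \<le> f x" for x
  proof (cases "\<exists>i\<in>T. x \<in> S i")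
    case True
    then obtain i where i: "i \<in> T" "x \<in> S i" by blast
    have "x \<notin> S j" if "j \<in> T" "j \<noteq> i" for j
      using dj i that unfolding disjoint_family_on_def by blast
    then have "(\<Sum>j\<in>T. ennreal (c j) * indicator (S j) x) = (\<Sum>j\<in>{i}. ennreal (c j) * indicator (S j) x)"
      using T(1) i by (intro sum.mono_neutral_right) auto
    then show ?thesis using le[OF i] i by simp
  next
    case False
    then have "(\<Sum>j\<in>T. ennreal (c j) * indicator (S j) x) = 0" by (intro sum.neutral) auto
    then show ?thesis by simp
  qed
  then have "(\<integral>\<^sup>+ x. (\<Sum>i\<in>T. ennreal (c i) * indicator (S i) x) \<partial>\<nu>) \<le> (\<integral>\<^sup>+ x. f x \<partial>\<nu>)"
    by (rule nn_integral_mono)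
  then show ?thesis using nn_integral_cube_sum[of T S c] T by simp
qed

lemma partition_memE:
  assumes "P \<in> cube_partitions" "x \<in> (half_open_unit_cube :: (real ^ 'd) set)"
  obtains Q n where "Q \<in> P" "x \<in> Q" "Q \<in> dyadic_cubes n"
proof -
  from assms have "x \<in> \<Union> P" unfolding cube_partitions_def partition_on_def by simp
  then obtain Q where Q: "Q \<in> P" "x \<in> Q" by blast
  with assms(1) obtain n where "Q \<in> dyadic_cubes n" unfolding cube_partitions_def all_dyadic_cubes_def by auto
  with Q that show ?thesis by blast
qed

lemma partition_level:
  assumes "P \<in> cube_partitions" "Q \<in> P"
  obtains n where "(Q :: (real ^ 'd) set) \<in> dyadic_cubes n"
  using assms unfolding cube_partitions_def all_dyadic_cubes_def by auto

lemma sets_nu_partition: "P \<in> cube_partitions \<Longrightarrow> Q \<in> P \<Longrightarrow> Q \<in> sets \<nu>"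
  using partition_level sets_nu_cubes by metis

text \<open>A partition cube of level l stays within C0 / 2 ^ l of its chosen point, so its share of
  the integral is at most C0 powr r times its weight, hence at most C0 powr r / x.\<close>

lemma partition_integral_upper:
  assumes r: "0 < r"
  obtains K where "0 < K" "\<And>P x n. P \<in> cube_partitions \<Longrightarrow> 0 < x \<Longrightarrow> (\<And>Q. Q \<in> P \<Longrightarrow> part_fun \<nu> r Q < 1 / x) \<Longrightarrow>
    card P \<le> n \<Longrightarrow> \<exists>A\<in>codebooks n. quant_integral N \<nu> r A \<le> ennreal (K * real n / x)"
proof -
  have rd: "admissible r" using r by (intro neg_dim_infty_less) simp
  obtain C0 where C0: "0 < C0" "\<And>n Q x y. Q \<in> dyadic_cubes n \<Longrightarrow> x \<in> Q \<Longrightarrow> y \<in> Q \<Longrightarrow> N (x - y) \<le> C0 / 2 ^ n"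
    using N_diam by metis
  have bound: "\<exists>A\<in>codebooks n. quant_integral N \<nu> r A \<le> ennreal (C0 powr r * real n / x)"
    if P: "P \<in> cube_partitions" and x: "0 < x" and J: "\<And>Q. Q \<in> P \<Longrightarrow> part_fun \<nu> r Q < 1 / x"
      and n: "card P \<le> n" for P x n
  proof -
    note ne = cube_partition_nonempty[OF P]
    define pick where "pick Q = (SOME y. y \<in> Q)" for Q :: "(real ^ 'd) set"
    have pick: "pick Q \<in> Q" if "Q \<in> P" for Q
    proof -
      have "Q \<noteq> {}" using P that unfolding cube_partitions_def partition_on_def by auto
      then show ?thesis unfolding pick_def by (simp add: some_in_eq)
    qed
    define A where "A = pick ` P"
    have A: "A \<in> codebooks n" "finite A"
      unfolding codebooks_def A_def using ne n card_image_le[of P pick]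
      by (auto simp: Suc_le_eq card_gt_0_iff)
    define c where "c Q = C0 powr r * measure lborel Q powr (r / real CARD('d))" for Q :: "(real ^ 'd) set"
    have "AE y in \<nu>. epow (ennreal (dist_set N y A)) r \<le> (\<Sum>Q\<in>P. ennreal (c Q) * indicator Q y)"
      using AE_unit_cube
    proof eventually_elim
      case (elim y)
      from partition_memE[OF P elim] obtain Q l where Q: "Q \<in> P" "y \<in> Q" "Q \<in> dyadic_cubes l" by metis
      have "dist_set N y A \<le> N (y - pick Q)" unfolding A_def using ne Q(1) by (intro dist_set_le) auto
      also have "\<dots> \<le> C0 / 2 ^ l" using C0(2)[OF Q(3,2) pick[OF Q(1)]] .
      finally have "epow (ennreal (dist_set N y A)) r \<le> epow (ennreal (C0 / 2 ^ l)) r"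
        by (intro epow_mono r ennreal_leI)
      also have "\<dots> = ennreal ((C0 / 2 ^ l) powr r)" using r C0(1) by (intro epow_ennreal) auto
      also have "(C0 / 2 ^ l) powr r = c Q"
        unfolding c_def measure_lborel_powr[OF Q(3)] using C0(1)
        by (rule divide_two_power_powr)
      also have "ennreal (c Q) = ennreal (c Q) * indicator Q y" using Q by simp
      also have "\<dots> \<le> (\<Sum>Q\<in>P. ennreal (c Q) * indicator Q y)" using ne Q by (intro member_le_sum) auto
      finally show ?case .
    qed
    then have "quant_integral N \<nu> r A \<le> (\<integral>\<^sup>+ y. (\<Sum>Q\<in>P. ennreal (c Q) * indicator Q y) \<partial>\<nu>)"
      unfolding quant_integral_def by (rule nn_integral_mono_AE)
    also have "\<dots> = ennreal (\<Sum>Q\<in>P. c Q * measure \<nu> Q)"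
      using ne sets_nu_partition[OF P] by (intro nn_integral_cube_sum) (auto simp: c_def)
    also have "\<dots> \<le> ennreal (C0 powr r * real n / x)"
    proof (rule ennreal_leI)
      have "(\<Sum>Q\<in>P. c Q * measure \<nu> Q) \<le> (\<Sum>Q\<in>P. C0 powr r * (1 / x))"
      proof (rule sum_mono)
        fix Q assume Q: "Q \<in> P"
        from partition_level[OF P Q] obtain l where l: "Q \<in> dyadic_cubes l" .
        have "c Q * measure \<nu> Q = C0 powr r * weight \<nu> r Q" unfolding c_def weight_def by simp
        also have "\<dots> \<le> C0 powr r * part_fun \<nu> r Q"
          using weight_le_part_fun[OF rd l order_refl] by (intro mult_left_mono) auto
        also have "\<dots> \<le> C0 powr r * (1 / x)" using J[OF Q] by (intro mult_left_mono) auto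
        finally show "c Q * measure \<nu> Q \<le> C0 powr r * (1 / x)" .
      qed
      also have "\<dots> = real (card P) * (C0 powr r * (1 / x))" by simp
      also have "\<dots> \<le> real n * (C0 powr r * (1 / x))" using n x by (intro mult_right_mono) auto
      finally show "(\<Sum>Q\<in>P. c Q * measure \<nu> Q) \<le> C0 powr r * real n / x" by (simp add: mult_ac)
    qed
    finally show ?thesis by (rule bexI[OF _ A(1)])
  qed
  have "0 < C0 powr r" using C0(1) by simp
  from this bound show ?thesis by (rule that)
qed

text \<open>A point that is closer to the codebook than the size of its partition cube is charged to the
  dyadic shell around the nearest codebook point; the gap between the exponents makes the
  contributions of the shells summable.\<close>

lemma partition_integral_upper_neg:
  assumes r: "r < 0" and r': "r' < r" "admissible r'"
  obtains K where "0 < K" "\<And>P x n A. P \<in> cube_partitions \<Longrightarrow> 0 < x \<Longrightarrow> (\<And>Q. Q \<in> P \<Longrightarrow> part_fun \<nu> r' Q < 1 / x) \<Longrightarrow>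
    card P \<le> n \<Longrightarrow> A \<in> codebooks n \<Longrightarrow> quant_integral N \<nu> r A \<le> ennreal (K * real n / x)"
proof -
  obtain c0 where c0: "0 < c0" "\<And>x i. c0 * \<bar>x $ i\<bar> \<le> N x" using N_component by metis
  define y where "y = 2 powr (- (r - r'))"
  have y: "0 < y" "y < 1" unfolding y_def using r' by (auto intro: powr_less_one)
  \<comment> \<open>The first summand stems from points at distance at least c0 / 2 ^ l in a
    partition cube of level l. The second stems from the shells, with at most 4 ^ d cubes per
    codebook point and level, summed with ratio y.\<close>
  define K where "K = c0 powr r + (c0 / 2) powr r * 4 ^ CARD('d) / (1 - y)"
  have K: "0 < K" unfolding K_def using c0 y by (intro add_pos_nonneg) auto
  have bound: "quant_integral N \<nu> r A \<le> ennreal (K * real n / x)"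
    if P: "P \<in> cube_partitions" and x: "0 < x" and J: "\<And>Q. Q \<in> P \<Longrightarrow> part_fun \<nu> r' Q < 1 / x"
      and n: "card P \<le> n" and A: "A \<in> codebooks n" for P x n A
  proof -
    note ne = cube_partition_nonempty[OF P]
    note finA = codebooksD[OF A]
    define c where "c Q = c0 powr r * measure lborel Q powr (r / real CARD('d))" for Q :: "(real ^ 'd) set"
    define e where "e k = (c0 / 2) powr r * 2 powr (- (real k * r))" for k
    \<comment> \<open>Cubes that can carry shell k around a; restricting to those inside a partition
      cube gives access to the bound J < 1 / x of order r'.\<close>
    define G where "G a k = {Q' \<in> near_cubes k a. \<exists>Q\<in>P. Q' \<subseteq> Q}" for a k
    have finG: "finite (G a k)" for a k unfolding G_def by (rule finite_subset[OF _ card_near_cubes(1)[of k a]]) blast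
    have cardG: "card (G a k) \<le> 4 ^ CARD('d)" for a k
      unfolding G_def by (rule order_trans[OF card_mono[OF card_near_cubes(1)] card_near_cubes(2)]) blast
    have GD: "Q' \<in> dyadic_cubes k" if "Q' \<in> G a k" for a k Q' using that unfolding G_def near_cubes_def by simp
    define T1 where "T1 z = (\<Sum>Q\<in>P. ennreal (c Q) * indicator Q z)" for z
    define T where "T a k z = (\<Sum>Q'\<in>G a k. ennreal (e k) * indicator Q' z)" for a k z
    \<comment> \<open>Since 2 powr (- k r) = y ^ k * 2 powr (- k r'), changing the order from r' to
      r on level k gains y ^ k.\<close>
    have weight_shift: "measure \<nu> Q * 2 powr (- (real k * r)) \<le> y ^ k / x"
      if Q: "Q \<in> dyadic_cubes k" "Q \<subseteq> Q0" "Q0 \<in> P" for Q k Q0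
    proof -
      have "measure \<nu> Q * 2 powr (- (real k * r)) = y ^ k * weight \<nu> r' Q"
        unfolding weight_eq[OF Q(1)] y_def by (simp add: powr_power powr_add[symmetric] algebra_simps)
      also have "\<dots> \<le> y ^ k * part_fun \<nu> r' Q0"
        using y weight_le_part_fun[OF r'(2) Q(1,2)] by (intro mult_left_mono) auto
      also have "\<dots> \<le> y ^ k * (1 / x)" using y J[OF Q(3)] by (intro mult_left_mono) auto
      finally show ?thesis by simp
    qed
    have "AE z in \<nu>. epow (ennreal (dist_set N z A)) r \<le> T1 z + (\<Sum>a\<in>A. \<Sum>k. T a k z)"
      using AE_unit_cube AE_not_in_finite[OF conjunct1[OF finA]]
    proof eventually_elim
      case (elim z)
      define \<delta> where "\<delta> = dist_set N z A"
      have \<delta>: "0 < \<delta>" unfolding \<delta>_def by (rule dist_set_pos[OF A elim(2)])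
      then have ep: "epow (ennreal \<delta>) r = ennreal (\<delta> powr r)" using r by (intro epow_ennreal) auto
      from partition_memE[OF P elim(1)] obtain Q l where Q: "Q \<in> P" "z \<in> Q" "Q \<in> dyadic_cubes l" by metis
      show ?case
      proof (cases "c0 / 2 ^ l \<le> \<delta>")
        case True
        then have "\<delta> powr r \<le> (c0 / 2 ^ l) powr r" using r c0 by (intro powr_mono2') auto
        also have "\<dots> = c Q"
          unfolding c_def measure_lborel_powr[OF Q(3)] using c0(1)
          by (rule divide_two_power_powr)
        finally have "epow (ennreal \<delta>) r \<le> ennreal (c Q) * indicator Q z"
          unfolding ep using Q by (simp add: ennreal_leI)
        also have "\<dots> \<le> T1 z" unfolding T1_def using ne Q by (intro member_le_sum) auto
        finally show ?thesis unfolding \<delta>_def by (rule order_trans) simp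
      next
        case False
        then have "\<delta> < c0 / 2 ^ l" by simp
        from dyadic_scale[OF \<delta> c0(1) this]
        obtain k where k: "l \<le> k" "c0 / 2 ^ Suc k \<le> \<delta>" "\<delta> < c0 / 2 ^ k" .
        from dist_set_attained[of A N z] finA obtain a where a: "a \<in> A" "\<delta> = N (z - a)"
          unfolding \<delta>_def by metis
        have "\<bar>z $ i - a $ i\<bar> < 1 / 2 ^ k" for i
        proof -
          have "c0 * \<bar>z $ i - a $ i\<bar> < c0 / 2 ^ k" using c0(2)[of "z - a" i] k(3) a(2) by simp
          then show ?thesis using c0(1) by (simp add: field_simps)
        qed
        then have "cube_at k z \<in> near_cubes k a"
          unfolding near_cubes_def using cube_at_in_dyadic_cubes[OF elim(1)] mem_cube_at by blast
        moreover have "cube_at k z \<subseteq> Q" using dyadic_cube_eq_cube_at[OF Q(3,2)] cube_at_antimono[OF k(1), of z] by simp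
        ultimately have G: "cube_at k z \<in> G a k" unfolding G_def using Q(1) by blast
        \<comment> \<open>A negative power is largest at the inner radius c0 / 2 ^ (k + 1) of the
          shell; this turns c0 into c0 / 2 in \<open>e\<close>.\<close>
        have "\<delta> powr r \<le> (c0 / 2 ^ Suc k) powr r" using r c0 k by (intro powr_mono2') auto
        also have "c0 / 2 ^ Suc k = (c0 / 2) / 2 ^ k" by simp
        also have "((c0 / 2) / 2 ^ k) powr r = e k"
          unfolding e_def using c0 by (intro divide_two_power_powr) simp
        finally have "epow (ennreal \<delta>) r \<le> ennreal (e k) * indicator (cube_at k z) z"
          unfolding ep using mem_cube_at[of z k] by (simp add: ennreal_leI)
        also have "\<dots> \<le> T a k z" unfolding T_def using finG G by (intro member_le_sum) auto
        also have "\<dots> \<le> (\<Sum>k. T a k z)" using sum_le_suminf[of "\<lambda>k. T a k z" "{k}"] by simp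
        also have "\<dots> \<le> (\<Sum>a\<in>A. \<Sum>k. T a k z)" using finA a by (intro member_le_sum) auto
        finally show ?thesis unfolding \<delta>_def by (rule order_trans) simp
      qed
    qed
    then have "quant_integral N \<nu> r A \<le> (\<integral>\<^sup>+ z. T1 z + (\<Sum>a\<in>A. \<Sum>k. T a k z) \<partial>\<nu>)"
      unfolding quant_integral_def by (rule nn_integral_mono_AE)
    have mT1: "T1 \<in> borel_measurable \<nu>" unfolding T1_def
      using sets_nu_partition[OF P] by (intro borel_measurable_sum borel_measurable_times) auto
    have mT: "(\<lambda>z. T a k z) \<in> borel_measurable \<nu>" for a k unfolding T_def
      using GD sets_nu_cubes by (intro borel_measurable_sum borel_measurable_times) auto
    have I1: "(\<integral>\<^sup>+ z. T1 z \<partial>\<nu>) \<le> ennreal (c0 powr r * real n / x)"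
    proof -
      have "(\<integral>\<^sup>+ z. T1 z \<partial>\<nu>) = ennreal (\<Sum>Q\<in>P. c Q * measure \<nu> Q)"
        unfolding T1_def
        using ne sets_nu_partition[OF P] by (intro nn_integral_cube_sum) (auto simp: c_def)
      also have "\<dots> \<le> ennreal (c0 powr r * real n / x)"
      proof (rule ennreal_leI)
        have "(\<Sum>Q\<in>P. c Q * measure \<nu> Q) \<le> (\<Sum>Q\<in>P. c0 powr r * (1 / x))"
        proof (rule sum_mono)
          fix Q assume Q: "Q \<in> P"
          from partition_level[OF P Q] obtain l where l: "Q \<in> dyadic_cubes l" .
          have "y ^ l / x \<le> 1 / x" using y x by (intro divide_right_mono power_le_one) auto
          then have "measure \<nu> Q * 2 powr (- (real l * r)) \<le> 1 / x"
            using weight_shift[OF l order_refl Q] by linarith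
          then have "c0 powr r * (measure \<nu> Q * 2 powr (- (real l * r))) \<le> c0 powr r * (1 / x)"
            by (intro mult_left_mono) auto
          then show "c Q * measure \<nu> Q \<le> c0 powr r * (1 / x)"
            unfolding c_def measure_lborel_powr[OF l] by (simp add: mult_ac)
        qed
        also have "\<dots> = real (card P) * (c0 powr r * (1 / x))" by simp
        also have "\<dots> \<le> real n * (c0 powr r * (1 / x))" using n x by (intro mult_right_mono) auto
        finally show "(\<Sum>Q\<in>P. c Q * measure \<nu> Q) \<le> c0 powr r * real n / x" by (simp add: mult_ac)
      qed
      finally show ?thesis .
    qed
    have I2: "(\<integral>\<^sup>+ z. T a k z \<partial>\<nu>) \<le> ennreal ((c0 / 2) powr r * 4 ^ CARD('d) / x * y ^ k)" for a k
    proof -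
      have "(\<integral>\<^sup>+ z. T a k z \<partial>\<nu>) = ennreal (\<Sum>Q\<in>G a k. e k * measure \<nu> Q)"
        unfolding T_def using finG GD sets_nu_cubes by (intro nn_integral_cube_sum) (auto simp: e_def)
      also have "\<dots> \<le> ennreal ((c0 / 2) powr r * 4 ^ CARD('d) / x * y ^ k)"
      proof (rule ennreal_leI)
        have "(\<Sum>Q\<in>G a k. e k * measure \<nu> Q) \<le> (\<Sum>Q\<in>G a k. (c0 / 2) powr r * (y ^ k / x))"
        proof (rule sum_mono)
          fix Q assume Q: "Q \<in> G a k"
          then obtain Q0 where Q0: "Q0 \<in> P" "Q \<subseteq> Q0" unfolding G_def by blast
          have "(c0 / 2) powr r * (measure \<nu> Q * 2 powr (- (real k * r))) \<le> (c0 / 2) powr r * (y ^ k / x)"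
            by (intro mult_left_mono weight_shift[OF GD[OF Q] Q0(2,1)]) simp
          then show "e k * measure \<nu> Q \<le> (c0 / 2) powr r * (y ^ k / x)" unfolding e_def by (simp add: mult_ac)
        qed
        also have "\<dots> = real (card (G a k)) * ((c0 / 2) powr r * (y ^ k / x))" by simp
        also have "\<dots> \<le> 4 ^ CARD('d) * ((c0 / 2) powr r * (y ^ k / x))"
          using of_nat_mono[OF cardG[of a k], where 'a=real] x y by (intro mult_right_mono) auto
        finally show "(\<Sum>Q\<in>G a k. e k * measure \<nu> Q) \<le> (c0 / 2) powr r * 4 ^ CARD('d) / x * y ^ k"
          by (simp add: mult_ac)
      qed
      finally show ?thesis .
    qed
    define w where "w = (c0 / 2) powr r * 4 ^ CARD('d) / x"
    have w: "0 \<le> w" unfolding w_def using x by simp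
    have I3: "(\<integral>\<^sup>+ z. (\<Sum>k. T a k z) \<partial>\<nu>) \<le> ennreal (w / (1 - y))" for a
    proof -
      have "(\<integral>\<^sup>+ z. (\<Sum>k. T a k z) \<partial>\<nu>) = (\<Sum>k. \<integral>\<^sup>+ z. T a k z \<partial>\<nu>)" by (rule nn_integral_suminf[OF mT])
      also have "\<dots> \<le> (\<Sum>k. ennreal (w * y ^ k))"
        using I2 unfolding w_def by (intro suminf_le) auto
      also have "\<dots> = ennreal (\<Sum>k. w * y ^ k)"
        using w y by (intro suminf_ennreal2) (auto intro!: summable_mult summable_geometric)
      also have "(\<Sum>k. w * y ^ k) = w / (1 - y)"
        using y by (simp add: suminf_mult summable_geometric suminf_geometric)
      finally show ?thesis .
    qed
    note \<open>quant_integral N \<nu> r A \<le> (\<integral>\<^sup>+ z. T1 z + (\<Sum>a\<in>A. \<Sum>k. T a k z) \<partial>\<nu>)\<close>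
    also have "(\<integral>\<^sup>+ z. T1 z + (\<Sum>a\<in>A. \<Sum>k. T a k z) \<partial>\<nu>) = (\<integral>\<^sup>+ z. T1 z \<partial>\<nu>) + (\<Sum>a\<in>A. \<integral>\<^sup>+ z. (\<Sum>k. T a k z) \<partial>\<nu>)"
      using mT1 mT by (subst nn_integral_add) (auto simp: nn_integral_sum)
    also have "\<dots> \<le> ennreal (c0 powr r * real n / x) + (\<Sum>a\<in>A. ennreal (w / (1 - y)))"
      by (intro add_mono I1 sum_mono I3)
    also have "(\<Sum>a\<in>A. ennreal (w / (1 - y))) = ennreal (real (card A) * (w / (1 - y)))"
      using w y by (simp only: sum_constant ennreal_of_nat_eq_real_of_nat, subst ennreal_mult[symmetric]) auto
    also have "\<dots> \<le> ennreal (real n * (w / (1 - y)))"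
      using A w y unfolding codebooks_def by (intro ennreal_leI mult_right_mono) auto
    also have "ennreal (c0 powr r * real n / x) + ennreal (real n * (w / (1 - y))) = ennreal (K * real n / x)"
    proof -
      define u where "u = 1 - y"
      have u: "0 < u" unfolding u_def using y by simp
      have "K * real n / x = c0 powr r * real n / x + real n * (w / (1 - y))"
        unfolding K_def w_def u_def[symmetric] using x u by (simp add: field_simps)
      moreover have "0 \<le> c0 powr r * real n / x" "0 \<le> real n * (w / (1 - y))" using x w y by auto
      ultimately show ?thesis by simp
    qed
    finally show ?thesis by (simp add: add_left_mono)
  qed
  from K bound show ?thesis by (rule that)
qed

end

context quantization
begin

text \<open>For r \<ge> 0 both the measure and the volume factor decrease on subcubes. For r < 0 the
  volume factor grows, and a deeper cube may win.\<close>

lemma part_fun_eq_weight: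
  assumes "0 \<le> r" "Q \<in> dyadic_cubes n"
  shows "part_fun \<nu> r Q = weight \<nu> r Q"
proof (rule antisym)
  show "part_fun \<nu> r Q \<le> weight \<nu> r Q"
  proof (rule part_fun_leI[OF assms(2)])
    fix m and Q' :: "(real ^ 'd) set" assume Q': "Q' \<in> dyadic_cubes m" "Q' \<subseteq> Q" "n \<le> m"
    have "measure \<nu> Q' \<le> measure \<nu> Q"
      using Q' sets_nu_cubes[OF assms(2)] by (intro finite_measure_mono) auto
    moreover have "2 powr (- (real m * r)) \<le> (2::real) powr (- (real n * r))"
      using Q' assms(1) by (intro powr_mono) (auto intro: mult_right_mono)
    ultimately show "weight \<nu> r Q' \<le> weight \<nu> r Q"
      unfolding weight_eq[OF Q'(1)] weight_eq[OF assms(2)] by (intro mult_mono) auto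
  qed
  show "weight \<nu> r Q \<le> part_fun \<nu> r Q"
    by (rule weight_le_part_fun[OF neg_dim_infty_less[OF assms(1)] assms(2) order_refl])
qed

text \<open>A codebook of at most half the relevant size misses the neighbourhoods of many heavy cubes.\<close>

lemma coarse_integral_lower:
  assumes r: "0 < r"
  obtains c where "0 < c" "\<And>\<alpha> n m A. 2 * 4 ^ CARD('d) * m \<le> coarse_count \<nu> \<alpha> r n \<Longrightarrow> A \<in> codebooks m \<Longrightarrow>
    ennreal (c * real m * 2 powr (- \<alpha> * real n)) \<le> quant_integral N \<nu> r A"
proof -
  obtain c0 where c0: "0 < c0" "\<And>x i. c0 * \<bar>x $ i\<bar> \<le> N x" using N_component by metis
  have bound: "ennreal (c0 powr r * real m * 2 powr (- \<alpha> * real n)) \<le> quant_integral N \<nu> r A"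
    if m: "2 * 4 ^ CARD('d) * m \<le> coarse_count \<nu> \<alpha> r n" and A: "A \<in> codebooks m" for \<alpha> n m A
  proof -
    note finA = codebooksD[OF A]
    define S where "S = {Q \<in> dyadic_cubes n. part_fun \<nu> r Q \<ge> 2 powr (- \<alpha> * real n)}"
    \<comment> \<open>At most 4 ^ d * m cubes are near the codebook, so at least half of the
      required 2 * 4 ^ d * m heavy cubes, and in particular m of them, remain in T.\<close>
    define B where "B = (\<Union>a\<in>A. near_cubes n a)"
    define T where "T = S - B"
    have finS: "finite S" unfolding S_def by simp
    have finB: "finite B" unfolding B_def by (intro finite_UN_I card_near_cubes(1)) (use finA in auto)
    have "card B \<le> (\<Sum>a\<in>A. card (near_cubes n a))" unfolding B_def using finA by (intro card_UN_le) simp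
    also have "\<dots> \<le> (\<Sum>a\<in>A. 4 ^ CARD('d))" by (intro sum_mono card_near_cubes(2))
    also have "\<dots> \<le> 4 ^ CARD('d) * m" using A unfolding codebooks_def by (simp add: mult.commute)
    finally have "card B \<le> 4 ^ CARD('d) * m" .
    moreover have "2 * 4 ^ CARD('d) * m \<le> card S" using m unfolding coarse_count_def S_def .
    moreover have "card S - card B \<le> card T" unfolding T_def by (rule diff_card_le_card_Diff[OF finB])
    ultimately have "4 ^ CARD('d) * m \<le> card T" by linarith
    moreover have "1 * m \<le> 4 ^ CARD('d) * m" by (intro mult_right_mono) auto
    ultimately have mT: "m \<le> card T" by linarith
    have TD: "Q \<in> dyadic_cubes n" if "Q \<in> T" for Q using that unfolding T_def S_def by simp
    define k where "k = (c0 / 2 ^ n) powr r"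
    have k: "k = c0 powr r * 2 powr (- (real n * r))" unfolding k_def by (rule divide_two_power_powr[OF c0(1)])
    have "ennreal (\<Sum>Q\<in>T. k * measure \<nu> Q) \<le> quant_integral N \<nu> r A"
      unfolding quant_integral_def
    proof (rule nn_integral_ge_cube_sum)
      show "finite T" unfolding T_def using finS by simp
      show "disjoint_family_on (\<lambda>Q. Q) T"
        using disjoint_dyadic_cubes[of n] TD unfolding disjoint_family_on_def disjoint_def by blast
      show "0 \<le> k" for Q :: "(real ^ 'd) set" unfolding k_def by simp
      show "Q \<in> sets \<nu>" if "Q \<in> T" for Q using TD[OF that] by (rule sets_nu_cubes)
      fix Q x assume Q: "Q \<in> T" "x \<in> Q"
      from dist_set_attained[of A N x] finA obtain a where a: "a \<in> A" "dist_set N x A = N (x - a)" by metis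
      have "Q \<notin> near_cubes n a" using Q(1) a(1) unfolding T_def B_def by blast
      then obtain i where i: "1 / 2 ^ n \<le> \<bar>x $ i - a $ i\<bar>"
        unfolding near_cubes_def using TD[OF Q(1)] Q(2) by (auto simp: not_less)
      have "c0 / 2 ^ n \<le> c0 * \<bar>x $ i - a $ i\<bar>" using mult_left_mono[OF i, of c0] c0(1) by simp
      also have "\<dots> \<le> dist_set N x A" using c0(2)[of "x - a" i] a(2) by simp
      finally have "epow (ennreal (c0 / 2 ^ n)) r \<le> epow (ennreal (dist_set N x A)) r"
        by (intro epow_mono r ennreal_leI)
      then show "ennreal k \<le> epow (ennreal (dist_set N x A)) r"
        unfolding k_def using r c0(1) by (simp add: epow_ennreal)
    qed
    moreover have "c0 powr r * real m * 2 powr (- \<alpha> * real n) \<le> (\<Sum>Q\<in>T. k * measure \<nu> Q)"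
    proof -
      have "c0 powr r * real m * 2 powr (- \<alpha> * real n) \<le> real (card T) * (c0 powr r * 2 powr (- \<alpha> * real n))"
        using mT by (simp add: mult_ac mult_right_mono)
      also have "\<dots> = (\<Sum>Q\<in>T. c0 powr r * 2 powr (- \<alpha> * real n))" by simp
      also have "\<dots> \<le> (\<Sum>Q\<in>T. k * measure \<nu> Q)"
      proof (rule sum_mono)
        fix Q assume Q: "Q \<in> T"
        then have "2 powr (- \<alpha> * real n) \<le> weight \<nu> r Q"
          using part_fun_eq_weight[of r Q n] r unfolding T_def S_def by simp
        then have "c0 powr r * 2 powr (- \<alpha> * real n) \<le> c0 powr r * weight \<nu> r Q" by (intro mult_left_mono) auto
        then show "c0 powr r * 2 powr (- \<alpha> * real n) \<le> k * measure \<nu> Q"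
          unfolding k weight_eq[OF TD[OF Q]] by (simp add: mult_ac)
      qed
      finally show ?thesis .
    qed
    ultimately show ?thesis by (meson ennreal_leI order_trans)
  qed
  have "0 < c0 powr r" using c0(1) by simp
  from this bound show ?thesis by (rule that)
qed

text \<open>One codebook is enough, since the error is an infimum and r < 0 reverses the order. Its
  points sit in subcubes that realise J up to the factor 2: on a subcube of level k the distance is
  at most C0 / 2 ^ k, so its negative power times the mass is at least C0 powr r times the
  weight.\<close>

lemma coarse_integral_lower_neg:
  assumes r: "r < 0" "admissible r"
  obtains c where "0 < c" "\<And>\<alpha> n m. 1 \<le> m \<Longrightarrow> m \<le> coarse_count \<nu> \<alpha> r n \<Longrightarrow>
    \<exists>A\<in>codebooks m. ennreal (c * real m * 2 powr (- \<alpha> * real n)) \<le> quant_integral N \<nu> r A"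
proof -
  obtain C0 where C0: "0 < C0" "\<And>n Q x y. Q \<in> dyadic_cubes n \<Longrightarrow> x \<in> Q \<Longrightarrow> y \<in> Q \<Longrightarrow> N (x - y) \<le> C0 / 2 ^ n"
    using N_diam by metis
  have bound: "\<exists>A\<in>codebooks m. ennreal (C0 powr r / 2 * real m * 2 powr (- \<alpha> * real n)) \<le> quant_integral N \<nu> r A"
    if m: "1 \<le> m" "m \<le> coarse_count \<nu> \<alpha> r n" for \<alpha> n m
  proof -
    define S where "S = {Q \<in> dyadic_cubes n. part_fun \<nu> r Q \<ge> 2 powr (- \<alpha> * real n)}"
    have "m \<le> card S" using m(2) unfolding coarse_count_def S_def .
    then obtain T where T: "T \<subseteq> S" "card T = m" "finite T" by (rule obtain_subset_with_card_n)
    have TD: "Q \<in> dyadic_cubes n" if "Q \<in> T" for Q using that T unfolding S_def by auto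
    have "\<exists>k Q' p. Q' \<in> dyadic_cubes k \<and> Q' \<subseteq> Q \<and> p \<in> Q' \<and> 2 powr (- \<alpha> * real n) / 2 \<le> weight \<nu> r Q'"
      if Q: "Q \<in> T" for Q
    proof -
      \<comment> \<open>Halving the threshold supplies the strict inequality that
        \<open>part_fun_approx\<close> asks for.\<close>
      have J: "2 powr (- \<alpha> * real n) \<le> part_fun \<nu> r Q" using Q T unfolding S_def by auto
      moreover have "0 < 2 powr (- \<alpha> * real n)" by simp
      ultimately have "2 powr (- \<alpha> * real n) / 2 < part_fun \<nu> r Q" by linarith
      from part_fun_approx[OF r(2) TD[OF Q] this] obtain k Q' where Q': "Q' \<in> dyadic_cubes k" "Q' \<subseteq> Q"
        "2 powr (- \<alpha> * real n) / 2 < weight \<nu> r Q'" by metis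
      moreover obtain p where "p \<in> Q'" using dyadic_cubes_nonempty[OF Q'(1)] by metis
      ultimately show ?thesis by (metis less_imp_le)
    qed
    then obtain k Q' p where W: "\<And>Q. Q \<in> T \<Longrightarrow> Q' Q \<in> dyadic_cubes (k Q) \<and> Q' Q \<subseteq> Q \<and> p Q \<in> Q' Q
      \<and> 2 powr (- \<alpha> * real n) / 2 \<le> weight \<nu> r (Q' Q)" by metis
    define A where "A = p ` T"
    have "T \<noteq> {}" using T m by auto
    then have A: "A \<in> codebooks m" "finite A"
      unfolding codebooks_def A_def using T card_image_le[of T p]
      by (auto simp: Suc_le_eq card_gt_0_iff)
    define c where "c Q = (C0 / 2 ^ k Q) powr r" for Q
    have c: "c Q = C0 powr r * 2 powr (- (real (k Q) * r))" for Q
      unfolding c_def by (rule divide_two_power_powr[OF C0(1)])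
    have "ennreal (\<Sum>Q\<in>T. c Q * measure \<nu> (Q' Q)) \<le> quant_integral N \<nu> r A"
      unfolding quant_integral_def
    proof (rule nn_integral_ge_cube_sum)
      show "finite T" by (rule T(3))
      show "disjoint_family_on Q' T"
        unfolding disjoint_family_on_def
      proof (intro ballI impI)
        fix Q1 Q2 assume Q: "Q1 \<in> T" "Q2 \<in> T" "Q1 \<noteq> Q2"
        then have "Q1 \<inter> Q2 = {}" using TD by (intro disjointD[OF disjoint_dyadic_cubes[of n]])
        then show "Q' Q1 \<inter> Q' Q2 = {}" using W[OF Q(1)] W[OF Q(2)] by blast
      qed
      show "0 \<le> c Q" for Q unfolding c_def by simp
      show "Q' Q \<in> sets \<nu>" if "Q \<in> T" for Q using W[OF that] sets_nu_cubes by blast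
      fix Q x assume Q: "Q \<in> T" "x \<in> Q' Q"
      have "dist_set N x A \<le> N (x - p Q)" unfolding A_def using T(3) Q(1) by (intro dist_set_le) auto
      also have "\<dots> \<le> C0 / 2 ^ k Q" using W[OF Q(1)] Q(2) by (intro C0(2)) auto
      finally have "epow (ennreal (C0 / 2 ^ k Q)) r \<le> epow (ennreal (dist_set N x A)) r"
        by (intro epow_antimono r ennreal_leI)
      then show "ennreal (c Q) \<le> epow (ennreal (dist_set N x A)) r"
        unfolding c_def using r C0(1) by (simp add: epow_ennreal)
    qed
    moreover have "C0 powr r / 2 * real m * 2 powr (- \<alpha> * real n) \<le> (\<Sum>Q\<in>T. c Q * measure \<nu> (Q' Q))"
    proof -
      have "C0 powr r / 2 * real m * 2 powr (- \<alpha> * real n) = (\<Sum>Q\<in>T. C0 powr r * (2 powr (- \<alpha> * real n) / 2))"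
        using T(2) by simp
      also have "\<dots> \<le> (\<Sum>Q\<in>T. c Q * measure \<nu> (Q' Q))"
      proof (rule sum_mono)
        fix Q assume Q: "Q \<in> T"
        have "C0 powr r * (2 powr (- \<alpha> * real n) / 2) \<le> C0 powr r * weight \<nu> r (Q' Q)"
          using W[OF Q] by (intro mult_left_mono) auto
        also have "weight \<nu> r (Q' Q) = measure \<nu> (Q' Q) * 2 powr (- (real (k Q) * r))"
          using W[OF Q] by (intro weight_eq) simp
        finally show "C0 powr r * (2 powr (- \<alpha> * real n) / 2) \<le> c Q * measure \<nu> (Q' Q)"
          unfolding c by (simp add: mult_ac)
      qed
      finally show ?thesis .
    qed
    ultimately have "ennreal (C0 powr r / 2 * real m * 2 powr (- \<alpha> * real n)) \<le> quant_integral N \<nu> r A"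
      by (meson ennreal_leI order_trans)
    then show ?thesis by (rule bexI[OF _ A(1)])
  qed
  have "0 < C0 powr r / 2" using C0(1) by simp
  from this bound show ?thesis by (rule that)
qed

section \<open>From integrals to quantization errors\<close>

abbreviation "err r n \<equiv> quant_error N \<nu> n r"

lemma err_eq: "r \<noteq> 0 \<Longrightarrow> err r n = (INF A\<in>codebooks n. epow (quant_integral N \<nu> r A) (1 / r))"
  unfolding quant_error_def quant_integral_def by simp

lemma err_le_pos:
  assumes "0 < r" "A \<in> codebooks n" "quant_integral N \<nu> r A \<le> ennreal b" "0 < b"
  shows "err r n \<le> ennreal (b powr (1 / r))"
proof -
  have "err r n \<le> epow (quant_integral N \<nu> r A) (1 / r)"
    using assms(1,2) by (subst err_eq) (auto intro: INF_lower)
  also have "\<dots> \<le> epow (ennreal b) (1 / r)" using assms by (intro epow_mono) auto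
  also have "\<dots> = ennreal (b powr (1 / r))" using assms by (intro epow_ennreal) auto
  finally show ?thesis .
qed

lemma err_ge_pos:
  assumes "0 < r" "\<And>A. A \<in> codebooks n \<Longrightarrow> ennreal b \<le> quant_integral N \<nu> r A" "0 < b"
  shows "ennreal (b powr (1 / r)) \<le> err r n"
proof -
  have "ennreal (b powr (1 / r)) = epow (ennreal b) (1 / r)" using assms by (intro epow_ennreal[symmetric]) auto
  also have "\<dots> \<le> err r n" using assms by (auto simp: err_eq intro!: INF_greatest epow_mono)
  finally show ?thesis .
qed

lemma err_le_neg:
  assumes "r < 0" "A \<in> codebooks n" "ennreal b \<le> quant_integral N \<nu> r A" "0 < b"
  shows "err r n \<le> ennreal (b powr (1 / r))"
proof -
  have "err r n \<le> epow (quant_integral N \<nu> r A) (1 / r)"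
    using assms(1,2) by (subst err_eq) (auto intro: INF_lower)
  also have "\<dots> \<le> epow (ennreal b) (1 / r)" using assms by (intro epow_antimono) auto
  also have "\<dots> = ennreal (b powr (1 / r))" using assms by (intro epow_ennreal) auto
  finally show ?thesis .
qed

lemma err_ge_neg:
  assumes "r < 0" "\<And>A. A \<in> codebooks n \<Longrightarrow> quant_integral N \<nu> r A \<le> ennreal b" "0 < b"
  shows "ennreal (b powr (1 / r)) \<le> err r n"
proof -
  have "ennreal (b powr (1 / r)) = epow (ennreal b) (1 / r)" using assms by (intro epow_ennreal[symmetric]) auto
  also have "\<dots> \<le> err r n" using assms by (auto simp: err_eq intro!: INF_greatest epow_antimono)
  finally show ?thesis .
qed

text \<open>An error below 1 makes its negative logarithm positive; lower bounds on the quotient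
  defining the dimension rely on that sign. A point in each cube of one sufficiently fine level does
  it.\<close>

lemma err_small:
  assumes r: "r \<noteq> 0"
  shows "\<forall>\<^sub>F n in sequentially. err r n \<le> ennreal (1 / 2)"
proof -
  obtain C0 where C0: "0 < C0" "\<And>n Q x y. Q \<in> dyadic_cubes n \<Longrightarrow> x \<in> Q \<Longrightarrow> y \<in> Q \<Longrightarrow> N (x - y) \<le> C0 / 2 ^ n"
    using N_diam by metis
  obtain k where k: "C0 * 2 < 2 ^ k" using real_arch_pow[of 2 "C0 * 2"] by auto
  define pick where "pick Q = (SOME y. y \<in> Q)" for Q :: "(real ^ 'd) set"
  have pick: "pick Q \<in> Q" if "Q \<in> dyadic_cubes k" for Q
    using dyadic_cubes_nonempty[OF that] unfolding pick_def by (metis someI)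
  let ?D = "dyadic_cubes k :: (real ^ 'd) set set"
  define A where "A = pick ` ?D"
  have "?D \<noteq> {}" using Union_dyadic_cubes[of k] exists_charged_cube by blast
  then have A: "A \<in> codebooks n" "finite A" if "card ?D \<le> n" for n
    unfolding codebooks_def A_def using card_image_le[of ?D pick] that
    by (auto simp: Suc_le_eq card_gt_0_iff)
  have close: "dist_set N x A \<le> 1 / 2" if "x \<in> half_open_unit_cube" for x
  proof -
    have D: "cube_at k x \<in> ?D" by (rule cube_at_in_dyadic_cubes[OF that])
    have "dist_set N x A \<le> N (x - pick (cube_at k x))" unfolding A_def using D by (intro dist_set_le) auto
    also have "\<dots> \<le> C0 / 2 ^ k" by (rule C0(2)[OF D mem_cube_at pick[OF D]])
    also have "\<dots> \<le> 1 / 2" using k by (simp add: field_simps)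
    finally show ?thesis .
  qed
  have "err r n \<le> ennreal (1 / 2)" if n: "card ?D \<le> n" for n
  proof (cases "0 < r")
    case True
    have "AE x in \<nu>. epow (ennreal (dist_set N x A)) r \<le> ennreal ((1/2) powr r)"
      using AE_unit_cube
    proof eventually_elim
      case (elim x)
      have "epow (ennreal (dist_set N x A)) r \<le> epow (ennreal (1/2)) r"
        using True close[OF elim] by (intro epow_mono ennreal_leI)
      also have "\<dots> = ennreal ((1/2) powr r)" using True by (intro epow_ennreal) auto
      finally show ?case .
    qed
    then have "quant_integral N \<nu> r A \<le> (\<integral>\<^sup>+ x. ennreal ((1/2) powr r) \<partial>\<nu>)"
      unfolding quant_integral_def by (rule nn_integral_mono_AE)
    then have "quant_integral N \<nu> r A \<le> ennreal ((1/2) powr r)" by (simp add: emeasure_space_1)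
    from err_le_pos[OF True A(1)[OF n] this] show ?thesis using True by (simp add: powr_powr)
  next
    case False
    with r have neg: "r < 0" by simp
    have "AE x in \<nu>. ennreal ((1/2) powr r) \<le> epow (ennreal (dist_set N x A)) r"
      using AE_unit_cube
    proof eventually_elim
      case (elim x)
      have "ennreal ((1/2) powr r) = epow (ennreal (1/2)) r" using neg by (intro epow_ennreal[symmetric]) auto
      also have "\<dots> \<le> epow (ennreal (dist_set N x A)) r"
        using neg close[OF elim] by (intro epow_antimono ennreal_leI)
      finally show ?case .
    qed
    then have "(\<integral>\<^sup>+ x. ennreal ((1/2) powr r) \<partial>\<nu>) \<le> quant_integral N \<nu> r A"
      unfolding quant_integral_def by (rule nn_integral_mono_AE)
    then have "ennreal ((1/2) powr r) \<le> quant_integral N \<nu> r A" by (simp add: emeasure_space_1)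
    from err_le_neg[OF neg A(1)[OF n] this] show ?thesis using neg by (simp add: powr_powr)
  qed
  then show ?thesis unfolding eventually_sequentially by blast
qed

end

section \<open>From error exponents to quantization dimensions\<close>

lemma elog_ennreal: "0 < e \<Longrightarrow> elog (ennreal e) = ereal (ln e)"
  unfolding elog_def by (simp add: ennreal_eq_0_iff not_le)

lemma dim_ratio_le:
  assumes n: "2 \<le> n" and z: "0 < z" and q: "q \<le> ennreal (real n powr (- 1 / z))"
  shows "ereal (ln (real n)) / (- elog q) \<le> ereal z"
proof (cases "q = 0")
  case True
  then show ?thesis using z by (simp add: elog_def)
next
  case False
  have "q \<noteq> \<infinity>" using q by (auto simp: top_unique)
  then obtain e where e: "q = ennreal e" "0 \<le> e" by (cases q) auto
  with False have e0: "0 < e" by (cases "e = 0") auto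
  have "e \<le> real n powr (- 1 / z)" using q unfolding e(1) by (subst (asm) ennreal_le_iff) auto
  then have "ln e \<le> ln (real n powr (- 1 / z))" using e0 n by (subst ln_le_cancel_iff) auto
  then have le: "ln (real n) / z \<le> - ln e" using n by (simp add: ln_powr)
  have ln: "0 < ln (real n)" using n by simp
  then have pos: "0 < - ln e" using le z by (smt (verit) divide_pos_pos)
  then have "ln (real n) / (- ln e) \<le> z" using le z by (simp only: divide_le_eq) (simp add: field_simps)
  then show ?thesis unfolding e(1) elog_ennreal[OF e0] using pos by simp
qed

lemma dim_ratio_ge:
  assumes n: "2 \<le> n" and z: "0 < z" and q: "ennreal (real n powr (- 1 / z)) \<le> q" "q < 1"
  shows "ereal z \<le> ereal (ln (real n)) / (- elog q)"
proof -
  have "q \<noteq> \<infinity>" using q by auto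
  then obtain e where e: "q = ennreal e" "0 \<le> e" by (cases q) auto
  have le: "real n powr (- 1 / z) \<le> e" using q(1) e(2) unfolding e(1) by simp
  have "0 < real n powr (- 1 / z)" using n by simp
  with le have e0: "0 < e" by linarith
  have e1: "e < 1" using q(2) e(2) unfolding e(1) by (simp add: ennreal_less_one_iff)
  have "ln (real n powr (- 1 / z)) \<le> ln e" using le e0 n by (subst ln_le_cancel_iff) auto
  then have le: "- ln e \<le> ln (real n) / z" using n by (simp add: ln_powr)
  have pos: "0 < - ln e" using e0 e1 by simp
  then have "z \<le> ln (real n) / (- ln e)" using le z by (simp only: le_divide_eq) (simp add: field_simps)
  then show ?thesis unfolding e(1) elog_ennreal[OF e0] using pos by simp
qed

lemma dim_ratio_nonneg:
  assumes "1 \<le> n" "q \<le> 1"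
  shows "0 \<le> ereal (ln (real n)) / (- elog q)"
proof (cases "q = 0")
  case False
  have "q \<noteq> \<infinity>" using assms(2) by (auto simp: top_unique)
  then obtain e where e: "q = ennreal e" "0 \<le> e" by (cases q) auto
  with False have e0: "0 < e" by (cases "e = 0") auto
  have "e \<le> 1" using assms(2) unfolding e(1) by (simp add: ennreal_le_1)
  then have "ln e \<le> 0" using e0 by simp
  then show ?thesis unfolding e(1) elog_ennreal[OF e0] using assms(1)
    by (cases "ln e = 0") (auto intro: divide_nonneg_neg divide_nonneg_nonpos)
qed (simp add: elog_def)

lemma eventually_exponent_le:
  fixes C t z :: real
  assumes "0 < t" "t < z"
  shows "\<forall>\<^sub>F n in sequentially. C * real n powr (- 1 / t) \<le> real n powr (- 1 / z)"
proof -
  have "- 1 / t < - 1 / z" using assms by (simp add: field_simps)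
  from eventually_compose_filterlim[OF eventually_mult_powr_less[OF this, of C] filterlim_real_sequentially]
  show ?thesis by eventually_elim simp
qed

lemma eventually_exponent_ge:
  fixes C t z :: real
  assumes "0 < z" "z < t" "0 < C"
  shows "\<forall>\<^sub>F n in sequentially. real n powr (- 1 / z) \<le> C * real n powr (- 1 / t)"
  using eventually_exponent_le[OF assms(1,2), of "1 / C"]
  by eventually_elim (use assms(3) in \<open>simp add: field_simps\<close>)

context quantization
begin

lemma upper_quant_dim_leI:
  assumes "0 < t" "\<forall>\<^sub>F n in sequentially. err r n \<le> ennreal (C * real n powr (- 1 / t))"
  shows "upper_quant_dim N \<nu> r \<le> ereal t"
proof (rule dense_ge)
  fix z' assume z': "ereal t < z'"
  show "upper_quant_dim N \<nu> r \<le> z'"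
  proof (cases z')
    case (real z)
    then have z: "t < z" using z' by simp
    have "\<forall>\<^sub>F n in sequentially. ereal (ln (real n)) / (- elog (err r n)) \<le> ereal z"
      using assms(2) eventually_exponent_le[OF assms(1) z, of C] eventually_ge_at_top[of 2]
    proof eventually_elim
      case (elim n)
      show ?case using elim z assms(1) by (intro dim_ratio_le) (auto intro: order_trans ennreal_leI)
    qed
    then show ?thesis unfolding upper_quant_dim_def real by (rule Limsup_bounded)
  qed (use z' in auto)
qed

lemma lower_quant_dim_leI:
  assumes "0 < t" "\<exists>\<^sub>F n in sequentially. err r n \<le> ennreal (C * real n powr (- 1 / t))"
  shows "lower_quant_dim N \<nu> r \<le> ereal t"
proof (rule dense_ge)
  fix z' assume z': "ereal t < z'"
  show "lower_quant_dim N \<nu> r \<le> z'"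
  proof (cases z')
    case (real z)
    then have z: "t < z" using z' by simp
    show ?thesis
    proof (rule ccontr)
      assume "\<not> ?thesis"
      then have "ereal z < lower_quant_dim N \<nu> r" unfolding real by simp
      then have "\<forall>\<^sub>F n in sequentially. ereal z < ereal (ln (real n)) / (- elog (err r n))"
        unfolding lower_quant_dim_def by (rule less_LiminfD)
      then have "\<forall>\<^sub>F n in sequentially. \<not> err r n \<le> ennreal (C * real n powr (- 1 / t))"
        using eventually_exponent_le[OF assms(1) z, of C] eventually_ge_at_top[of 2]
      proof eventually_elim
        case (elim n)
        show ?case
        proof
          assume "err r n \<le> ennreal (C * real n powr (- 1 / t))"
          also have "\<dots> \<le> ennreal (real n powr (- 1 / z))" using elim by (intro ennreal_leI)
          finally have "ereal (ln (real n)) / (- elog (err r n)) \<le> ereal z"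
            using elim z assms(1) by (intro dim_ratio_le) auto
          with elim(1) show False by simp
        qed
      qed
      with assms(2) show False by (simp add: frequently_def)
    qed
  qed (use z' in auto)
qed

lemma lower_quant_dim_geI:
  assumes "0 < t" "0 < C" "\<forall>\<^sub>F n in sequentially. ennreal (C * real n powr (- 1 / t)) \<le> err r n"
    and small: "\<forall>\<^sub>F n in sequentially. err r n < 1"
  shows "ereal t \<le> lower_quant_dim N \<nu> r"
proof (rule dense_le_bounded[of 0])
  fix z' assume z': "0 < z'" "z' < ereal t"
  then obtain z where z: "z' = ereal z" "0 < z" "z < t" by (cases z') auto
  have "\<forall>\<^sub>F n in sequentially. ereal z \<le> ereal (ln (real n)) / (- elog (err r n))"
    using assms(3) small eventually_exponent_ge[OF z(2,3) assms(2)] eventually_ge_at_top[of 2]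
  proof eventually_elim
    case (elim n)
    show ?case using elim z by (intro dim_ratio_ge) (auto intro: order_trans ennreal_leI)
  qed
  then show "z' \<le> lower_quant_dim N \<nu> r" unfolding lower_quant_dim_def z(1) by (rule Liminf_bounded)
qed (use assms in simp)

lemma upper_quant_dim_geI:
  assumes "0 < t" "0 < C" "\<exists>\<^sub>F n in sequentially. ennreal (C * real n powr (- 1 / t)) \<le> err r n"
    and small: "\<forall>\<^sub>F n in sequentially. err r n < 1"
  shows "ereal t \<le> upper_quant_dim N \<nu> r"
proof (rule dense_le_bounded[of 0])
  fix z' assume z': "0 < z'" "z' < ereal t"
  then obtain z where z: "z' = ereal z" "0 < z" "z < t" by (cases z') auto
  show "z' \<le> upper_quant_dim N \<nu> r"
  proof (rule ccontr)
    assume "\<not> ?thesis"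
    then have "upper_quant_dim N \<nu> r < ereal z" unfolding z(1) by simp
    then have "\<forall>\<^sub>F n in sequentially. ereal (ln (real n)) / (- elog (err r n)) < ereal z"
      unfolding upper_quant_dim_def by (rule Limsup_lessD)
    then have "\<forall>\<^sub>F n in sequentially. \<not> ennreal (C * real n powr (- 1 / t)) \<le> err r n"
      using small eventually_exponent_ge[OF z(2,3) assms(2)] eventually_ge_at_top[of 2]
    proof eventually_elim
      case (elim n)
      show ?case
      proof
        assume *: "ennreal (C * real n powr (- 1 / t)) \<le> err r n"
        have "ennreal (real n powr (- 1 / z)) \<le> ennreal (C * real n powr (- 1 / t))"
          using elim by (intro ennreal_leI)
        also note *
        finally have "ereal z \<le> ereal (ln (real n)) / (- elog (err r n))"
          using elim z by (intro dim_ratio_ge) auto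
        with elim(1) show False by simp
      qed
    qed
    with assms(3) show False by (simp add: frequently_def)
  qed
qed (use assms in simp)

lemma err_less_1:
  assumes "r \<noteq> 0"
  shows "\<forall>\<^sub>F n in sequentially. err r n < 1"
  using err_small[OF assms]
proof eventually_elim
  case (elim n)
  then have "err r n \<le> ennreal (1 / 2)" .
  also have "\<dots> < ennreal 1" by (intro ennreal_lessI) auto
  finally show ?case by simp
qed

lemma lower_quant_dim_nonneg:
  assumes "r \<noteq> 0"
  shows "0 \<le> lower_quant_dim N \<nu> r"
  unfolding lower_quant_dim_def
proof (rule Liminf_bounded)
  show "\<forall>\<^sub>F n in sequentially. 0 \<le> ereal (ln (real n)) / (- elog (err r n))"
    using err_less_1[OF assms] eventually_ge_at_top[of 1]
  proof eventually_elim
    case (elim n)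
    then show ?case by (intro dim_ratio_nonneg) auto
  qed
qed

end

section \<open>Quantization dimensions of nonzero order\<close>

definition dim_of_exponent :: "real \<Rightarrow> real \<Rightarrow> real" where
  "dim_of_exponent r h = r * h / (1 - h)"

lemma dim_of_exponent_pos: "0 < r \<and> 0 < h \<and> h < 1 \<or> r < 0 \<and> 1 < h \<Longrightarrow> 0 < dim_of_exponent r h"
  unfolding dim_of_exponent_def by (auto intro: divide_neg_neg simp: mult_neg_pos)

text \<open>A partition into n = x powr h cubes bounds the integral by n / x = n powr (1 - 1 / h),
  up to a constant. Taking the power 1 / r gives the error exponent on the right.\<close>

lemma inverse_dim_of_exponent:
  assumes "r \<noteq> 0" "h \<noteq> 0" "h \<noteq> 1"
  shows "(1 - 1 / h) * (1 / r) = - 1 / dim_of_exponent r h"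
  using assms unfolding dim_of_exponent_def by (simp add: field_simps)

lemma power_bound_eq:
  assumes "r \<noteq> 0" "h \<noteq> 0" "h \<noteq> 1" "0 < K"
  shows "(K * real n powr (1 - 1 / h)) powr (1 / r) = K powr (1 / r) * real n powr (- 1 / dim_of_exponent r h)"
  using assms(4) by (simp only: powr_mult powr_powr inverse_dim_of_exponent[OF assms(1-3)])

lemma ereal_dim_of_exponent:
  "h \<noteq> 1 \<Longrightarrow> ereal r * ereal h / (1 - ereal h) = ereal (dim_of_exponent r h)"
  unfolding dim_of_exponent_def by (simp add: one_ereal_def)

lemma tendsto_dim_of_exponent:
  assumes "h0 \<noteq> 1"
  shows "((\<lambda>h. ereal (dim_of_exponent r h)) \<longlongrightarrow> ereal (dim_of_exponent r h0)) (at h0 within S)"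
  unfolding dim_of_exponent_def using assms by (intro tendsto_intros) auto

text \<open>The error estimates hold for h strictly on one side of the critical value. This lemma
  and its three variants, for both sides and both directions of the inequality, close the gap by
  continuity away from h = 1.\<close>

lemma dim_of_exponent_le_limit_right:
  assumes "h0 \<noteq> 1" "h0 < h1" "\<And>h. h0 < h \<Longrightarrow> h < h1 \<Longrightarrow> X \<le> ereal (dim_of_exponent r h)"
  shows "X \<le> ereal (dim_of_exponent r h0)"
proof (rule tendsto_lowerbound[OF tendsto_dim_of_exponent[OF assms(1), of r "{h0<..}"]])
  show "\<forall>\<^sub>F h in at_right h0. X \<le> ereal (dim_of_exponent r h)"
    unfolding eventually_at_right_field using assms by blast
qed simp

lemma dim_of_exponent_ge_limit_right:
  assumes "h0 \<noteq> 1" "h0 < h1" "\<And>h. h0 < h \<Longrightarrow> h < h1 \<Longrightarrow> ereal (dim_of_exponent r h) \<le> X"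
  shows "ereal (dim_of_exponent r h0) \<le> X"
proof (rule tendsto_upperbound[OF tendsto_dim_of_exponent[OF assms(1), of r "{h0<..}"]])
  show "\<forall>\<^sub>F h in at_right h0. ereal (dim_of_exponent r h) \<le> X"
    unfolding eventually_at_right_field using assms by blast
qed simp

lemma dim_of_exponent_le_limit_left:
  assumes "h0 \<noteq> 1" "h1 < h0" "\<And>h. h1 < h \<Longrightarrow> h < h0 \<Longrightarrow> X \<le> ereal (dim_of_exponent r h)"
  shows "X \<le> ereal (dim_of_exponent r h0)"
proof (rule tendsto_lowerbound[OF tendsto_dim_of_exponent[OF assms(1), of r "{..<h0}"]])
  show "\<forall>\<^sub>F h in at_left h0. X \<le> ereal (dim_of_exponent r h)"
    unfolding eventually_at_left_field using assms by blast
qed simp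

lemma dim_of_exponent_ge_limit_left:
  assumes "h0 \<noteq> 1" "h1 < h0" "\<And>h. h1 < h \<Longrightarrow> h < h0 \<Longrightarrow> ereal (dim_of_exponent r h) \<le> X"
  shows "ereal (dim_of_exponent r h0) \<le> X"
proof (rule tendsto_upperbound[OF tendsto_dim_of_exponent[OF assms(1), of r "{..<h0}"]])
  show "\<forall>\<^sub>F h in at_left h0. ereal (dim_of_exponent r h) \<le> X"
    unfolding eventually_at_left_field using assms by blast
qed simp

lemma dim_of_exponent_mono:
  assumes "0 < r" "h \<le> h'" "h' < 1"
  shows "dim_of_exponent r h \<le> dim_of_exponent r h'"
proof -
  have "r * h * (1 - h') \<le> r * h' * (1 - h)"
  proof -
    have "r * h \<le> r * h'" using assms by simp
    then show ?thesis by (simp add: algebra_simps)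
  qed
  then show ?thesis unfolding dim_of_exponent_def using assms by (simp add: frac_le_eq divide_le_0_iff)
qed

lemma dim_of_exponent_antimono:
  assumes "r < 0" "1 < h" "h \<le> h'"
  shows "dim_of_exponent r h' \<le> dim_of_exponent r h"
proof -
  have "r * h' * (1 - h) \<le> r * h * (1 - h')"
  proof -
    have "r * h' \<le> r * h" using assms by simp
    then show ?thesis by (simp add: algebra_simps)
  qed
  moreover have "0 < (1 - h') * (1 - h)" using assms by (intro mult_neg_neg) auto
  ultimately show ?thesis unfolding dim_of_exponent_def using assms by (simp add: frac_le_eq divide_le_0_iff)
qed

section \<open>Matching thresholds, levels and codebook sizes\<close>

lemma quotient_powr_le:
  fixes x h :: real
  assumes h: "0 < h" and x: "0 < x" and n: "1 \<le> n" "real n \<le> x powr h"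
  shows "real n / x \<le> real n powr (1 - 1 / h)"
proof -
  have "real n powr (1 / h) \<le> (x powr h) powr (1 / h)" using h n by (intro powr_mono2) auto
  also have "\<dots> = x" using h x by (simp add: powr_powr)
  finally have "real n / x \<le> real n / real n powr (1 / h)" using n x by (intro divide_left_mono) auto
  also have "\<dots> = real n powr (1 - 1 / h)" using n by (simp add: powr_diff)
  finally show ?thesis .
qed

lemma eventually_quotient_powr:
  fixes M :: "real \<Rightarrow> nat"
  assumes h: "0 < h" and ev: "\<forall>\<^sub>F x in at_top. real (M x) < x powr h"
  shows "\<forall>\<^sub>F n in sequentially. \<exists>x>0. 1 \<le> n \<and> M x \<le> n \<and> real n / x \<le> real n powr (1 - 1 / h)"
proof -
  from ev obtain x0 where x0: "\<And>x. x0 \<le> x \<Longrightarrow> real (M x) < x powr h"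
    unfolding eventually_at_top_linorder by auto
  obtain n0 where n0: "max 1 x0 powr h \<le> real n0" using real_arch_simple by blast
  have "\<exists>x>0. 1 \<le> n \<and> M x \<le> n \<and> real n / x \<le> real n powr (1 - 1 / h)" if n: "max 1 n0 \<le> n" for n
  \<comment> \<open>The threshold with x powr h = n.\<close>
  proof (intro exI[of _ "real n powr (1 / h)"] conjI)
    have "(max 1 x0 powr h) powr (1 / h) \<le> real n powr (1 / h)" using n0 n h by (intro powr_mono2) auto
    then have "x0 \<le> real n powr (1 / h)" using h by (simp add: powr_powr)
    from x0[OF this] show "M (real n powr (1 / h)) \<le> n" using h n by (simp add: powr_powr)
    show "real n / real n powr (1 / h) \<le> real n powr (1 - 1 / h)" using n h by (simp add: powr_diff)
  qed (use n in auto)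
  then show ?thesis unfolding eventually_sequentially by blast
qed

lemma frequently_quotient_powr:
  fixes M :: "real \<Rightarrow> nat"
  assumes h: "0 < h" and fr: "\<exists>\<^sub>F x in at_top. real (M x) < x powr h"
  shows "\<exists>\<^sub>F n in sequentially. \<exists>x>0. 1 \<le> n \<and> M x \<le> n \<and> real n / x \<le> real n powr (1 - 1 / h)"
  unfolding frequently_sequentially
proof
  fix n0
  from fr obtain x where x: "(real n0 + 1) powr (1 / h) \<le> x" "real (M x) < x powr h"
    unfolding frequently_def eventually_at_top_linorder by (metis not_le less_imp_le)
  have x0: "0 < x" using x(1) by (smt (verit) of_nat_0_le_iff powr_gt_zero)
  have "((real n0 + 1) powr (1 / h)) powr h \<le> x powr h" using x h by (intro powr_mono2) auto
  then have big: "real n0 + 1 \<le> x powr h" using h by (simp add: powr_powr)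
  \<comment> \<open>Only some x are good, so n is read off from x. As an integer below x powr h, the
    value M x is at most the floor.\<close>
  define n where "n = nat \<lfloor>x powr h\<rfloor>"
  have n: "real n \<le> x powr h" "n0 \<le> n" "1 \<le> n" unfolding n_def using big by linarith+
  have "M x \<le> n" unfolding n_def using x(2) by linarith
  with n x0 quotient_powr_le[OF h x0 n(3,1)]
  show "\<exists>n\<ge>n0. \<exists>x>0. 1 \<le> n \<and> M x \<le> n \<and> real n / x \<le> real n powr (1 - 1 / h)" by blast
qed

text \<open>K is the number of heavy cubes demanded per codebook point. Every large m is served by
  the first integer level at which 2 powr (f \<alpha> n) reaches K m.\<close>

lemma eventually_coarse_scale:
  fixes c :: "nat \<Rightarrow> nat"
  assumes f: "0 < f" and \<alpha>: "0 < \<alpha>" and K: "1 \<le> K"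
    and ev: "\<forall>\<^sub>F n in sequentially. 2 powr (f * \<alpha> * real n) < max 1 (real (c n))"
  obtains b where "0 < b" "\<forall>\<^sub>F m in sequentially. \<exists>n. 1 \<le> m \<and> K * m \<le> c n \<and> b * real m powr (- 1 / f) \<le> 2 powr (- \<alpha> * real n)"
proof -
  from ev obtain n0 where n0: "\<And>n. n0 \<le> n \<Longrightarrow> 2 powr (f * \<alpha> * real n) < max 1 (real (c n))"
    unfolding eventually_sequentially by auto
  \<comment> \<open>The first factor pays for rounding the level up, the second for K.\<close>
  define b where "b = 2 powr (- \<alpha>) * real K powr (- 1 / f)"
  have "\<exists>n. 1 \<le> m \<and> K * m \<le> c n \<and> b * real m powr (- 1 / f) \<le> 2 powr (- \<alpha> * real n)"
    if m: "nat \<lceil>2 powr (f * \<alpha> * real n0)\<rceil> + 1 \<le> m" for m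
  proof -
    have Km: "m \<le> K * m" using K by simp
    have m1: "1 \<le> m" using m by simp
    have "2 powr (f * \<alpha> * real n0) \<le> real m" using m by linarith
    also have "\<dots> \<le> real (K * m)" using Km by (intro of_nat_mono)
    finally have "2 powr (f * \<alpha> * real n0) \<le> real (K * m)" .
    then have l0: "f * \<alpha> * real n0 \<le> log 2 (real (K * m))" using m1 K by (subst le_log_iff) auto
    define l where "l = log 2 (real (K * m)) / (f * \<alpha>)"
    have l: "real n0 \<le> l" "f * \<alpha> * l = log 2 (real (K * m))"
      unfolding l_def using l0 f \<alpha> by (auto simp: field_simps)
    define n where "n = nat \<lceil>l\<rceil>"
    have n: "n0 \<le> n" "l \<le> real n" "real n \<le> l + 1" unfolding n_def using l(1) by linarith+
    have "log 2 (real (K * m)) \<le> f * \<alpha> * real n" unfolding l(2)[symmetric] using n f \<alpha> by (intro mult_left_mono) auto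
    then have "real (K * m) \<le> 2 powr (f * \<alpha> * real n)" using m1 K by (subst (asm) log_le_iff) auto
    also have "\<dots> < max 1 (real (c n))" by (rule n0[OF n(1)])
    finally have "real (K * m) < max 1 (real (c n))" .
    \<comment> \<open>The maximum with 1 encodes log^+; a maximum exceeding K m \<ge> 1 must be the
      count itself.\<close>
    moreover have "1 \<le> real (K * m)" using m1 Km by linarith
    ultimately have "real (K * m) \<le> real (c n)" by linarith
    then have c: "K * m \<le> c n" by (simp only: of_nat_le_iff)
    have "b * real m powr (- 1 / f) = 2 powr (- \<alpha>) * real (K * m) powr (- 1 / f)"
      unfolding b_def by (simp add: powr_mult)
    also have "real (K * m) = 2 powr (f * \<alpha> * l)" unfolding l(2) using m1 K by simp
    also have "2 powr (- \<alpha>) * (2 powr (f * \<alpha> * l)) powr (- 1 / f) = 2 powr (- \<alpha> * (l + 1))"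
      using f by (simp add: powr_powr powr_add[symmetric] algebra_simps)
    also have "\<dots> \<le> 2 powr (- \<alpha> * real n)" using n(3) \<alpha> by (intro powr_mono mult_left_mono_neg) auto
    finally show ?thesis using m1 c by blast
  qed
  then have "\<forall>\<^sub>F m in sequentially. \<exists>n. 1 \<le> m \<and> K * m \<le> c n \<and> b * real m powr (- 1 / f) \<le> 2 powr (- \<alpha> * real n)"
    unfolding eventually_sequentially by blast
  moreover have "0 < b" unfolding b_def using K by simp
  ultimately show ?thesis using that by blast
qed

lemma frequently_coarse_scale:
  fixes c :: "nat \<Rightarrow> nat"
  assumes f: "0 < f" and \<alpha>: "0 < \<alpha>" and K: "1 \<le> K"
    and fr: "\<exists>\<^sub>F n in sequentially. 2 powr (f * \<alpha> * real n) < max 1 (real (c n))"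
  obtains b where "0 < b" "\<exists>\<^sub>F m in sequentially. \<exists>n. 1 \<le> m \<and> K * m \<le> c n \<and> b * real m powr (- 1 / f) \<le> 2 powr (- \<alpha> * real n)"
proof -
  \<comment> \<open>Rounding X / K down to a positive integer m loses at most the factor 2, which
    enters here.\<close>
  define b where "b = (2 * real K) powr (- 1 / f)"
  have "\<exists>\<^sub>F m in sequentially. \<exists>n. 1 \<le> m \<and> K * m \<le> c n \<and> b * real m powr (- 1 / f) \<le> 2 powr (- \<alpha> * real n)"
    unfolding frequently_sequentially
  proof
    fix m0
    \<comment> \<open>Beyond this level X is at least K (m0 + 1), so the rounded m reaches
      m0.\<close>
    define n0 where "n0 = nat \<lceil>log 2 (real (K * (m0 + 1))) / (f * \<alpha>)\<rceil>"
    from fr obtain n where n: "n0 \<le> n" "2 powr (f * \<alpha> * real n) < max 1 (real (c n))"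
      unfolding frequently_sequentially by blast
    define X where "X = 2 powr (f * \<alpha> * real n)"
    have "log 2 (real (K * (m0 + 1))) / (f * \<alpha>) \<le> real n" using n(1) unfolding n0_def by linarith
    then have "log 2 (real (K * (m0 + 1))) \<le> f * \<alpha> * real n" using f \<alpha> by (simp add: field_simps)
    moreover have "1 * 1 \<le> K * (m0 + 1)" using K by (intro mult_mono) auto
    from of_nat_mono[OF this, where 'a=real] have K1: "1 \<le> real (K * (m0 + 1))" by (simp only: mult_1 of_nat_1)
    ultimately have X: "real (K * (m0 + 1)) \<le> X" unfolding X_def by (subst (asm) log_le_iff) linarith+
    with K1 n(2) have cX: "X < real (c n)" unfolding X_def[symmetric] by linarith
    define m where "m = nat \<lfloor>X / real K\<rfloor>"
    have "real (m0 + 1) \<le> X / real K" using X K by (simp add: field_simps)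
    then have m: "m0 \<le> m" "1 \<le> m" "real m \<le> X / real K" "X / real K \<le> real m + 1" unfolding m_def by linarith+
    have "real (K * m) \<le> X" using m(3) K by (simp add: field_simps)
    with cX have "real (K * m) \<le> real (c n)" by linarith
    then have c: "K * m \<le> c n" by (simp only: of_nat_le_iff)
    have "X / real K \<le> 2 * real m" using m by linarith
    then have "X \<le> 2 * real K * real m" using K by (simp add: field_simps)
    moreover have "0 < X" unfolding X_def by simp
    ultimately have "(2 * real K * real m) powr (- 1 / f) \<le> X powr (- 1 / f)"
      using f by (intro powr_mono2') auto
    also have "\<dots> = 2 powr (- \<alpha> * real n)" unfolding X_def using f by (simp add: powr_powr)
    finally have "b * real m powr (- 1 / f) \<le> 2 powr (- \<alpha> * real n)"
      unfolding b_def by (simp only: powr_mult)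
    with m c show "\<exists>m\<ge>m0. \<exists>n. 1 \<le> m \<and> K * m \<le> c n \<and> b * real m powr (- 1 / f) \<le> 2 powr (- \<alpha> * real n)"
      by blast
  qed
  moreover have "0 < b" unfolding b_def using K by simp
  ultimately show ?thesis using that by blast
qed

section \<open>Bounds for the quantization dimensions at noncritical exponents\<close>

context quantization
begin

lemma err_le_of_partition:
  assumes r: "0 < r" and h: "0 < h" "h < 1"
  obtains C where "\<And>n x. 0 < x \<Longrightarrow> 1 \<le> n \<Longrightarrow> min_part_card \<nu> r x \<le> n \<Longrightarrow> real n / x \<le> real n powr (1 - 1 / h) \<Longrightarrow>
    err r n \<le> ennreal (C * real n powr (- 1 / dim_of_exponent r h))"
proof -
  have rd: "admissible r" using r by (intro neg_dim_infty_less) simp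
  obtain K where K: "0 < K" "\<And>P x n. P \<in> cube_partitions \<Longrightarrow> 0 < x \<Longrightarrow> (\<And>Q. Q \<in> P \<Longrightarrow> part_fun \<nu> r Q < 1 / x) \<Longrightarrow>
    card P \<le> n \<Longrightarrow> \<exists>A\<in>codebooks n. quant_integral N \<nu> r A \<le> ennreal (K * real n / x)"
    using partition_integral_upper[OF r] by metis
  have bound: "err r n \<le> ennreal (K powr (1 / r) * real n powr (- 1 / dim_of_exponent r h))"
    if x: "0 < x" and n: "1 \<le> n" "min_part_card \<nu> r x \<le> n" "real n / x \<le> real n powr (1 - 1 / h)" for n x
  proof -
    obtain P where P: "P \<in> cube_partitions" "\<And>Q. Q \<in> P \<Longrightarrow> part_fun \<nu> r Q < 1 / x" "card P \<le> n"
      using min_part_card_attained[OF rd x] n(2) by metis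
    from K(2)[OF P(1) x P(2,3)] obtain A where A: "A \<in> codebooks n" "quant_integral N \<nu> r A \<le> ennreal (K * real n / x)"
      by blast
    have "K * real n / x \<le> K * real n powr (1 - 1 / h)" using mult_left_mono[OF n(3), of K] K(1) by simp
    with A(2) have "quant_integral N \<nu> r A \<le> ennreal (K * real n powr (1 - 1 / h))"
      by (meson ennreal_leI order_trans)
    then have "err r n \<le> ennreal ((K * real n powr (1 - 1 / h)) powr (1 / r))"
      using r A(1) K(1) n(1) by (intro err_le_pos) auto
    then show ?thesis using r h K(1) by (simp add: power_bound_eq)
  qed
  then show ?thesis by (rule that)
qed

lemma err_ge_of_partition:
  assumes r: "r < 0" and r': "r' < r" "admissible r'" and h: "1 < h"
  obtains C where "0 < C" "\<And>n x. 0 < x \<Longrightarrow> 1 \<le> n \<Longrightarrow> min_part_card \<nu> r' x \<le> n \<Longrightarrow> real n / x \<le> real n powr (1 - 1 / h) \<Longrightarrow>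
    ennreal (C * real n powr (- 1 / dim_of_exponent r h)) \<le> err r n"
proof -
  obtain K where K: "0 < K" "\<And>P x n A. P \<in> cube_partitions \<Longrightarrow> 0 < x \<Longrightarrow> (\<And>Q. Q \<in> P \<Longrightarrow> part_fun \<nu> r' Q < 1 / x) \<Longrightarrow>
    card P \<le> n \<Longrightarrow> A \<in> codebooks n \<Longrightarrow> quant_integral N \<nu> r A \<le> ennreal (K * real n / x)"
    using partition_integral_upper_neg[OF r r'] by metis
  have bound: "ennreal (K powr (1 / r) * real n powr (- 1 / dim_of_exponent r h)) \<le> err r n"
    if x: "0 < x" and n: "1 \<le> n" "min_part_card \<nu> r' x \<le> n" "real n / x \<le> real n powr (1 - 1 / h)" for n x
  proof -
    obtain P where P: "P \<in> cube_partitions" "\<And>Q. Q \<in> P \<Longrightarrow> part_fun \<nu> r' Q < 1 / x" "card P \<le> n"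
      using min_part_card_attained[OF r'(2) x] n(2) by metis
    have "K * real n / x \<le> K * real n powr (1 - 1 / h)" using mult_left_mono[OF n(3), of K] K(1) by simp
    then have "quant_integral N \<nu> r A \<le> ennreal (K * real n powr (1 - 1 / h))" if "A \<in> codebooks n" for A
      using K(2)[OF P(1) x P(2,3) that] by (meson ennreal_leI order_trans)
    then have "ennreal ((K * real n powr (1 - 1 / h)) powr (1 / r)) \<le> err r n"
      using r K(1) n(1) by (intro err_ge_neg) auto
    then show ?thesis using r h K(1) by (simp add: power_bound_eq)
  qed
  have "0 < K powr (1 / r)" using K(1) by simp
  from this bound show ?thesis by (rule that)
qed

lemma mult_powr_exponent:
  assumes "1 \<le> m"
  shows "c * real m * (b * real m powr (- 1 / f)) = c * b * real m powr (1 - 1 / f)"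
  using assms by (simp add: powr_diff powr_minus divide_inverse)

lemma err_ge_of_coarse:
  assumes r: "0 < r" and f: "0 < f" "f < 1" and b: "0 < b"
  obtains C where "0 < C" "\<And>m n. 1 \<le> m \<Longrightarrow> 2 * 4 ^ CARD('d) * m \<le> coarse_count \<nu> \<alpha> r n \<Longrightarrow>
    b * real m powr (- 1 / f) \<le> 2 powr (- \<alpha> * real n) \<Longrightarrow>
    ennreal (C * real m powr (- 1 / dim_of_exponent r f)) \<le> err r m"
proof -
  obtain c where c: "0 < c" "\<And>\<alpha> n m A. 2 * 4 ^ CARD('d) * m \<le> coarse_count \<nu> \<alpha> r n \<Longrightarrow> A \<in> codebooks m \<Longrightarrow>
    ennreal (c * real m * 2 powr (- \<alpha> * real n)) \<le> quant_integral N \<nu> r A"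
    using coarse_integral_lower[OF r] by metis
  have bound: "ennreal ((c * b) powr (1 / r) * real m powr (- 1 / dim_of_exponent r f)) \<le> err r m"
    if m: "1 \<le> m" "2 * 4 ^ CARD('d) * m \<le> coarse_count \<nu> \<alpha> r n"
      "b * real m powr (- 1 / f) \<le> 2 powr (- \<alpha> * real n)" for m n
  proof -
    have "c * real m * (b * real m powr (- 1 / f)) \<le> c * real m * 2 powr (- \<alpha> * real n)"
      using m c(1) by (intro mult_left_mono) auto
    then have le: "c * b * real m powr (1 - 1 / f) \<le> c * real m * 2 powr (- \<alpha> * real n)"
      unfolding mult_powr_exponent[OF m(1)] .
    have "ennreal (c * b * real m powr (1 - 1 / f)) \<le> quant_integral N \<nu> r A" if "A \<in> codebooks m" for A
      using c(2)[OF m(2) that] ennreal_leI[OF le] by (rule order_trans[rotated])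
    then have "ennreal ((c * b * real m powr (1 - 1 / f)) powr (1 / r)) \<le> err r m"
      using r c(1) b m(1) by (intro err_ge_pos) auto
    then show ?thesis using r f c(1) b by (simp add: power_bound_eq)
  qed
  have "0 < (c * b) powr (1 / r)" using c(1) b by simp
  from this bound show ?thesis by (rule that)
qed

lemma err_le_of_coarse:
  assumes r: "r < 0" "admissible r" and f: "1 < f" and b: "0 < b"
  obtains C where "\<And>m n. 1 \<le> m \<Longrightarrow> m \<le> coarse_count \<nu> \<alpha> r n \<Longrightarrow>
    b * real m powr (- 1 / f) \<le> 2 powr (- \<alpha> * real n) \<Longrightarrow>
    err r m \<le> ennreal (C * real m powr (- 1 / dim_of_exponent r f))"
proof -
  obtain c where c: "0 < c" "\<And>\<alpha> n m. 1 \<le> m \<Longrightarrow> m \<le> coarse_count \<nu> \<alpha> r n \<Longrightarrow>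
    \<exists>A\<in>codebooks m. ennreal (c * real m * 2 powr (- \<alpha> * real n)) \<le> quant_integral N \<nu> r A"
    using coarse_integral_lower_neg[OF r] by metis
  have bound: "err r m \<le> ennreal ((c * b) powr (1 / r) * real m powr (- 1 / dim_of_exponent r f))"
    if m: "1 \<le> m" "m \<le> coarse_count \<nu> \<alpha> r n"
      "b * real m powr (- 1 / f) \<le> 2 powr (- \<alpha> * real n)" for m n
  proof -
    have "c * real m * (b * real m powr (- 1 / f)) \<le> c * real m * 2 powr (- \<alpha> * real n)"
      using m c(1) by (intro mult_left_mono) auto
    then have le: "c * b * real m powr (1 - 1 / f) \<le> c * real m * 2 powr (- \<alpha> * real n)"
      unfolding mult_powr_exponent[OF m(1)] .
    obtain A where A: "A \<in> codebooks m" "ennreal (c * real m * 2 powr (- \<alpha> * real n)) \<le> quant_integral N \<nu> r A"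
      using c(2)[OF m(1,2)] by blast
    have "ennreal (c * b * real m powr (1 - 1 / f)) \<le> quant_integral N \<nu> r A"
      using A(2) ennreal_leI[OF le] by (rule order_trans[rotated])
    then have "err r m \<le> ennreal ((c * b * real m powr (1 - 1 / f)) powr (1 / r))"
      using r A(1) c(1) b m(1) by (intro err_le_neg) auto
    then show ?thesis using r f c(1) b by (simp add: power_bound_eq)
  qed
  then show ?thesis by (rule that)
qed

lemma upper_quant_dim_le_entropy:
  assumes "0 < r" "0 < h" "h < 1" "upper_entropy \<nu> r < ereal h"
  shows "upper_quant_dim N \<nu> r \<le> ereal (dim_of_exponent r h)"
proof -
  have rd: "admissible r" using assms(1) by (intro neg_dim_infty_less) simp
  from err_le_of_partition[OF assms(1-3)] obtain C where C: "\<And>n x. 0 < x \<Longrightarrow> 1 \<le> n \<Longrightarrow> min_part_card \<nu> r x \<le> n \<Longrightarrow> real n / x \<le> real n powr (1 - 1 / h) \<Longrightarrow>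
    err r n \<le> ennreal (C * real n powr (- 1 / dim_of_exponent r h))" by metis
  show ?thesis
  proof (rule upper_quant_dim_leI)
    show "\<forall>\<^sub>F n in sequentially. err r n \<le> ennreal (C * real n powr (- 1 / dim_of_exponent r h))"
      using eventually_quotient_powr[OF assms(2) upper_entropy_lessD[OF rd assms(4)]]
      by eventually_elim (use C in blast)
  qed (use assms dim_of_exponent_pos in blast)
qed

lemma lower_quant_dim_le_entropy:
  assumes "0 < r" "0 < h" "h < 1" "lower_entropy \<nu> r < ereal h"
  shows "lower_quant_dim N \<nu> r \<le> ereal (dim_of_exponent r h)"
proof -
  have rd: "admissible r" using assms(1) by (intro neg_dim_infty_less) simp
  from err_le_of_partition[OF assms(1-3)] obtain C where C: "\<And>n x. 0 < x \<Longrightarrow> 1 \<le> n \<Longrightarrow> min_part_card \<nu> r x \<le> n \<Longrightarrow> real n / x \<le> real n powr (1 - 1 / h) \<Longrightarrow>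
    err r n \<le> ennreal (C * real n powr (- 1 / dim_of_exponent r h))" by metis
  show ?thesis
  proof (rule lower_quant_dim_leI)
    show "\<exists>\<^sub>F n in sequentially. err r n \<le> ennreal (C * real n powr (- 1 / dim_of_exponent r h))"
      using frequently_quotient_powr[OF assms(2) lower_entropy_lessD[OF rd assms(4)]]
      by (rule frequently_elim1) (use C in blast)
  qed (use assms dim_of_exponent_pos in blast)
qed

lemma lower_quant_dim_ge_entropy:
  assumes "r < 0" "r' < r" "admissible r'" "1 < h" "upper_entropy \<nu> r' < ereal h"
  shows "ereal (dim_of_exponent r h) \<le> lower_quant_dim N \<nu> r"
proof -
  from err_ge_of_partition[OF assms(1-4)] obtain C where C: "0 < C" "\<And>n x. 0 < x \<Longrightarrow> 1 \<le> n \<Longrightarrow> min_part_card \<nu> r' x \<le> n \<Longrightarrow> real n / x \<le> real n powr (1 - 1 / h) \<Longrightarrow>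
    ennreal (C * real n powr (- 1 / dim_of_exponent r h)) \<le> err r n" by metis
  have h: "0 < h" using assms by simp
  show ?thesis
  proof (rule lower_quant_dim_geI[OF _ C(1)])
    show "\<forall>\<^sub>F n in sequentially. ennreal (C * real n powr (- 1 / dim_of_exponent r h)) \<le> err r n"
      using eventually_quotient_powr[OF h upper_entropy_lessD[OF assms(3,5)]]
      by eventually_elim (use C(2) in blast)
    show "\<forall>\<^sub>F n in sequentially. err r n < 1" using assms(1) by (intro err_less_1) simp
  qed (use assms dim_of_exponent_pos in blast)
qed

lemma upper_quant_dim_ge_entropy:
  assumes "r < 0" "r' < r" "admissible r'" "1 < h" "lower_entropy \<nu> r' < ereal h"
  shows "ereal (dim_of_exponent r h) \<le> upper_quant_dim N \<nu> r"
proof -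
  from err_ge_of_partition[OF assms(1-4)] obtain C where C: "0 < C" "\<And>n x. 0 < x \<Longrightarrow> 1 \<le> n \<Longrightarrow> min_part_card \<nu> r' x \<le> n \<Longrightarrow> real n / x \<le> real n powr (1 - 1 / h) \<Longrightarrow>
    ennreal (C * real n powr (- 1 / dim_of_exponent r h)) \<le> err r n" by metis
  have h: "0 < h" using assms by simp
  show ?thesis
  proof (rule upper_quant_dim_geI[OF _ C(1)])
    show "\<exists>\<^sub>F n in sequentially. ennreal (C * real n powr (- 1 / dim_of_exponent r h)) \<le> err r n"
      using frequently_quotient_powr[OF h lower_entropy_lessD[OF assms(3,5)]]
      by (rule frequently_elim1) (use C(2) in blast)
    show "\<forall>\<^sub>F n in sequentially. err r n < 1" using assms(1) by (intro err_less_1) simp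
  qed (use assms dim_of_exponent_pos in blast)
qed

lemma upper_coarse_dim_greaterD:
  assumes "ereal f < upper_coarse_dim \<nu> r"
  obtains \<alpha> where "0 < \<alpha>" "\<exists>\<^sub>F n in sequentially. 2 powr (f * \<alpha> * real n) < max 1 (real (coarse_count \<nu> \<alpha> r n))"
proof -
  obtain \<alpha> where \<alpha>: "0 < \<alpha>" "ereal f < upper_coarse \<nu> r \<alpha> / ereal \<alpha>"
    using assms unfolding upper_coarse_dim_def less_SUP_iff by auto
  then have "ereal (f * \<alpha>) < upper_coarse \<nu> r \<alpha>" by (simp add: ereal_less_divide_iff)
  then have "\<exists>\<^sub>F n in sequentially. 2 powr (f * \<alpha> * real n) < max 1 (real (coarse_count \<nu> \<alpha> r n))"
    unfolding upper_coarse_eq_rate by (rule upper_rate_greaterD) simp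
  with \<alpha>(1) show ?thesis by (rule that)
qed

lemma lower_coarse_dim_greaterD:
  assumes "ereal f < lower_coarse_dim \<nu> r"
  obtains \<alpha> where "0 < \<alpha>" "\<forall>\<^sub>F n in sequentially. 2 powr (f * \<alpha> * real n) < max 1 (real (coarse_count \<nu> \<alpha> r n))"
proof -
  obtain \<alpha> where \<alpha>: "0 < \<alpha>" "ereal f < lower_coarse \<nu> r \<alpha> / ereal \<alpha>"
    using assms unfolding lower_coarse_dim_def less_SUP_iff by auto
  then have "ereal (f * \<alpha>) < lower_coarse \<nu> r \<alpha>" by (simp add: ereal_less_divide_iff)
  then have "\<forall>\<^sub>F n in sequentially. 2 powr (f * \<alpha> * real n) < max 1 (real (coarse_count \<nu> \<alpha> r n))"
    unfolding lower_coarse_eq_rate by (rule lower_rate_greaterD) simp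
  with \<alpha>(1) show ?thesis by (rule that)
qed

lemma upper_quant_dim_ge_coarse:
  assumes "0 < r" "0 < f" "f < 1" "ereal f < upper_coarse_dim \<nu> r"
  shows "ereal (dim_of_exponent r f) \<le> upper_quant_dim N \<nu> r"
proof -
  from upper_coarse_dim_greaterD[OF assms(4)] obtain \<alpha> where \<alpha>: "0 < \<alpha>"
    "\<exists>\<^sub>F n in sequentially. 2 powr (f * \<alpha> * real n) < max 1 (real (coarse_count \<nu> \<alpha> r n))" by metis
  from frequently_coarse_scale[where K="2 * 4 ^ CARD('d)", OF assms(2) \<alpha>(1) _ \<alpha>(2)] obtain b where b: "0 < b"
    "\<exists>\<^sub>F m in sequentially. \<exists>n. 1 \<le> m \<and> 2 * 4 ^ CARD('d) * m \<le> coarse_count \<nu> \<alpha> r n \<and> b * real m powr (- 1 / f) \<le> 2 powr (- \<alpha> * real n)"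
    by auto
  from err_ge_of_coarse[OF assms(1-3) b(1), of \<alpha>] obtain C where C: "0 < C"
    "\<And>m n. 1 \<le> m \<Longrightarrow> 2 * 4 ^ CARD('d) * m \<le> coarse_count \<nu> \<alpha> r n \<Longrightarrow>
    b * real m powr (- 1 / f) \<le> 2 powr (- \<alpha> * real n) \<Longrightarrow>
    ennreal (C * real m powr (- 1 / dim_of_exponent r f)) \<le> err r m" by metis
  show ?thesis
  proof (rule upper_quant_dim_geI[OF _ C(1)])
    show "\<exists>\<^sub>F n in sequentially. ennreal (C * real n powr (- 1 / dim_of_exponent r f)) \<le> err r n"
      using b(2) by (rule frequently_elim1) (use C(2) in blast)
    show "\<forall>\<^sub>F n in sequentially. err r n < 1" using assms(1) by (intro err_less_1) simp
  qed (use assms dim_of_exponent_pos in blast)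
qed

lemma lower_quant_dim_ge_coarse:
  assumes "0 < r" "0 < f" "f < 1" "ereal f < lower_coarse_dim \<nu> r"
  shows "ereal (dim_of_exponent r f) \<le> lower_quant_dim N \<nu> r"
proof -
  from lower_coarse_dim_greaterD[OF assms(4)] obtain \<alpha> where \<alpha>: "0 < \<alpha>"
    "\<forall>\<^sub>F n in sequentially. 2 powr (f * \<alpha> * real n) < max 1 (real (coarse_count \<nu> \<alpha> r n))" by metis
  from eventually_coarse_scale[where K="2 * 4 ^ CARD('d)", OF assms(2) \<alpha>(1) _ \<alpha>(2)] obtain b where b: "0 < b"
    "\<forall>\<^sub>F m in sequentially. \<exists>n. 1 \<le> m \<and> 2 * 4 ^ CARD('d) * m \<le> coarse_count \<nu> \<alpha> r n \<and> b * real m powr (- 1 / f) \<le> 2 powr (- \<alpha> * real n)"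
    by auto
  from err_ge_of_coarse[OF assms(1-3) b(1), of \<alpha>] obtain C where C: "0 < C"
    "\<And>m n. 1 \<le> m \<Longrightarrow> 2 * 4 ^ CARD('d) * m \<le> coarse_count \<nu> \<alpha> r n \<Longrightarrow>
    b * real m powr (- 1 / f) \<le> 2 powr (- \<alpha> * real n) \<Longrightarrow>
    ennreal (C * real m powr (- 1 / dim_of_exponent r f)) \<le> err r m" by metis
  show ?thesis
  proof (rule lower_quant_dim_geI[OF _ C(1)])
    show "\<forall>\<^sub>F n in sequentially. ennreal (C * real n powr (- 1 / dim_of_exponent r f)) \<le> err r n"
      using b(2) by eventually_elim (use C(2) in blast)
    show "\<forall>\<^sub>F n in sequentially. err r n < 1" using assms(1) by (intro err_less_1) simp
  qed (use assms dim_of_exponent_pos in blast)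
qed

lemma lower_quant_dim_le_coarse:
  assumes "r < 0" "admissible r" "1 < f" "ereal f < upper_coarse_dim \<nu> r"
  shows "lower_quant_dim N \<nu> r \<le> ereal (dim_of_exponent r f)"
proof -
  have f: "0 < f" using assms by simp
  from upper_coarse_dim_greaterD[OF assms(4)] obtain \<alpha> where \<alpha>: "0 < \<alpha>"
    "\<exists>\<^sub>F n in sequentially. 2 powr (f * \<alpha> * real n) < max 1 (real (coarse_count \<nu> \<alpha> r n))" by metis
  from frequently_coarse_scale[where K=1, OF f \<alpha>(1) _ \<alpha>(2)] obtain b where b: "0 < b"
    "\<exists>\<^sub>F m in sequentially. \<exists>n. 1 \<le> m \<and> m \<le> coarse_count \<nu> \<alpha> r n \<and> b * real m powr (- 1 / f) \<le> 2 powr (- \<alpha> * real n)"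
    by auto
  from err_le_of_coarse[OF assms(1-3) b(1), of \<alpha>] obtain C where C:
    "\<And>m n. 1 \<le> m \<Longrightarrow> m \<le> coarse_count \<nu> \<alpha> r n \<Longrightarrow>
    b * real m powr (- 1 / f) \<le> 2 powr (- \<alpha> * real n) \<Longrightarrow>
    err r m \<le> ennreal (C * real m powr (- 1 / dim_of_exponent r f))" by metis
  show ?thesis
  proof (rule lower_quant_dim_leI)
    show "\<exists>\<^sub>F n in sequentially. err r n \<le> ennreal (C * real n powr (- 1 / dim_of_exponent r f))"
      using b(2) by (rule frequently_elim1) (use C in blast)
  qed (use assms dim_of_exponent_pos in blast)
qed

lemma upper_quant_dim_le_coarse:
  assumes "r < 0" "admissible r" "1 < f" "ereal f < lower_coarse_dim \<nu> r"
  shows "upper_quant_dim N \<nu> r \<le> ereal (dim_of_exponent r f)"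
proof -
  have f: "0 < f" using assms by simp
  from lower_coarse_dim_greaterD[OF assms(4)] obtain \<alpha> where \<alpha>: "0 < \<alpha>"
    "\<forall>\<^sub>F n in sequentially. 2 powr (f * \<alpha> * real n) < max 1 (real (coarse_count \<nu> \<alpha> r n))" by metis
  from eventually_coarse_scale[where K=1, OF f \<alpha>(1) _ \<alpha>(2)] obtain b where b: "0 < b"
    "\<forall>\<^sub>F m in sequentially. \<exists>n. 1 \<le> m \<and> m \<le> coarse_count \<nu> \<alpha> r n \<and> b * real m powr (- 1 / f) \<le> 2 powr (- \<alpha> * real n)"
    by auto
  from err_le_of_coarse[OF assms(1-3) b(1), of \<alpha>] obtain C where C:
    "\<And>m n. 1 \<le> m \<Longrightarrow> m \<le> coarse_count \<nu> \<alpha> r n \<Longrightarrow>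
    b * real m powr (- 1 / f) \<le> 2 powr (- \<alpha> * real n) \<Longrightarrow>
    err r m \<le> ennreal (C * real m powr (- 1 / dim_of_exponent r f))" by metis
  show ?thesis
  proof (rule upper_quant_dim_leI)
    show "\<forall>\<^sub>F n in sequentially. err r n \<le> ennreal (C * real n powr (- 1 / dim_of_exponent r f))"
      using b(2) by eventually_elim (use C in blast)
  qed (use assms dim_of_exponent_pos in blast)
qed

end

section \<open>Dependence on the order from the left\<close>

context quant_measure
begin

lemma lower_entropy_antimono:
  assumes "admissible r" "r \<le> r'"
  shows "lower_entropy \<nu> r' \<le> lower_entropy \<nu> r"
  unfolding lower_entropy_def
proof (rule Liminf_mono)
  have r': "admissible r'" using assms by (metis ereal_less_eq(3) less_le_trans)
  show "\<forall>\<^sub>F x in at_top. ereal (ln (real (min_part_card \<nu> r' x)) / ln x) \<le> ereal (ln (real (min_part_card \<nu> r x)) / ln x)"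
    using eventually_gt_at_top[of 1]
  proof eventually_elim
    case (elim x)
    have "1 \<le> min_part_card \<nu> r' x" using min_part_card_pos[OF r'] elim by simp
    moreover have "min_part_card \<nu> r' x \<le> min_part_card \<nu> r x" using min_part_card_antimono[OF assms] elim by simp
    ultimately have "ln (real (min_part_card \<nu> r' x)) \<le> ln (real (min_part_card \<nu> r x))"
      by (subst ln_le_cancel_iff) auto
    then show ?case using elim by (simp add: divide_right_mono)
  qed
qed

lemma exists_smaller_order:
  assumes "admissible r"
  obtains \<epsilon>0 where "0 < \<epsilon>0" "\<And>\<epsilon>. \<epsilon> < \<epsilon>0 \<Longrightarrow> admissible (r - \<epsilon>)"
proof -
  from dim_infty_dense[OF assms] obtain s where s: "0 < s" "0 < s + r" "ereal s < dim_infty \<nu>" by blast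
  have "admissible (r - \<epsilon>)" if "\<epsilon> < s + r" for \<epsilon>
  proof -
    have "- dim_infty \<nu> < - ereal s" using s(3) by (simp only: ereal_minus_less_minus)
    also have "- ereal s < ereal (r - \<epsilon>)" using that by simp
    finally show ?thesis .
  qed
  with s(2) that show ?thesis by blast
qed

text \<open>A single q below h with \<beta> q < r q keeps this strict inequality for slightly
  smaller orders. This closes the gap r' < r left by the estimates of negative order.\<close>

lemma crit_left_continuous:
  assumes r: "admissible r" and h: "crit r < h"
  shows "\<exists>r'<r. admissible r' \<and> crit r' < h"
proof -
  from exists_smaller_order[OF r] obtain \<epsilon>0 where e0: "0 < \<epsilon>0"
    "\<And>\<epsilon>. \<epsilon> < \<epsilon>0 \<Longrightarrow> admissible (r - \<epsilon>)" by metis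
  obtain q where qh: "crit r < q" "q < h" using dense[OF h] by blast
  have q: "0 < q" "\<beta> q < r * q" using beta_less_above_crit[OF r qh(1)] by auto
  \<comment> \<open>The second term spends half of the slack r q - \<beta> q, the first keeps the
    order admissible.\<close>
  define \<epsilon> where "\<epsilon> = min (\<epsilon>0 / 2) ((r * q - \<beta> q) / (2 * q))"
  have e: "0 < \<epsilon>" "\<epsilon> < \<epsilon>0" using e0 q unfolding \<epsilon>_def by auto
  have "\<epsilon> * q \<le> (r * q - \<beta> q) / (2 * q) * q" unfolding \<epsilon>_def using q by (intro mult_right_mono) auto
  also have "\<dots> = (r * q - \<beta> q) / 2" using q by simp
  finally have "\<beta> q < (r - \<epsilon>) * q" using q by (simp add: algebra_simps)
  with crit_le[OF e0(2)[OF e(2)] q(1)] have "crit (r - \<epsilon>) \<le> q" by simp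
  then show ?thesis using e e0(2)[OF e(2)] qh by (intro exI[of _ "r - \<epsilon>"]) auto
qed

text \<open>Monotonicity in the order turns the left limit into an infimum over smaller orders, so
  \<open>Lim\<close> denotes an actual limit. It is finite, lying between 0 and
  \<open>crit r\<close> by left continuity of \<open>crit\<close>. The last conclusion supplies the
  smaller order r' required for negative r.\<close>

lemma lower_entropy_lim_props:
  assumes r: "admissible r"
  obtains h where "lower_entropy_lim \<nu> r = ereal h" "lower_entropy \<nu> r \<le> ereal h" "0 \<le> h" "h \<le> crit r"
    "\<And>h'. h < h' \<Longrightarrow> \<exists>r'<r. admissible r' \<and> lower_entropy \<nu> r' < ereal h'"
proof -
  from exists_smaller_order[OF r] obtain \<epsilon>0 where e0: "0 < \<epsilon>0"
    "\<And>\<epsilon>. \<epsilon> < \<epsilon>0 \<Longrightarrow> admissible (r - \<epsilon>)" by metis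
  define L where "L = (INF \<epsilon>\<in>{0<..<\<epsilon>0}. lower_entropy \<nu> (r - \<epsilon>))"
  have ge: "lower_entropy \<nu> r \<le> L" unfolding L_def
    using e0 by (intro INF_greatest lower_entropy_antimono) auto
  have less: "\<exists>\<epsilon>. 0 < \<epsilon> \<and> \<epsilon> < \<epsilon>0 \<and> lower_entropy \<nu> (r - \<epsilon>) < a" if "L < a" for a
    using that unfolding L_def INF_less_iff by auto
  have lim: "((\<lambda>\<epsilon>. lower_entropy \<nu> (r - \<epsilon>)) \<longlongrightarrow> L) (at_right 0)"
  proof (rule order_tendstoI)
    fix a assume a: "a < L"
    show "\<forall>\<^sub>F \<epsilon> in at_right 0. a < lower_entropy \<nu> (r - \<epsilon>)"
      unfolding eventually_at_right_field
    proof (intro exI[of _ \<epsilon>0] conjI allI impI)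
      fix \<epsilon> :: real assume "0 < \<epsilon>" "\<epsilon> < \<epsilon>0"
      then have "L \<le> lower_entropy \<nu> (r - \<epsilon>)" unfolding L_def by (intro INF_lower) auto
      with a show "a < lower_entropy \<nu> (r - \<epsilon>)" by (rule less_le_trans)
    qed (use e0 in simp)
  next
    fix a assume "L < a"
    from less[OF this] obtain \<epsilon>1 where e1: "0 < \<epsilon>1" "\<epsilon>1 < \<epsilon>0" "lower_entropy \<nu> (r - \<epsilon>1) < a" by blast
    show "\<forall>\<^sub>F \<epsilon> in at_right 0. lower_entropy \<nu> (r - \<epsilon>) < a"
      unfolding eventually_at_right_field
    proof (intro exI[of _ \<epsilon>1] conjI allI impI)
      fix \<epsilon> :: real assume "0 < \<epsilon>" "\<epsilon> < \<epsilon>1"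
      then have "lower_entropy \<nu> (r - \<epsilon>) \<le> lower_entropy \<nu> (r - \<epsilon>1)"
        using e1 e0 by (intro lower_entropy_antimono) auto
      with e1(3) show "lower_entropy \<nu> (r - \<epsilon>) < a" by (rule le_less_trans[rotated])
    qed (use e1 in simp)
  qed
  have L: "lower_entropy_lim \<nu> r = L" unfolding lower_entropy_lim_def
    using lim by (intro tendsto_Lim) auto
  have L0: "0 \<le> L" using lower_entropy_nonneg[OF r] ge by (rule order_trans)
  have Lc: "L \<le> ereal (crit r)"
  proof (rule dense_ge)
    fix z assume z: "ereal (crit r) < z"
    show "L \<le> z"
    proof (cases z)
      case (real q)
      then have "crit r < q" using z by simp
      from crit_left_continuous[OF r this] obtain r' where r': "r' < r" "admissible r'" "crit r' < q" by blast
      define \<epsilon> where "\<epsilon> = min (r - r') (\<epsilon>0 / 2)"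
      have e: "0 < \<epsilon>" "\<epsilon> < \<epsilon>0" "r' \<le> r - \<epsilon>" using e0(1) r'(1) unfolding \<epsilon>_def by auto
      have "L \<le> lower_entropy \<nu> (r - \<epsilon>)" unfolding L_def using e by (intro INF_lower) auto
      also have "\<dots> \<le> lower_entropy \<nu> r'" by (rule lower_entropy_antimono[OF r'(2) e(3)])
      also have "\<dots> \<le> upper_entropy \<nu> r'" by (rule lower_entropy_le_upper)
      also have "\<dots> \<le> ereal (crit r')" by (rule upper_entropy_le_crit[OF r'(2)])
      also have "\<dots> \<le> z" unfolding real using r'(3) by simp
      finally show ?thesis .
    qed (use z in auto)
  qed
  from L0 Lc obtain h where h: "L = ereal h" "0 \<le> h" "h \<le> crit r" by (cases L) auto
  show ?thesis
  proof (rule that[of h])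
    fix h' assume "h < h'"
    then have "L < ereal h'" using h by simp
    from less[OF this] obtain \<epsilon> where "0 < \<epsilon>" "\<epsilon> < \<epsilon>0" "lower_entropy \<nu> (r - \<epsilon>) < ereal h'" by blast
    then show "\<exists>r'<r. admissible r' \<and> lower_entropy \<nu> r' < ereal h'"
      using e0(2) by (intro exI[of _ "r - \<epsilon>"]) auto
  qed (use h L ge in auto)
qed

lemma lower_coarse_dim_nonneg: "0 \<le> lower_coarse_dim \<nu> r"
proof -
  have "0 \<le> lower_coarse \<nu> r 1"
    unfolding lower_coarse_def by (intro Liminf_bounded always_eventually) auto
  also have "lower_coarse \<nu> r 1 \<le> lower_coarse \<nu> r 1 / ereal 1" by (simp add: one_ereal_def[symmetric])
  also have "\<dots> \<le> lower_coarse_dim \<nu> r" unfolding lower_coarse_dim_def by (intro SUP_upper) auto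
  finally show ?thesis .
qed

lemma lower_coarse_dim_props:
  assumes r: "admissible r"
  obtains f where "lower_coarse_dim \<nu> r = ereal f" "f \<le> crit r" "ereal f \<le> lower_entropy \<nu> r"
proof -
  have "lower_coarse_dim \<nu> r \<le> lower_entropy \<nu> r" by (rule lower_coarse_dim_le_lower_entropy[OF r])
  also have "\<dots> \<le> upper_entropy \<nu> r" by (rule lower_entropy_le_upper)
  also have "\<dots> \<le> ereal (crit r)" by (rule upper_entropy_le_crit[OF r])
  finally have le: "lower_coarse_dim \<nu> r \<le> ereal (crit r)" .
  with lower_coarse_dim_nonneg[of r] obtain f where "lower_coarse_dim \<nu> r = ereal f"
    by (cases "lower_coarse_dim \<nu> r") auto
  with le lower_coarse_dim_le_lower_entropy[OF r] that show ?thesis by simp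
qed

end

section \<open>Dimensions of positive and of negative order\<close>

context quantization
begin

text \<open>Heavy cubes bound from below, partitions from above, and both exponents equal
  \<open>crit r\<close>. The auxiliary ends 0 and 1 keep h in the range of those bounds.\<close>

lemma upper_quant_dim_eq:
  assumes r: "0 < r"
  shows "upper_quant_dim N \<nu> r = ereal (dim_of_exponent r (crit r))"
proof (rule antisym)
  have rd: "admissible r" using r by (intro neg_dim_infty_less) simp
  have "real CARD('d) / (real CARD('d) + r) < 1" using r by simp
  then have c1: "crit r < 1" using crit_less_1[OF r] by linarith
  have c0: "0 < crit r" by (rule crit_pos[OF rd])
  show "upper_quant_dim N \<nu> r \<le> ereal (dim_of_exponent r (crit r))"
    using r c0 c1 upper_entropy_eq[OF rd]
    by - (rule dim_of_exponent_le_limit_right[of _ 1], (auto)[2], rule upper_quant_dim_le_entropy, auto)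
  show "ereal (dim_of_exponent r (crit r)) \<le> upper_quant_dim N \<nu> r"
    using r c0 c1 upper_coarse_dim_eq[OF rd]
    by - (rule dim_of_exponent_ge_limit_left[of _ 0], (auto)[2], rule upper_quant_dim_ge_coarse, auto)
qed

lemma lower_quant_dim_eq:
  assumes r: "r < 0" "admissible r"
  shows "lower_quant_dim N \<nu> r = ereal (dim_of_exponent r (crit r))"
proof (rule antisym)
  have c1: "1 < crit r" by (rule crit_greater_1[OF r(2,1)])
  show "lower_quant_dim N \<nu> r \<le> ereal (dim_of_exponent r (crit r))"
    using r c1 upper_coarse_dim_eq[OF r(2)]
    by - (rule dim_of_exponent_le_limit_left[of _ 1], (auto)[2], rule lower_quant_dim_le_coarse, auto)
  show "ereal (dim_of_exponent r (crit r)) \<le> lower_quant_dim N \<nu> r"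
  proof (rule dim_of_exponent_ge_limit_right[of _ "crit r + 1"])
    fix h assume h: "crit r < h"
    from crit_left_continuous[OF r(2) this] obtain r' where r': "r' < r" "admissible r'" "crit r' < h"
      by blast
    show "ereal (dim_of_exponent r h) \<le> lower_quant_dim N \<nu> r"
      using r r' h c1 upper_entropy_eq[OF r'(2)] by (intro lower_quant_dim_ge_entropy[of r r']) auto
  qed (use c1 in auto)
qed

lemma quantization_positive_order:
  assumes r: "0 < r"
  shows "ereal r * lower_coarse_dim \<nu> r / (1 - lower_coarse_dim \<nu> r) \<le> lower_quant_dim N \<nu> r \<and>
        lower_quant_dim N \<nu> r \<le> ereal r * lower_entropy_lim \<nu> r / (1 - lower_entropy_lim \<nu> r) \<and>
        ereal r * lower_entropy_lim \<nu> r / (1 - lower_entropy_lim \<nu> r)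
          \<le> ereal r * upper_entropy \<nu> r / (1 - upper_entropy \<nu> r) \<and>
        ereal r * upper_entropy \<nu> r / (1 - upper_entropy \<nu> r) = upper_quant_dim N \<nu> r \<and>
        upper_quant_dim N \<nu> r = ereal r * crit_exp \<nu> r / (1 - crit_exp \<nu> r) \<and>
        ereal r * crit_exp \<nu> r / (1 - crit_exp \<nu> r)
          = ereal r * upper_coarse_dim \<nu> r / (1 - upper_coarse_dim \<nu> r)"
proof -
  have rd: "admissible r" using r by (intro neg_dim_infty_less) simp
  have "real CARD('d) / (real CARD('d) + r) < 1" using r by simp
  then have c1: "crit r < 1" using crit_less_1[OF r] by linarith
  from lower_entropy_lim_props[OF rd] obtain hL where hL: "lower_entropy_lim \<nu> r = ereal hL"
    "lower_entropy \<nu> r \<le> ereal hL" "0 \<le> hL" "hL \<le> crit r" by metis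
  from lower_coarse_dim_props[OF rd] obtain f where f: "lower_coarse_dim \<nu> r = ereal f" "f \<le> crit r" by metis
  have 1: "ereal (dim_of_exponent r f) \<le> lower_quant_dim N \<nu> r"
  \<comment> \<open>The bound by heavy cubes needs a positive exponent; for f = 0 the left side is
    0.\<close>
  proof (cases "f \<le> 0")
    case True
    then have "f = 0" using lower_coarse_dim_nonneg[of r] f by simp
    then show ?thesis using lower_quant_dim_nonneg[of r] r unfolding dim_of_exponent_def by (simp add: zero_ereal_def)
  next
    case False
    then show ?thesis
      using r c1 f by - (rule dim_of_exponent_ge_limit_left[of _ 0], (auto)[2], rule lower_quant_dim_ge_coarse, auto)
  qed
  have 2: "lower_quant_dim N \<nu> r \<le> ereal (dim_of_exponent r hL)"
  proof (rule dim_of_exponent_le_limit_right[of _ 1])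
    fix h assume h: "hL < h" "h < 1"
    then have "lower_entropy \<nu> r < ereal h" using hL(2) by (simp add: le_less_trans)
    then show "lower_quant_dim N \<nu> r \<le> ereal (dim_of_exponent r h)"
      using r h hL(3) by (intro lower_quant_dim_le_entropy) auto
  qed (use c1 hL in auto)
  have 3: "dim_of_exponent r hL \<le> dim_of_exponent r (crit r)"
    using r hL c1 by (intro dim_of_exponent_mono)
  have ne: "f \<noteq> 1" "hL \<noteq> 1" "crit r \<noteq> 1" using f(2) hL(4) c1 by auto
  show ?thesis
    unfolding f(1) hL(1) upper_entropy_eq[OF rd] crit_exp_eq[OF rd] upper_coarse_dim_eq[OF rd] upper_quant_dim_eq[OF r]
      ereal_dim_of_exponent[OF ne(1)] ereal_dim_of_exponent[OF ne(2)] ereal_dim_of_exponent[OF ne(3)]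
    using 1 2 3 by simp
qed

lemma quantization_negative_order:
  assumes r: "admissible r" "r < 0"
  shows "(ereal r * upper_coarse_dim \<nu> r / (1 - upper_coarse_dim \<nu> r)
           = ereal r * crit_exp \<nu> r / (1 - crit_exp \<nu> r) \<and>
         ereal r * crit_exp \<nu> r / (1 - crit_exp \<nu> r) = lower_quant_dim N \<nu> r \<and>
         lower_quant_dim N \<nu> r = ereal r * upper_entropy \<nu> r / (1 - upper_entropy \<nu> r)) \<and>
        (lower_coarse_dim \<nu> r > 1 \<longrightarrow>
         ereal r * upper_entropy \<nu> r / (1 - upper_entropy \<nu> r)
           \<le> ereal r * lower_entropy_lim \<nu> r / (1 - lower_entropy_lim \<nu> r) \<and>
         ereal r * lower_entropy_lim \<nu> r / (1 - lower_entropy_lim \<nu> r) \<le> upper_quant_dim N \<nu> r \<and>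
         upper_quant_dim N \<nu> r
           \<le> ereal r * lower_coarse_dim \<nu> r / (1 - lower_coarse_dim \<nu> r))"
proof -
  have c1: "1 < crit r" by (rule crit_greater_1[OF r])
  then have c_ne: "crit r \<noteq> 1" by simp
  have a: "ereal r * upper_coarse_dim \<nu> r / (1 - upper_coarse_dim \<nu> r)
           = ereal r * crit_exp \<nu> r / (1 - crit_exp \<nu> r) \<and>
         ereal r * crit_exp \<nu> r / (1 - crit_exp \<nu> r) = lower_quant_dim N \<nu> r \<and>
         lower_quant_dim N \<nu> r = ereal r * upper_entropy \<nu> r / (1 - upper_entropy \<nu> r)"
    unfolding upper_entropy_eq[OF r(1)] crit_exp_eq[OF r(1)] upper_coarse_dim_eq[OF r(1)] lower_quant_dim_eq[OF r(2,1)]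
      ereal_dim_of_exponent[OF c_ne] by simp
  have b: "ereal r * upper_entropy \<nu> r / (1 - upper_entropy \<nu> r)
           \<le> ereal r * lower_entropy_lim \<nu> r / (1 - lower_entropy_lim \<nu> r) \<and>
         ereal r * lower_entropy_lim \<nu> r / (1 - lower_entropy_lim \<nu> r) \<le> upper_quant_dim N \<nu> r \<and>
         upper_quant_dim N \<nu> r
           \<le> ereal r * lower_coarse_dim \<nu> r / (1 - lower_coarse_dim \<nu> r)"
    if F: "lower_coarse_dim \<nu> r > 1"
  proof -
    from lower_entropy_lim_props[OF r(1)] obtain hL where hL: "lower_entropy_lim \<nu> r = ereal hL"
      "lower_entropy \<nu> r \<le> ereal hL" "hL \<le> crit r"
      "\<And>h'. hL < h' \<Longrightarrow> \<exists>r'<r. admissible r' \<and> lower_entropy \<nu> r' < ereal h'" by metis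
    from lower_coarse_dim_props[OF r(1)] obtain f where f: "lower_coarse_dim \<nu> r = ereal f"
      "f \<le> crit r" "ereal f \<le> lower_entropy \<nu> r" by metis
    have f1: "1 < f" using F by (simp only: f(1) one_ereal_def less_ereal.simps)
    \<comment> \<open>The assumption that the lower coarse dimension exceeds 1 passes on to hL,
      which keeps all denominators 1 - h negative.\<close>
    have "ereal f \<le> ereal hL" using f(3) hL(2) by (rule order_trans)
    then have hL1: "1 < hL" using f1 by simp
    have 1: "dim_of_exponent r (crit r) \<le> dim_of_exponent r hL"
      using r hL1 hL(3) by (intro dim_of_exponent_antimono)
    have 2: "ereal (dim_of_exponent r hL) \<le> upper_quant_dim N \<nu> r"
    proof (rule dim_of_exponent_ge_limit_right[of _ "hL + 1"])
      fix h assume h: "hL < h"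
      from hL(4)[OF this] obtain r' where r': "r' < r" "admissible r'" "lower_entropy \<nu> r' < ereal h" by blast
      show "ereal (dim_of_exponent r h) \<le> upper_quant_dim N \<nu> r"
        using r r' h hL1 by (intro upper_quant_dim_ge_entropy[of r r']) auto
    qed (use hL1 in auto)
    have 3: "upper_quant_dim N \<nu> r \<le> ereal (dim_of_exponent r f)"
      using r f1 f(1) by - (rule dim_of_exponent_le_limit_left[of _ 1], (auto)[2], rule upper_quant_dim_le_coarse, auto)
    have ne: "f \<noteq> 1" "hL \<noteq> 1" using f1 hL1 by auto
    show ?thesis
      unfolding f(1) hL(1) upper_entropy_eq[OF r(1)]
        ereal_dim_of_exponent[OF ne(1)] ereal_dim_of_exponent[OF ne(2)] ereal_dim_of_exponent[OF c_ne]
      using 1 2 3 by simp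
  qed
  from a b show ?thesis by blast
qed

end

section \<open>The geometric mean error\<close>

lemma eexp_ereal: "eexp (ereal t) = ennreal (exp t)"
  unfolding eexp_def by simp

lemma ereal_integral_eq:
  assumes g: "integrable M g" and f: "AE x in M. f x = ereal (g x)"
  shows "ereal_integral M f = ereal (\<integral>x. g x \<partial>M)"
proof -
  have 1: "(\<integral>\<^sup>+ x. e2ennreal (f x) \<partial>M) = (\<integral>\<^sup>+ x. ennreal (g x) \<partial>M)"
    using f by (intro nn_integral_cong_AE) (auto elim!: eventually_mono simp: e2ennreal_ereal)
  have 2: "(\<integral>\<^sup>+ x. e2ennreal (- f x) \<partial>M) = (\<integral>\<^sup>+ x. ennreal (- g x) \<partial>M)"
    using f by (intro nn_integral_cong_AE) (auto elim!: eventually_mono simp: e2ennreal_ereal)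
  have fin: "(\<integral>\<^sup>+ x. ennreal (g x) \<partial>M) < \<infinity>" "(\<integral>\<^sup>+ x. ennreal (- g x) \<partial>M) < \<infinity>"
    using g unfolding real_integrable_def by (auto simp: less_top)
  have e: "enn2ereal y = ereal (enn2real y)" if "y < \<infinity>" for y
    using that by (cases y) (auto simp: enn2ereal_ennreal)
  show ?thesis
    unfolding ereal_integral_def 1 2 e[OF fin(1)] e[OF fin(2)] real_lebesgue_integral_def[OF g] by simp
qed

lemma codebooks_mono: "m \<le> n \<Longrightarrow> codebooks m \<subseteq> codebooks n"
  unfolding codebooks_def by auto

lemma dim_ratio_mono:
  assumes "1 \<le> n" "q1 \<le> q2" "q2 < 1"
  shows "ereal (ln (real n)) / (- elog q1) \<le> ereal (ln (real n)) / (- elog q2)"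
proof (cases "q1 = 0")
  case True
  then have "ereal (ln (real n)) / (- elog q1) = 0" by (simp add: elog_def)
  also have "\<dots> \<le> ereal (ln (real n)) / (- elog q2)" using assms by (intro dim_ratio_nonneg) auto
  finally show ?thesis .
next
  case False
  have "q1 < 1" using assms(2,3) by (rule le_less_trans)
  with assms(3) have "q1 \<noteq> \<infinity>" "q2 \<noteq> \<infinity>" by auto
  then obtain e1 e2 where e: "q1 = ennreal e1" "0 \<le> e1" "q2 = ennreal e2" "0 \<le> e2" by (cases q1; cases q2) auto
  have e1: "0 < e1" using False e by (cases "e1 = 0") auto
  have le: "e1 \<le> e2" using assms(2) e by simp
  have "ennreal e2 < ennreal 1" using assms(3) e by simp
  then have e2: "e2 < 1" using e by (subst (asm) ennreal_less_iff) auto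
  have "ln e1 \<le> ln e2" "ln e2 < 0" using e1 le e2 by auto
  moreover have "0 \<le> ln (real n)" using assms(1) by simp
  ultimately have "ln (real n) / (- ln e1) \<le> ln (real n) / (- ln e2)" by (intro divide_left_mono mult_pos_pos) auto
  then show ?thesis
    unfolding e(1,3) elog_ennreal[OF e1] elog_ennreal[OF less_le_trans[OF e1 le]]
    using \<open>ln e1 \<le> ln e2\<close> \<open>ln e2 < 0\<close> by simp
qed

lemma (in quant_measure) dim_infty_pos_real:
  obtains s where "0 < s" "ereal s < dim_infty \<nu>" "\<And>r. - s < r \<Longrightarrow> admissible r"
proof (rule dim_infty_dense[OF neg_dim_infty_less[OF order_refl]])
  fix s assume s: "0 < s" "ereal s < dim_infty \<nu>"
  have "admissible r" if "- s < r" for r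
  proof -
    have "- dim_infty \<nu> < - ereal s" using s(2) by (simp only: ereal_minus_less_minus)
    also have "- ereal s < ereal r" using that by simp
    finally show ?thesis .
  qed
  with s show thesis by (rule that)
qed

context quantization
begin

lemma AE_dist_set_pos:
  assumes "A \<in> codebooks n"
  shows "AE x in \<nu>. 0 < dist_set N x A"
  using AE_not_in_finite[OF conjunct1[OF codebooksD[OF assms]]]
  by eventually_elim (rule dist_set_pos[OF assms])

lemma quant_integral_eq_powr:
  assumes "A \<in> codebooks n" "r \<noteq> 0"
  shows "quant_integral N \<nu> r A = (\<integral>\<^sup>+ x. ennreal (dist_set N x A powr r) \<partial>\<nu>)"
  unfolding quant_integral_def using AE_dist_set_pos[OF assms(1)] assms(2)
  by (intro nn_integral_cong_AE) (auto elim!: eventually_mono simp: epow_ennreal)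

lemma quant_integral_finite_pos:
  assumes A: "A \<in> codebooks n" and r: "0 < r"
  shows "quant_integral N \<nu> r A < \<infinity>"
proof -
  from N_diam obtain C0 where C0: "0 < C0" "\<And>n Q x y. Q \<in> dyadic_cubes n \<Longrightarrow> x \<in> Q \<Longrightarrow> y \<in> Q \<Longrightarrow> N (x - y) \<le> C0 / 2 ^ n"
    by metis
  obtain a where a: "a \<in> A" "finite A" using codebooksD[OF A] by blast
  have one: "(1 :: real ^ 'd) \<in> half_open_unit_cube" by (simp add: half_open_unit_cube_def)
  define B where "B = C0 + N (1 - a)"
  have B: "0 < B" unfolding B_def using C0(1) N_nonneg[of "1 - a"] by linarith
  have "AE x in \<nu>. epow (ennreal (dist_set N x A)) r \<le> ennreal (B powr r)"
    using AE_unit_cube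
  proof eventually_elim
    case (elim x)
    have "dist_set N x A \<le> N ((x - 1) + (1 - a))" using dist_set_le[OF a(2,1), of N x] by simp
    also have "\<dots> \<le> N (x - 1) + N (1 - a)" using norm_N unfolding is_norm_def by blast
    also have "N (x - 1) \<le> C0" using C0(2)[of half_open_unit_cube 0 x 1] elim one by (simp add: dyadic_cubes_0)
    finally have "epow (ennreal (dist_set N x A)) r \<le> epow (ennreal B) r"
      unfolding B_def using r by (intro epow_mono ennreal_leI) auto
    also have "\<dots> = ennreal (B powr r)" using r B by (intro epow_ennreal) auto
    finally show ?case .
  qed
  then have "quant_integral N \<nu> r A \<le> (\<integral>\<^sup>+ x. ennreal (B powr r) \<partial>\<nu>)"
    unfolding quant_integral_def by (rule nn_integral_mono_AE)
  also have "\<dots> < \<infinity>" by (simp add: emeasure_space_1)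
  finally show ?thesis .
qed

text \<open>The uniform estimate for all codebooks, taken at threshold x = 1, already gives
  finiteness. The size parameter is a maximum because it has to bound the partition and the codebook
  at once.\<close>

lemma quant_integral_finite_neg:
  assumes A: "A \<in> codebooks n" and r: "r < 0" "admissible r"
  shows "quant_integral N \<nu> r A < \<infinity>"
proof -
  from exists_smaller_order[OF r(2)] obtain \<epsilon>0 where e0: "0 < \<epsilon>0"
    "\<And>\<epsilon>. \<epsilon> < \<epsilon>0 \<Longrightarrow> admissible (r - \<epsilon>)" by metis
  define r' where "r' = r - \<epsilon>0 / 2"
  have r': "r' < r" "admissible r'" unfolding r'_def using e0 by auto
  obtain K where K: "0 < K" "\<And>P x n A. P \<in> cube_partitions \<Longrightarrow> 0 < x \<Longrightarrow> (\<And>Q. Q \<in> P \<Longrightarrow> part_fun \<nu> r' Q < 1 / x) \<Longrightarrow>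
    card P \<le> n \<Longrightarrow> A \<in> codebooks n \<Longrightarrow> quant_integral N \<nu> r A \<le> ennreal (K * real n / x)"
    using partition_integral_upper_neg[OF r(1) r'] by metis
  obtain P where P: "P \<in> cube_partitions" "\<And>Q. Q \<in> P \<Longrightarrow> part_fun \<nu> r' Q < 1 / 1"
    using min_part_card_attained[OF r'(2), of 1] by auto
  have "A \<in> codebooks (max n (card P))" using A codebooks_mono[of n "max n (card P)"] by auto
  from K(2)[OF P(1) _ P(2) _ this] have "quant_integral N \<nu> r A \<le> ennreal (K * real (max n (card P)) / 1)" by simp
  also have "\<dots> < \<infinity>" by simp
  finally show ?thesis .
qed

lemma dist_set_powr_integrable:
  assumes A: "A \<in> codebooks n" and r: "r \<noteq> 0" "admissible r"
  shows "integrable \<nu> (\<lambda>x. dist_set N x A powr r)"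
    and "quant_integral N \<nu> r A = ennreal (\<integral>x. dist_set N x A powr r \<partial>\<nu>)"
    and "0 < (\<integral>x. dist_set N x A powr r \<partial>\<nu>)"
proof -
  have m: "(\<lambda>x. dist_set N x A powr r) \<in> borel_measurable \<nu>"
    using borel_measurable_dist_set[OF A] by measurable
  have fin: "quant_integral N \<nu> r A < \<infinity>"
    using quant_integral_finite_pos[OF A] quant_integral_finite_neg[OF A] r by (cases "0 < r") auto
  then show int: "integrable \<nu> (\<lambda>x. dist_set N x A powr r)"
    unfolding quant_integral_eq_powr[OF A r(1)] using m by (intro integrableI_nonneg) auto
  show "quant_integral N \<nu> r A = ennreal (\<integral>x. dist_set N x A powr r \<partial>\<nu>)"
    unfolding quant_integral_eq_powr[OF A r(1)] using int by (intro nn_integral_eq_integral) auto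
  have "(\<integral>x. dist_set N x A powr r \<partial>\<nu>) \<noteq> 0"
  proof
    assume "(\<integral>x. dist_set N x A powr r \<partial>\<nu>) = 0"
    then have "AE x in \<nu>. dist_set N x A powr r = 0"
      using int by (subst (asm) integral_nonneg_eq_0_iff_AE) auto
    with AE_dist_set_pos[OF A] have "AE x in \<nu>. False" by eventually_elim auto
    then show False by simp
  qed
  moreover have "0 \<le> (\<integral>x. dist_set N x A powr r \<partial>\<nu>)" by (intro integral_nonneg_AE) auto
  ultimately show "0 < (\<integral>x. dist_set N x A powr r \<partial>\<nu>)" by linarith
qed

text \<open>For \<delta> > 0 both ln \<delta> \<le> \<delta> and - ln \<delta> \<le> \<delta> powr
  (- s) / s hold; the moments of orders 1 and - s are finite, the latter because - s is
  admissible.\<close>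

lemma ln_dist_set_integrable:
  assumes A: "A \<in> codebooks n"
  shows "integrable \<nu> (\<lambda>x. ln (dist_set N x A))"
proof -
  obtain s where s: "0 < s" "ereal s < dim_infty \<nu>" "\<And>r. - s < r \<Longrightarrow> admissible r"
    using dim_infty_pos_real by metis
  have rd: "admissible (- s)" using s(2) by (simp only: ereal_minus_less_minus flip: uminus_ereal.simps(1))
  have "integrable \<nu> (\<lambda>x. dist_set N x A powr 1 + dist_set N x A powr (- s) / s)"
    using dist_set_powr_integrable(1)[OF A _ neg_dim_infty_less[of 1]] dist_set_powr_integrable(1)[OF A _ rd] s(1)
    by (intro Bochner_Integration.integrable_add) auto
  then show ?thesis
  proof (rule Bochner_Integration.integrable_bound)
    show "(\<lambda>x. ln (dist_set N x A)) \<in> borel_measurable \<nu>"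
      using borel_measurable_dist_set[OF A] by measurable
    show "AE x in \<nu>. norm (ln (dist_set N x A)) \<le> norm (dist_set N x A powr 1 + dist_set N x A powr (- s) / s)"
      using AE_dist_set_pos[OF A]
    proof eventually_elim
      case (elim x)
      define \<delta> where "\<delta> = dist_set N x A"
      have d: "0 < \<delta>" unfolding \<delta>_def by fact
      have 1: "ln \<delta> \<le> \<delta>" using ln_le_minus_one[OF d] by simp
      have "ln (\<delta> powr (- s)) \<le> \<delta> powr (- s) - 1" using d by (intro ln_le_minus_one) simp
      then have "- s * ln \<delta> \<le> \<delta> powr (- s)" using d by (simp add: ln_powr)
      then have 2: "- ln \<delta> \<le> \<delta> powr (- s) / s" using s(1) by (simp add: field_simps)
      have 3: "0 \<le> \<delta> powr (- s) / s" using s(1) by simp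
      have "\<bar>ln \<delta>\<bar> \<le> \<delta> + \<delta> powr (- s) / s" using 1 2 3 d by linarith
      then show ?case unfolding \<delta>_def[symmetric] using d 3 by simp
    qed
  qed
qed

lemma geometric_error_eq:
  assumes A: "A \<in> codebooks n"
  shows "eexp (ereal_integral \<nu> (\<lambda>x. elog (ennreal (dist_set N x A)))) = ennreal (exp (\<integral>x. ln (dist_set N x A) \<partial>\<nu>))"
proof -
  have "AE x in \<nu>. elog (ennreal (dist_set N x A)) = ereal (ln (dist_set N x A))"
    using AE_dist_set_pos[OF A] by eventually_elim (rule elog_ennreal)
  from ereal_integral_eq[OF ln_dist_set_integrable[OF A] this] show ?thesis by (simp add: eexp_ereal)
qed

text \<open>Jensen's inequality for ln, obtained from ln t \<le> t - 1 at t = dist powr r / c, where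
  c normalises the mean of t to 1. It holds for either sign of r; dividing by r decides on which
  side the geometric mean error lies.\<close>

lemma integral_ln_dist_set_le:
  assumes A: "A \<in> codebooks n" and r: "r \<noteq> 0" "admissible r"
  shows "r * (\<integral>x. ln (dist_set N x A) \<partial>\<nu>) \<le> ln (\<integral>x. dist_set N x A powr r \<partial>\<nu>)"
proof -
  define c where "c = (\<integral>x. dist_set N x A powr r \<partial>\<nu>)"
  have c: "0 < c" unfolding c_def by (rule dist_set_powr_integrable(3)[OF A r])
  note i1 = ln_dist_set_integrable[OF A] and i2 = dist_set_powr_integrable(1)[OF A r]
  have "(\<integral>x. r * ln (dist_set N x A) - ln c \<partial>\<nu>) \<le> (\<integral>x. dist_set N x A powr r / c - 1 \<partial>\<nu>)"
  proof (rule integral_mono_AE)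
    show "AE x in \<nu>. r * ln (dist_set N x A) - ln c \<le> dist_set N x A powr r / c - 1"
      using AE_dist_set_pos[OF A]
    proof eventually_elim
      case (elim x)
      have "ln (dist_set N x A powr r / c) \<le> dist_set N x A powr r / c - 1"
        using elim c by (intro ln_le_minus_one) simp
      then show ?case using elim c by (simp add: ln_div ln_powr)
    qed
  qed (use i1 i2 in auto)
  also have "\<dots> = c / c - 1" using i2 by (simp add: c_def prob_space)
  also have "\<dots> = 0" using c by simp
  also have "(\<integral>x. r * ln (dist_set N x A) - ln c \<partial>\<nu>) = r * (\<integral>x. ln (dist_set N x A) \<partial>\<nu>) - ln c"
    using i1 by (simp add: prob_space)
  finally show ?thesis unfolding c_def by simp
qed

lemma err_0_le:
  assumes r: "0 < r"
  shows "err 0 n \<le> err r n"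
proof -
  have rd: "admissible r" using r by (intro neg_dim_infty_less) simp
  have "eexp (ereal_integral \<nu> (\<lambda>x. elog (ennreal (dist_set N x A)))) \<le> epow (quant_integral N \<nu> r A) (1 / r)"
    if A: "A \<in> codebooks n" for A
  proof -
    define c where "c = (\<integral>x. dist_set N x A powr r \<partial>\<nu>)"
    have c: "0 < c" unfolding c_def using r rd by (intro dist_set_powr_integrable(3)[OF A]) auto
    have "r * (\<integral>x. ln (dist_set N x A) \<partial>\<nu>) \<le> ln c" unfolding c_def using r rd by (intro integral_ln_dist_set_le[OF A]) auto
    then have "(\<integral>x. ln (dist_set N x A) \<partial>\<nu>) \<le> 1 / r * ln c" using r by (simp add: field_simps)
    then have "exp (\<integral>x. ln (dist_set N x A) \<partial>\<nu>) \<le> c powr (1 / r)" using c by (simp add: powr_def)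
    moreover have "quant_integral N \<nu> r A = ennreal c" unfolding c_def using r rd by (intro dist_set_powr_integrable(2)[OF A]) auto
    ultimately show ?thesis unfolding geometric_error_eq[OF A] using c r by (simp add: epow_ennreal ennreal_leI)
  qed
  then have "(INF A\<in>codebooks n. eexp (ereal_integral \<nu> (\<lambda>x. elog (ennreal (dist_set N x A)))))
    \<le> (INF A\<in>codebooks n. epow (quant_integral N \<nu> r A) (1 / r))" by (intro INF_mono) blast
  then show ?thesis using r by (simp add: err_eq) (simp add: quant_error_def)
qed

lemma err_0_ge:
  assumes r: "r < 0" "admissible r"
  shows "err r n \<le> err 0 n"
proof -
  have "epow (quant_integral N \<nu> r A) (1 / r) \<le> eexp (ereal_integral \<nu> (\<lambda>x. elog (ennreal (dist_set N x A))))"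
    if A: "A \<in> codebooks n" for A
  proof -
    define c where "c = (\<integral>x. dist_set N x A powr r \<partial>\<nu>)"
    have c: "0 < c" unfolding c_def using r by (intro dist_set_powr_integrable(3)[OF A]) auto
    have "r * (\<integral>x. ln (dist_set N x A) \<partial>\<nu>) \<le> ln c" unfolding c_def using r by (intro integral_ln_dist_set_le[OF A]) auto
    then have "1 / r * ln c \<le> (\<integral>x. ln (dist_set N x A) \<partial>\<nu>)" using r by (simp add: field_simps)
    then have "c powr (1 / r) \<le> exp (\<integral>x. ln (dist_set N x A) \<partial>\<nu>)" using c by (simp add: powr_def)
    moreover have "quant_integral N \<nu> r A = ennreal c" unfolding c_def using r by (intro dist_set_powr_integrable(2)[OF A]) auto
    ultimately show ?thesis unfolding geometric_error_eq[OF A] using c r by (simp add: epow_ennreal ennreal_leI)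
  qed
  then have "(INF A\<in>codebooks n. epow (quant_integral N \<nu> r A) (1 / r))
    \<le> (INF A\<in>codebooks n. eexp (ereal_integral \<nu> (\<lambda>x. elog (ennreal (dist_set N x A)))))" by (intro INF_mono) blast
  then show ?thesis using r by (simp add: err_eq) (simp add: quant_error_def)
qed

lemma upper_quant_dim_0_le:
  assumes r: "0 < r"
  shows "upper_quant_dim N \<nu> 0 \<le> upper_quant_dim N \<nu> r"
  unfolding upper_quant_dim_def
proof (rule Limsup_mono)
  have "r \<noteq> 0" using r by simp
  from err_less_1[OF this] eventually_ge_at_top[of 1]
  show "\<forall>\<^sub>F n in sequentially. ereal (ln (real n)) / (- elog (err 0 n)) \<le> ereal (ln (real n)) / (- elog (err r n))"
    by eventually_elim (rule dim_ratio_mono[OF _ err_0_le[OF r]])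
qed

lemma lower_quant_dim_0_ge:
  assumes r: "r < 0" "admissible r"
  shows "lower_quant_dim N \<nu> r \<le> lower_quant_dim N \<nu> 0"
  unfolding lower_quant_dim_def
proof (rule Liminf_mono)
  \<comment> \<open>The error of order 0 is below 1 because that of order 1 is;
    \<open>err_less_1\<close> speaks about nonzero orders.\<close>
  have "(1::real) \<noteq> 0" by simp
  from err_less_1[OF this] eventually_ge_at_top[of 1]
  show "\<forall>\<^sub>F n in sequentially. ereal (ln (real n)) / (- elog (err r n)) \<le> ereal (ln (real n)) / (- elog (err 0 n))"
  proof eventually_elim
    case (elim n)
    have "err 0 n < 1" using err_0_le[of 1 n] elim(1) by (simp add: le_less_trans)
    then show ?case by (rule dim_ratio_mono[OF elim(2) err_0_ge[OF r]])
  qed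
qed

end

section \<open>Differentiability of the critical exponent at zero\<close>

context quant_measure
begin

lemma beta_near_1:
  obtains s where "0 < s" "\<And>q. 0 \<le> q \<Longrightarrow> q \<le> 1 \<Longrightarrow> s * (1 - q) \<le> \<beta> q" "\<And>q. 1 \<le> q \<Longrightarrow> \<beta> q \<le> - (s * (q - 1))"
proof -
  obtain s where s: "0 < s" "ereal s < dim_infty \<nu>" "\<And>r. - s < r \<Longrightarrow> admissible r"
    using dim_infty_pos_real by metis
  have "s * (1 - q) \<le> \<beta> q" if "0 \<le> q" "q \<le> 1" for q using beta_shift[OF s(2) that] beta_1 by simp
  moreover have "\<beta> q \<le> - (s * (q - 1))" if "1 \<le> q" for q using beta_shift[OF s(2) _ that] beta_1 by simp
  ultimately show ?thesis using s(1) that by blast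
qed

lemma abs_beta_le: "0 \<le> q \<Longrightarrow> \<bar>\<beta> q\<bar> \<le> real CARD('d) * \<bar>q - 1\<bar>"
proof -
  assume q: "0 \<le> q"
  from beta_near_1 obtain s where s: "0 < s" "\<And>q. 0 \<le> q \<Longrightarrow> q \<le> 1 \<Longrightarrow> s * (1 - q) \<le> \<beta> q"
    "\<And>q. 1 \<le> q \<Longrightarrow> \<beta> q \<le> - (s * (q - 1))" by metis
  show ?thesis
  proof (cases "q \<le> 1")
    case True
    have "0 \<le> s * (1 - q)" using s(1) True by simp
    then have "0 \<le> \<beta> q" using s(2)[OF q True] by linarith
    then show ?thesis using beta_le[OF q True] True by simp
  next
    case False
    have "0 \<le> s * (q - 1)" using s(1) False by simp
    then have "\<beta> q \<le> 0" using s(3)[of q] False by linarith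
    then show ?thesis using beta_ge[of q] False by simp
  qed
qed

lemma beta_nonzero: "0 \<le> q \<Longrightarrow> q \<noteq> 1 \<Longrightarrow> \<beta> q \<noteq> 0"
proof -
  assume q: "0 \<le> q" "q \<noteq> 1"
  from beta_near_1 obtain s where s: "0 < s" "\<And>q. 0 \<le> q \<Longrightarrow> q \<le> 1 \<Longrightarrow> s * (1 - q) \<le> \<beta> q"
    "\<And>q. 1 \<le> q \<Longrightarrow> \<beta> q \<le> - (s * (q - 1))" by metis
  show ?thesis
  proof (cases "q < 1")
    case True
    have "0 < s * (1 - q)" using s(1) True by simp
    then show ?thesis using s(2)[of q] q True by linarith
  next
    case False
    have "0 < s * (q - 1)" using s(1) False q by simp
    then show ?thesis using s(3)[of q] q False by linarith
  qed
qed

text \<open>For 0 < r < 1 the bound \<open>crit_less_1\<close> keeps the difference quotients below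
  - 1 / (d + 1), so the derivative cannot vanish and 1 / \<Delta> is a genuine reciprocal.\<close>

lemma crit_derivative_neg:
  assumes "(crit has_real_derivative \<Delta>) (at 0)"
  shows "\<Delta> < 0"
proof -
  have lim: "((\<lambda>r. (crit r - 1) / r) \<longlongrightarrow> \<Delta>) (at_right 0)"
    using assms crit_0 unfolding has_field_derivative_iff by (auto intro: tendsto_within_subset)
  have "\<Delta> \<le> - 1 / (real CARD('d) + 1)"
  proof (rule tendsto_upperbound[OF lim])
    show "\<forall>\<^sub>F r in at_right 0. (crit r - 1) / r \<le> - 1 / (real CARD('d) + 1)"
      unfolding eventually_at_right_field
    proof (intro exI[of _ 1] conjI allI impI)
      fix r :: real assume r: "0 < r" "r < 1"
      have "crit r - 1 \<le> real CARD('d) / (real CARD('d) + r) - 1" using crit_less_1[OF r(1)] by simp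
      also have "\<dots> = - r / (real CARD('d) + r)" using r by (simp add: field_simps)
      finally have "(crit r - 1) / r \<le> - r / (real CARD('d) + r) / r" using r by (intro divide_right_mono) auto
      also have "\<dots> = - 1 / (real CARD('d) + r)" using r by simp
      also have "\<dots> \<le> - 1 / (real CARD('d) + 1)" using r by (simp add: frac_le)
      finally show "(crit r - 1) / r \<le> - 1 / (real CARD('d) + 1)" .
    qed simp
  qed simp
  also have "\<dots> < 0" by (simp add: divide_less_0_iff)
  finally show ?thesis .
qed

text \<open>Near \<open>1\<close> the critical exponent inverts \<open>q \<mapsto> \<beta> q / q\<close>, so the two difference quotients are
  reciprocal to each other up to a factor tending to \<open>1\<close>.\<close>

lemma beta_has_derivative:
  assumes "(crit has_real_derivative \<Delta>) (at 0)"
  shows "(\<beta> has_real_derivative 1 / \<Delta>) (at 1)"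
proof -
  have lim: "((\<lambda>r. (crit r - 1) / r) \<longlongrightarrow> \<Delta>) (at 0)"
    using assms crit_0 unfolding has_field_derivative_iff by simp
  have D: "\<Delta> \<noteq> 0" using crit_derivative_neg[OF assms] by simp
  obtain s where s: "0 < s" "ereal s < dim_infty \<nu>" "\<And>r. - s < r \<Longrightarrow> admissible r"
    using dim_infty_pos_real by metis
  have ev: "\<forall>\<^sub>F q in at 1. 0 < q \<and> q \<noteq> (1::real)"
    by (intro eventually_conj eventually_at_ball' order_tendstoD(1)[OF tendsto_ident_at]) (auto simp: eventually_at_filter)
  have "((\<lambda>q. real CARD('d) * \<bar>q - 1\<bar>) \<longlongrightarrow> real CARD('d) * \<bar>1 - 1\<bar>) (at 1)" by (intro tendsto_intros)
  then have "((\<lambda>q. real CARD('d) * \<bar>q - 1\<bar>) \<longlongrightarrow> 0) (at 1)" by simp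
  moreover have "\<forall>\<^sub>F q in at 1. norm (\<beta> q) \<le> real CARD('d) * \<bar>q - 1\<bar>"
    using ev by eventually_elim (simp add: abs_beta_le)
  ultimately have b0: "(\<beta> \<longlongrightarrow> 0) (at 1)" by (rule Lim_null_comparison[rotated])
  then have "((\<lambda>q. \<beta> q / q) \<longlongrightarrow> 0 / 1) (at 1)" by (intro tendsto_intros) auto
  then have r0: "((\<lambda>q. \<beta> q / q) \<longlongrightarrow> 0) (at 1)" by simp
  \<comment> \<open>The limit defining \<Delta> is punctured at 0, so the substituted order must
    avoid 0.\<close>
  have "\<forall>\<^sub>F q in at 1. \<beta> q / q \<noteq> 0"
    using ev by eventually_elim (use beta_nonzero in auto)
  with r0 have fl: "filterlim (\<lambda>q. \<beta> q / q) (at 0) (at 1)" by (simp add: filterlim_at)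
  \<comment> \<open>Orders close to 0 are admissible, as \<open>crit_eqI\<close> requires.\<close>
  have "\<forall>\<^sub>F q in at 1. - s < \<beta> q / q" using r0 s(1) by (intro order_tendstoD(1)) auto
  with ev have inv: "\<forall>\<^sub>F q in at 1. crit (\<beta> q / q) = q"
  proof eventually_elim
    case (elim q)
    have "admissible (\<beta> q / q)" using elim by (intro s(3)) simp
    then show ?case using elim by (intro crit_eqI) auto
  qed
  have "((\<lambda>q. (crit (\<beta> q / q) - 1) / (\<beta> q / q)) \<longlongrightarrow> \<Delta>) (at 1)"
    by (rule filterlim_compose[OF lim fl])
  then have "((\<lambda>q. q / ((crit (\<beta> q / q) - 1) / (\<beta> q / q))) \<longlongrightarrow> 1 / \<Delta>) (at 1)"
    using D by (intro tendsto_intros)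
  moreover have "\<forall>\<^sub>F q in at 1. q / ((crit (\<beta> q / q) - 1) / (\<beta> q / q)) = (\<beta> q - \<beta> 1) / (q - 1)"
    using ev inv by eventually_elim (use beta_nonzero in \<open>auto simp: beta_1\<close>)
  ultimately have "((\<lambda>q. (\<beta> q - \<beta> 1) / (q - 1)) \<longlongrightarrow> 1 / \<Delta>) (at 1)" by (rule Lim_transform_eventually)
  then show ?thesis unfolding has_field_derivative_iff .
qed

lemma dim_of_crit_tendsto:
  assumes "(crit has_real_derivative \<Delta>) (at 0)"
  shows "((\<lambda>r. ereal (dim_of_exponent r (crit r))) \<longlongrightarrow> ereal (- (1 / \<Delta>))) (at 0)"
proof -
  have lim: "((\<lambda>r. (crit r - 1) / r) \<longlongrightarrow> \<Delta>) (at 0)"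
    using assms crit_0 unfolding has_field_derivative_iff by simp
  have D: "\<Delta> \<noteq> 0" using crit_derivative_neg[OF assms] by simp
  have "isCont crit 0" using assms by (rule DERIV_isCont)
  then have c: "(crit \<longlongrightarrow> 1) (at 0)" using crit_0 by (simp add: isCont_def)
  have "((\<lambda>r. - (crit r / ((crit r - 1) / r))) \<longlongrightarrow> - (1 / \<Delta>)) (at 0)"
    using D by (intro tendsto_intros c lim)
  moreover have "- (crit r / ((crit r - 1) / r)) = dim_of_exponent r (crit r)" for r
    unfolding dim_of_exponent_def by (simp add: minus_divide_right)
  ultimately show ?thesis by simp
qed

end

context quantization
begin

lemma quant_dim_0_eq:
  assumes "(crit has_real_derivative \<Delta>) (at 0)"
  shows "lower_quant_dim N \<nu> 0 = ereal (- (1 / \<Delta>))" "upper_quant_dim N \<nu> 0 = ereal (- (1 / \<Delta>))"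
proof -
  note lim = dim_of_crit_tendsto[OF assms]
  have u: "upper_quant_dim N \<nu> 0 \<le> ereal (- (1 / \<Delta>))"
  proof (rule tendsto_lowerbound)
    show "((\<lambda>r. ereal (dim_of_exponent r (crit r))) \<longlongrightarrow> ereal (- (1 / \<Delta>))) (at_right 0)"
      using lim by (rule tendsto_within_subset) simp
    have "upper_quant_dim N \<nu> 0 \<le> ereal (dim_of_exponent r (crit r))" if "0 < r" for r
      using upper_quant_dim_0_le[OF that] upper_quant_dim_eq[OF that] by simp
    then show "\<forall>\<^sub>F r in at_right 0. upper_quant_dim N \<nu> 0 \<le> ereal (dim_of_exponent r (crit r))"
      unfolding eventually_at_right_field by (intro exI[of _ 1]) auto
  qed simp
  obtain s where s: "0 < s" "ereal s < dim_infty \<nu>" "\<And>r. - s < r \<Longrightarrow> admissible r"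
    using dim_infty_pos_real by metis
  have l: "ereal (- (1 / \<Delta>)) \<le> lower_quant_dim N \<nu> 0"
  proof (rule tendsto_upperbound)
    show "((\<lambda>r. ereal (dim_of_exponent r (crit r))) \<longlongrightarrow> ereal (- (1 / \<Delta>))) (at_left 0)"
      using lim by (rule tendsto_within_subset) simp
    have "ereal (dim_of_exponent r (crit r)) \<le> lower_quant_dim N \<nu> 0" if r: "- s < r" "r < 0" for r
    proof -
      have rd: "admissible r" using r by (intro s(3))
      show ?thesis using lower_quant_dim_0_ge[OF r(2) rd] lower_quant_dim_eq[OF r(2) rd] by simp
    qed
    then show "\<forall>\<^sub>F r in at_left 0. ereal (dim_of_exponent r (crit r)) \<le> lower_quant_dim N \<nu> 0"
      unfolding eventually_at_left_field using s(1) by (intro exI[of _ "- s"]) auto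
  qed simp
  have "lower_quant_dim N \<nu> 0 \<le> upper_quant_dim N \<nu> 0"
    unfolding lower_quant_dim_def upper_quant_dim_def by (rule Liminf_le_Limsup) simp
  with u l show "lower_quant_dim N \<nu> 0 = ereal (- (1 / \<Delta>))" "upper_quant_dim N \<nu> 0 = ereal (- (1 / \<Delta>))" by auto
qed

end

section \<open>Hausdorff dimension\<close>

lemma norm_dyadic_cubes_le:
  assumes "Q \<in> dyadic_cubes n" "x \<in> Q" "y \<in> (Q :: (real ^ 'd) set)"
  shows "norm (x - y) \<le> real CARD('d) / 2 ^ n"
proof -
  have "norm (x - y) \<le> (\<Sum>i\<in>UNIV. \<bar>(x - y) $ i\<bar>)" by (rule norm_le_l1_cart)
  also have "\<dots> \<le> (\<Sum>i\<in>(UNIV :: 'd set). 1 / 2 ^ n)"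
    using dyadic_cubes_dist[OF assms] by (intro sum_mono) simp
  finally show ?thesis by simp
qed

lemma bounded_dyadic_cubes:
  assumes "Q \<in> dyadic_cubes n"
  shows "bounded (Q :: (real ^ 'd) set)"
proof -
  obtain x where "x \<in> Q" using dyadic_cubes_nonempty[OF assms] by blast
  then show ?thesis
    using norm_dyadic_cubes_le[OF assms] unfolding bounded_def dist_norm by blast
qed

lemma diameter_dyadic_cubes:
  assumes "Q \<in> dyadic_cubes n"
  shows "diameter (Q :: (real ^ 'd) set) \<le> real CARD('d) / 2 ^ n"
  using norm_dyadic_cubes_le[OF assms] by (intro diameter_le) auto

lemma hausdorff_premeasure_le:
  fixes U :: "nat \<Rightarrow> nat \<Rightarrow> 'a::metric_space set"
  assumes "A \<subseteq> (\<Union>n. \<Union>j. U n j)" "\<And>n j. bounded (U n j)" "\<And>n j. diameter (U n j) \<le> \<delta>"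
  shows "hausdorff_premeasure s \<delta> A \<le> (\<Sum>n. \<Sum>j. ennreal (diameter (U n j) powr s))"
proof -
  define V where "V i = case_prod U (prod_decode i)" for i
  have "A \<subseteq> (\<Union>i. V i)"
  proof
    fix x assume "x \<in> A"
    then obtain n j where "x \<in> U n j" using assms(1) by blast
    then have "x \<in> V (prod_encode (n, j))" unfolding V_def by simp
    then show "x \<in> (\<Union>i. V i)" by blast
  qed
  moreover have "bounded (V i) \<and> diameter (V i) \<le> \<delta>" for i
    unfolding V_def using assms(2,3) by (simp split: prod.split)
  ultimately have "hausdorff_premeasure s \<delta> A \<le> (\<Sum>i. ennreal (diameter (V i) powr s))"
    unfolding hausdorff_premeasure_def by (intro INF_lower) auto
  also have "\<dots> = (\<Sum>i. (\<lambda>(n, j). ennreal (diameter (U n j) powr s)) (prod_decode i))"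
    unfolding V_def by (simp add: case_prod_unfold)
  also have "\<dots> = (\<Sum>n. \<Sum>j. ennreal (diameter (U n j) powr s))"
    by (rule suminf_ennreal_2dimen) simp
  finally show ?thesis .
qed

section \<open>Typical masses of cubes and the two bounds for the Hausdorff dimension\<close>

context quant_measure
begin

text \<open>The exceptional cubes on level \<open>n\<close> have total mass at most
  \<open>2 powr (n * s * t) * moment_sum \<nu> n (1 + t)\<close>, whose sum over \<open>n\<close> is finite.\<close>

lemma AE_cube_moment:
  assumes t: "- 1 \<le> t" "\<beta> (1 + t) < - (s * t)"
  shows "AE x in \<nu>. \<forall>\<^sub>F n in sequentially. x \<in> half_open_unit_cube \<and>
    measure \<nu> (cube_at n x) powr (1 + t) * 2 powr (s * t * real n) < measure \<nu> (cube_at n x)"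
proof -
  \<comment> \<open>Cubes of measure 0 satisfy this inequality and count as exceptional, so the
    cubes around almost every point eventually have positive measure.\<close>
  define G where "G n = {Q \<in> dyadic_cubes n. measure \<nu> Q \<le> measure \<nu> Q powr (1 + t) * 2 powr (s * t * real n)}" for n
  define B where "B n = \<Union>(G n)" for n
  have Bs: "B n \<in> sets \<nu>" for n unfolding B_def G_def
    using sets_nu_cubes by (intro sets.finite_Union) auto
  obtain b where b: "\<beta> (1 + t) < b" "b < - (s * t)" using dense[OF t(2)] by blast
  define y where "y = 2 powr (b + s * t)"
  have y: "0 < y" "y < 1" unfolding y_def using b by (auto intro: powr_less_one)
  have meas: "measure \<nu> (B n) \<le> 2 powr (s * t * real n) * moment_sum \<nu> n (1 + t)" for n
  proof -
    have "measure \<nu> (B n) \<le> (\<Sum>Q\<in>G n. measure \<nu> Q)"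
      unfolding B_def using sets_nu_cubes
      by (intro measure_Union_le) (auto simp: G_def)
    also have "\<dots> \<le> (\<Sum>Q\<in>G n. 2 powr (s * t * real n) * measure \<nu> Q powr (1 + t))"
      by (intro sum_mono) (auto simp: G_def mult.commute)
    also have "\<dots> \<le> (\<Sum>Q\<in>dyadic_cubes n. 2 powr (s * t * real n) * measure \<nu> Q powr (1 + t))"
      by (intro sum_mono2) (auto simp: G_def)
    finally show ?thesis unfolding moment_sum_def by (simp add: sum_distrib_left)
  qed
  have "\<forall>\<^sub>F n in sequentially. norm (measure \<nu> (B n)) \<le> y ^ n"
  proof -
    have "0 \<le> 1 + t" using t by simp
    from moment_sum_le[OF this b(1)] show ?thesis
    proof eventually_elim
      case (elim n)
      have "measure \<nu> (B n) \<le> 2 powr (s * t * real n) * 2 powr (b * real n)"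
        using elim by (intro order_trans[OF meas] mult_left_mono) auto
      also have "\<dots> = 2 powr ((b + s * t) * real n)" by (simp add: powr_add[symmetric] algebra_simps)
      also have "\<dots> = y ^ n" unfolding y_def by (simp add: powr_power mult.commute)
      finally show ?case by simp
    qed
  qed
  then have "summable (\<lambda>n. measure \<nu> (B n))"
    by (rule summable_comparison_test_ev) (use y in \<open>auto intro: summable_geometric\<close>)
  then have "AE x in \<nu>. \<forall>\<^sub>F n in sequentially. x \<in> space \<nu> - B n"
    using Bs by (intro borel_cantelli_AE1) (auto simp: emeasure_eq_measure)
  then show ?thesis using AE_unit_cube
  proof eventually_elim
    case (elim x)
    from elim(1) show ?case
    proof eventually_elim
      case (elim n)
      then have "cube_at n x \<notin> G n" using mem_cube_at[of x n] unfolding B_def by blast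
      then show ?case using \<open>x \<in> half_open_unit_cube\<close> cube_at_in_dyadic_cubes[of x n] unfolding G_def by auto
    qed
  qed
qed

lemma difference_quotient_beta:
  assumes "(\<beta> has_real_derivative \<beta>') (at 1)"
  shows "((\<lambda>t. \<beta> (1 + t) / t) \<longlongrightarrow> \<beta>') (at 0)"
  using assms beta_1 by (simp add: DERIV_def)

text \<open>With t > 0, dividing the strict inequality by the mass m > 0 leaves m powr t < 2 powr (-
  (s t n)), hence m < 2 powr (- (s n)). In \<open>AE_measure_cube_ge\<close> a negative t reverses
  the last step.\<close>

lemma AE_measure_cube_le:
  assumes "(\<beta> has_real_derivative \<beta>') (at 1)" "s < - \<beta>'"
  shows "AE x in \<nu>. \<forall>\<^sub>F n in sequentially. x \<in> half_open_unit_cube \<and> measure \<nu> (cube_at n x) \<le> 2 powr (- (s * real n))"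
proof -
  have "\<forall>\<^sub>F t in at_right 0. \<beta> (1 + t) / t < - s"
    using tendsto_within_subset[OF difference_quotient_beta[OF assms(1)], of "{0<..}"] assms(2)
    by (intro order_tendstoD(2)) auto
  then obtain t where t: "0 < t" "\<beta> (1 + t) / t < - s"
    unfolding eventually_at_right_field using dense by (metis (no_types, opaque_lifting))
  then have "\<beta> (1 + t) < - (s * t)" by (simp add: divide_less_eq)
  with t(1) have "AE x in \<nu>. \<forall>\<^sub>F n in sequentially. x \<in> half_open_unit_cube \<and>
    measure \<nu> (cube_at n x) powr (1 + t) * 2 powr (s * t * real n) < measure \<nu> (cube_at n x)"
    by (intro AE_cube_moment) auto
  then show ?thesis
  proof (rule eventually_mono, elim eventually_mono)
    fix x n
    define m where "m = measure \<nu> (cube_at n x)"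
    assume elim: "x \<in> half_open_unit_cube \<and>
      measure \<nu> (cube_at n x) powr (1 + t) * 2 powr (s * t * real n) < measure \<nu> (cube_at n x)"
    have "m \<le> 2 powr (- (s * real n))"
    proof (rule ccontr)
      assume c: "\<not> ?thesis"
      then have m: "0 < m" by (smt (verit) powr_gt_zero)
      have "(2 powr (- (s * real n))) powr t \<le> m powr t" using c t(1) by (intro powr_mono2) auto
      then have "2 powr (- (s * t * real n)) \<le> m powr t" by (simp add: powr_powr mult_ac)
      then have "1 \<le> m powr t * 2 powr (s * t * real n)" by (simp add: powr_minus field_simps)
      then have "m * 1 \<le> m * (m powr t * 2 powr (s * t * real n))" using m by (intro mult_left_mono) auto
      also have "\<dots> = m powr (1 + t) * 2 powr (s * t * real n)" using m by (simp add: powr_add)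
      finally show False using elim unfolding m_def by simp
    qed
    with elim show "x \<in> half_open_unit_cube \<and> measure \<nu> (cube_at n x) \<le> 2 powr (- (s * real n))"
      unfolding m_def by simp
  qed
qed

lemma AE_measure_cube_ge:
  assumes "(\<beta> has_real_derivative \<beta>') (at 1)" "- \<beta>' < s"
  shows "AE x in \<nu>. \<forall>\<^sub>F n in sequentially. x \<in> half_open_unit_cube \<and> 2 powr (- (s * real n)) \<le> measure \<nu> (cube_at n x)"
proof -
  have "\<forall>\<^sub>F t in at_left 0. - s < \<beta> (1 + t) / t"
    using tendsto_within_subset[OF difference_quotient_beta[OF assms(1)], of "{..<0}"] assms(2)
    by (intro order_tendstoD(1)) auto
  then obtain e where e: "e < 0" "\<And>t. e < t \<Longrightarrow> t < 0 \<Longrightarrow> - s < \<beta> (1 + t) / t"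
    unfolding eventually_at_left_field by blast
  \<comment> \<open>The bound - 1 keeps the exponent 1 + t nonnegative, where \<beta> is
    controlled.\<close>
  define t where "t = max (e / 2) (- 1)"
  have t: "t < 0" "- 1 \<le> t" "- s < \<beta> (1 + t) / t" unfolding t_def using e(1) by (auto intro!: e(2))
  then have "\<beta> (1 + t) < - (s * t)" by (simp add: less_divide_eq)
  with t have "AE x in \<nu>. \<forall>\<^sub>F n in sequentially. x \<in> half_open_unit_cube \<and>
    measure \<nu> (cube_at n x) powr (1 + t) * 2 powr (s * t * real n) < measure \<nu> (cube_at n x)"
    by (intro AE_cube_moment) auto
  then show ?thesis
  proof (rule eventually_mono, elim eventually_mono)
    fix x n
    define m where "m = measure \<nu> (cube_at n x)"
    assume elim: "x \<in> half_open_unit_cube \<and>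
      measure \<nu> (cube_at n x) powr (1 + t) * 2 powr (s * t * real n) < measure \<nu> (cube_at n x)"
    have "2 powr (- (s * real n)) \<le> m"
    proof (rule ccontr)
      assume c: "\<not> ?thesis"
      have "0 \<le> m powr (1 + t) * 2 powr (s * t * real n)" by simp
      then have m: "0 < m" using elim unfolding m_def by linarith
      have "(2 powr (- (s * real n))) powr t \<le> m powr t" using c m t(1) by (intro powr_mono2') auto
      then have "2 powr (- (s * t * real n)) \<le> m powr t" by (simp add: powr_powr mult_ac)
      then have "1 \<le> m powr t * 2 powr (s * t * real n)" by (simp add: powr_minus field_simps)
      then have "m * 1 \<le> m * (m powr t * 2 powr (s * t * real n))" using m by (intro mult_left_mono) auto
      also have "\<dots> = m powr (1 + t) * 2 powr (s * t * real n)" using m by (simp add: powr_add)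
      finally show False using elim unfolding m_def by simp
    qed
    with elim show "x \<in> half_open_unit_cube \<and> 2 powr (- (s * real n)) \<le> measure \<nu> (cube_at n x)"
      unfolding m_def by simp
  qed
qed

lemma sets_cube_condition:
  "{x \<in> half_open_unit_cube. R (cube_at n x)} \<in> sets \<nu>"
proof -
  have "{x \<in> half_open_unit_cube. R (cube_at n x)} = \<Union>{Q \<in> dyadic_cubes n. R Q}"
  proof (intro equalityI subsetI)
    fix x assume "x \<in> {x \<in> half_open_unit_cube. R (cube_at n x)}"
    then show "x \<in> \<Union>{Q \<in> dyadic_cubes n. R Q}"
      using cube_at_in_dyadic_cubes[of x n] mem_cube_at[of x n] by blast
  next
    fix x assume "x \<in> \<Union>{Q \<in> dyadic_cubes n. R Q}"
    then obtain Q where Q: "Q \<in> dyadic_cubes n" "R Q" "x \<in> Q" by blast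
    then show "x \<in> {x \<in> half_open_unit_cube. R (cube_at n x)}"
      using dyadic_cube_eq_cube_at[OF Q(1,3)] dyadic_cubes_subset[OF Q(1)] by auto
  qed
  also have "\<dots> \<in> sets \<nu>" using sets_nu_cubes by (intro sets.finite_Union) auto
  finally show ?thesis .
qed

lemma sets_INT_cube_condition:
  "(\<Inter>n\<in>{k..}. {x \<in> half_open_unit_cube. R n (cube_at n x)}) \<in> sets \<nu>"
  by (rule sets.countable_INT') (auto intro: sets_cube_condition)

lemma card_heavy_cubes:
  "real (card {Q \<in> dyadic_cubes n. 2 powr (- (s * real n)) \<le> measure \<nu> Q}) \<le> 2 powr (s * real n)"
proof -
  let ?H = "{Q \<in> dyadic_cubes n. 2 powr (- (s * real n)) \<le> measure \<nu> Q}"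
  have "real (card ?H) * 2 powr (- (s * real n)) = (\<Sum>Q\<in>?H. 2 powr (- (s * real n)))" by simp
  also have "\<dots> \<le> (\<Sum>Q\<in>?H. measure \<nu> Q)" by (intro sum_mono) auto
  also have "\<dots> \<le> (\<Sum>Q\<in>dyadic_cubes n. measure \<nu> Q)" by (intro sum_mono2) auto
  also have "\<dots> = 1" by (rule sum_measure_cubes)
  finally show ?thesis by (simp add: powr_minus field_simps)
qed

text \<open>Level n has at most 2 powr (s' n) heavy cubes of diameter at most d / 2 ^ n, so it
  contributes at most d powr s * y ^ (2 n). The number y is a square root on purpose: one factor y ^
  n is summed, the other yields the smallness y ^ n1.\<close>

lemma hausdorff_premeasure_heavy_le:
  assumes s: "0 < s'" "s' < s" and n1: "real CARD('d) / 2 ^ n1 \<le> \<delta>" and \<delta>: "0 < \<delta>"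
    and A: "\<And>x. x \<in> A \<Longrightarrow> \<exists>n\<ge>n1. x \<in> half_open_unit_cube \<and> 2 powr (- (s' * real n)) \<le> measure \<nu> (cube_at n x)"
    and y_def: "y = 2 powr (- ((s - s') / 2))"
  shows "hausdorff_premeasure s \<delta> A \<le> ennreal (real CARD('d) powr s / (1 - y) * y ^ n1)"
proof -
  define H where "H n = {Q \<in> dyadic_cubes n. 2 powr (- (s' * real n)) \<le> measure \<nu> Q}" for n
  have finH: "finite (H n)" for n unfolding H_def by simp
  have "\<exists>h. bij_betw h {0..<card (H n)} (H n)" for n by (rule ex_bij_betw_nat_finite[OF finH])
  then obtain h where h: "\<And>n. bij_betw (h n) {0..<card (H n)} (H n)" by metis
  \<comment> \<open>Earlier levels and surplus indices are filled with the empty set, whose diameter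
    0 adds \<open>0 powr s = 0\<close>.\<close>
  define U where "U n j = (if n1 \<le> n \<and> j < card (H n) then h n j else {})" for n j
  have hH: "h n j \<in> H n" if "j < card (H n)" for n j using h[of n] that by (auto simp: bij_betw_def)
  have hD: "h n j \<in> dyadic_cubes n" if "j < card (H n)" for n j using hH[OF that] unfolding H_def by simp
  have y: "0 < y" "y < 1" unfolding y_def using s by (auto intro: powr_less_one)
  have dm: "0 \<le> diameter (h n j)" if "j < card (H n)" for n j
    using bounded_dyadic_cubes[OF hD[OF that]] by (rule diameter_ge_0)
  have "hausdorff_premeasure s \<delta> A \<le> (\<Sum>n. \<Sum>j. ennreal (diameter (U n j) powr s))"
  proof (rule hausdorff_premeasure_le)
    show "A \<subseteq> (\<Union>n. \<Union>j. U n j)"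
    proof
      fix x assume "x \<in> A"
      from A[OF this] obtain n where n: "n1 \<le> n" "x \<in> half_open_unit_cube" "2 powr (- (s' * real n)) \<le> measure \<nu> (cube_at n x)"
        by blast
      then have "cube_at n x \<in> H n" unfolding H_def using cube_at_in_dyadic_cubes[OF n(2)] by simp
      then have "cube_at n x \<in> h n ` {0..<card (H n)}" using h[of n] by (simp add: bij_betw_def)
      then obtain j where j: "j < card (H n)" "h n j = cube_at n x" by auto
      then have "x \<in> U n j" unfolding U_def using n(1) mem_cube_at[of x n] by simp
      then show "x \<in> (\<Union>n. \<Union>j. U n j)" by blast
    qed
    show "bounded (U n j)" for n j unfolding U_def using bounded_dyadic_cubes[OF hD] by simp
    show "diameter (U n j) \<le> \<delta>" for n j
    proof (cases "n1 \<le> n \<and> j < card (H n)")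
      case True
      then have "diameter (U n j) \<le> real CARD('d) / 2 ^ n" unfolding U_def using diameter_dyadic_cubes[OF hD] by simp
      also have "\<dots> \<le> real CARD('d) / 2 ^ n1" using True by (intro divide_left_mono power_increasing) auto
      finally show ?thesis using n1 by simp
    next
      case False
      then have "U n j = {}" unfolding U_def by auto
      then show ?thesis using \<delta> by simp
    qed
  qed
  also have "\<dots> \<le> (\<Sum>n. ennreal (real CARD('d) powr s * y ^ n1 * y ^ n))"
  proof (rule suminf_le)
    fix n
    have "(\<Sum>j. ennreal (diameter (U n j) powr s)) = (\<Sum>j\<in>{..<card (H n)}. ennreal (diameter (U n j) powr s))"
      by (rule suminf_finite) (auto simp: U_def)
    also have "\<dots> \<le> ennreal (real CARD('d) powr s * y ^ n1 * y ^ n)"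
    proof (cases "n1 \<le> n")
      case False
      then show ?thesis unfolding U_def by simp
    next
      case True
      have "(\<Sum>j\<in>{..<card (H n)}. ennreal (diameter (U n j) powr s)) \<le> (\<Sum>j\<in>{..<card (H n)}. ennreal ((real CARD('d) / 2 ^ n) powr s))"
      proof (intro sum_mono ennreal_leI powr_mono2)
        fix j assume "j \<in> {..<card (H n)}"
        then have j: "j < card (H n)" by simp
        show "0 \<le> diameter (U n j)" using dm[OF j] j True unfolding U_def by simp
        show "diameter (U n j) \<le> real CARD('d) / 2 ^ n" using diameter_dyadic_cubes[OF hD[OF j]] j True unfolding U_def by simp
      qed (use s in simp)
      also have "\<dots> = ennreal (real (card (H n)) * (real CARD('d) / 2 ^ n) powr s)"
        by (simp add: ennreal_mult ennreal_of_nat_eq_real_of_nat)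
      also have "\<dots> \<le> ennreal (2 powr (s' * real n) * (real CARD('d) / 2 ^ n) powr s)"
        using card_heavy_cubes[of n s'] unfolding H_def by (intro ennreal_leI mult_right_mono) auto
      also have "\<dots> \<le> ennreal (real CARD('d) powr s * y ^ n1 * y ^ n)"
      proof (rule ennreal_leI)
        have "2 powr (s' * real n) * (real CARD('d) / 2 ^ n) powr s = real CARD('d) powr s * 2 powr (- ((s - s') * real n))"
          by (subst divide_two_power_powr) (auto simp: powr_add[symmetric] algebra_simps)
        also have "2 powr (- ((s - s') * real n)) = y ^ n * y ^ n"
          unfolding y_def by (simp add: powr_power powr_add[symmetric] algebra_simps add_divide_distrib[symmetric] diff_divide_distrib[symmetric])
        also have "\<dots> \<le> y ^ n1 * y ^ n" using y True by (intro mult_right_mono power_decreasing) auto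
        finally show "2 powr (s' * real n) * (real CARD('d) / 2 ^ n) powr s \<le> real CARD('d) powr s * y ^ n1 * y ^ n"
          by (simp add: mult.assoc mult_left_mono)
      qed
      finally show ?thesis .
    qed
    finally show "(\<Sum>j. ennreal (diameter (U n j) powr s)) \<le> ennreal (real CARD('d) powr s * y ^ n1 * y ^ n)" .
  qed auto
  also have "\<dots> = ennreal (\<Sum>n. real CARD('d) powr s * y ^ n1 * y ^ n)"
    using y by (intro suminf_ennreal2) (auto intro!: summable_mult summable_geometric)
  also have "(\<Sum>n. real CARD('d) powr s * y ^ n1 * y ^ n) = real CARD('d) powr s / (1 - y) * y ^ n1"
    using y by (simp add: suminf_mult summable_geometric suminf_geometric)
  finally show ?thesis .
qed

text \<open>For s' slightly above - \<beta>' the points whose cubes are eventually heavy have full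
  measure. Covering them from ever deeper levels makes the s-premeasure vanish for every
  \<delta>.\<close>

lemma hausdorff_dim_measure_le:
  assumes d: "(\<beta> has_real_derivative \<beta>') (at 1)" and pos: "0 \<le> - \<beta>'"
  shows "hausdorff_dim_measure \<nu> \<le> ereal (- \<beta>')"
proof (rule dense_ge)
  fix z assume z: "ereal (- \<beta>') < z"
  show "hausdorff_dim_measure \<nu> \<le> z"
  proof (cases z)
    case (real s)
    then have "- \<beta>' < s" using z by simp
    then obtain s' where s': "- \<beta>' < s'" "s' < s" using dense by blast
    define A where "A = {x. \<exists>k. \<forall>n\<ge>k. x \<in> half_open_unit_cube \<and> 2 powr (- (s' * real n)) \<le> measure \<nu> (cube_at n x)}"
    have "A = (\<Union>k. \<Inter>n\<in>{k..}. {x \<in> half_open_unit_cube. 2 powr (- (s' * real n)) \<le> measure \<nu> (cube_at n x)})"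
      unfolding A_def
      by (rule set_eqI) (simp only: mem_Collect_eq UN_iff INT_iff atLeast_iff bex_UNIV Ball_def)
    also have "\<dots> \<in> sets \<nu>"
      by (intro sets.countable_UN image_subsetI
          sets_INT_cube_condition[where R="\<lambda>n Q. 2 powr (- (s' * real n)) \<le> measure \<nu> Q"])
    finally have As: "A \<in> sets \<nu>" .
    have "AE x in \<nu>. x \<in> A"
      using AE_measure_cube_ge[OF d s'(1)] unfolding A_def eventually_sequentially by simp
    then have "measure \<nu> A = 1" by (simp only: prob_eq_1[OF As])
    then have "emeasure \<nu> A = 1" by (simp add: emeasure_eq_measure)
    then have A1: "A \<in> {A \<in> sets borel. emeasure \<nu> A > 0}" using As sets_nu by simp
    have s0: "0 < s'" using pos s' by simp
    define y where "y = 2 powr (- ((s - s') / 2))"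
    have y: "0 < y" "y < 1" unfolding y_def using s' by (auto intro: powr_less_one)
    have pre: "hausdorff_premeasure s \<delta> A = 0" if \<delta>: "0 < \<delta>" for \<delta>
    proof -
      have "(\<lambda>n. real CARD('d) * (1 / 2) ^ n) \<longlonglongrightarrow> real CARD('d) * 0"
        by (intro tendsto_intros LIMSEQ_power_zero) auto
      then have "\<forall>\<^sub>F n in sequentially. real CARD('d) * (1 / 2) ^ n < \<delta>" using \<delta> by (intro order_tendstoD(2)) auto
      then have "\<forall>\<^sub>F n in sequentially. hausdorff_premeasure s \<delta> A \<le> ennreal (real CARD('d) powr s / (1 - y) * y ^ n)"
      proof eventually_elim
        case (elim n)
        have "real CARD('d) / 2 ^ n \<le> \<delta>" using elim by (simp add: power_divide)
        then show ?case
        proof (rule hausdorff_premeasure_heavy_le[OF s0 s'(2) _ \<delta> _ y_def])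
          fix x assume "x \<in> A"
          then obtain k where "\<forall>n\<ge>k. x \<in> half_open_unit_cube \<and> 2 powr (- (s' * real n)) \<le> measure \<nu> (cube_at n x)"
            unfolding A_def by blast
          then have "x \<in> half_open_unit_cube \<and> 2 powr (- (s' * real (max n k))) \<le> measure \<nu> (cube_at (max n k) x)"
            by (meson max.cobounded2)
          then show "\<exists>m\<ge>n. x \<in> half_open_unit_cube \<and> 2 powr (- (s' * real m)) \<le> measure \<nu> (cube_at m x)"
            by (intro exI[of _ "max n k"] conjI max.cobounded1) auto
        qed
      qed
      moreover have "(\<lambda>n. ennreal (real CARD('d) powr s / (1 - y) * y ^ n)) \<longlonglongrightarrow> ennreal (real CARD('d) powr s / (1 - y) * 0)"
        using y by (intro tendsto_intros LIMSEQ_power_zero) auto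
      ultimately have "hausdorff_premeasure s \<delta> A \<le> ennreal (real CARD('d) powr s / (1 - y) * 0)"
        by (intro tendsto_lowerbound) auto
      then show ?thesis by simp
    qed
    then have "hausdorff_measure s A = 0" unfolding hausdorff_measure_def by simp
    then have "hausdorff_dim A \<le> ereal s" unfolding hausdorff_dim_def using s0 s' by (intro INF_lower) auto
    moreover have "hausdorff_dim_measure \<nu> \<le> hausdorff_dim A"
      unfolding hausdorff_dim_measure_def using A1 by (rule INF_lower)
    ultimately show ?thesis unfolding real by simp
  qed (use z in auto)
qed

text \<open>Mass distribution principle: a set of diameter comparable to \<open>2 ^ - k\<close> meets boundedly many
  cubes of level \<open>k\<close>.\<close>

lemma mass_distribution_cover:
  assumes s: "0 < s" and E: "\<And>x n. x \<in> E \<Longrightarrow> n0 \<le> n \<Longrightarrow> x \<in> half_open_unit_cube \<and> measure \<nu> (cube_at n x) \<le> 2 powr (- (s * real n))"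
    and V: "bounded V" "diameter V \<le> 1 / 2 ^ Suc n0"
  shows "\<exists>W\<in>sets \<nu>. V \<inter> E \<subseteq> W \<and> measure \<nu> W \<le> 4 ^ CARD('d) * 2 powr s * diameter V powr s"
proof (cases "V \<inter> E = {}")
  case True
  then show ?thesis by (intro bexI[of _ "{}"]) auto
next
  case False
  then obtain p where p: "p \<in> V" "p \<in> E" by blast
  have dist: "dist x p \<le> diameter V" if "x \<in> V" for x using diameter_bounded_bound[OF V(1) that p(1)] .
  show ?thesis
  \<comment> \<open>For diameter 0 the bound is \<open>0 powr s = 0\<close>, so V must be caught by
    a null set; absence of atoms provides it.\<close>
  proof (cases "diameter V = 0")
    case True
    then have "V \<inter> E \<subseteq> {p}" using dist by fastforce
    moreover have "{p} \<in> sets \<nu>" using sets_nu by simp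
    ultimately show ?thesis using measure_singleton[of p] by (intro bexI[of _ "{p}"]) auto
  next
    case False
    define \<rho> where "\<rho> = diameter V"
    have \<rho>: "0 < \<rho>" using False diameter_ge_0[OF V(1)] unfolding \<rho>_def by simp
    have "(1::real) / 2 ^ Suc n0 < 1 / 2 ^ n0" by (intro divide_strict_left_mono) auto
    then have "\<rho> < 1 / 2 ^ n0" using V(2) unfolding \<rho>_def by linarith
    from dyadic_scale[OF \<rho> zero_less_one this] obtain k where k: "n0 \<le> k" "1 / 2 ^ Suc k \<le> \<rho>" "\<rho> < 1 / 2 ^ k" by metis
    define F where "F = {Q \<in> near_cubes k p. measure \<nu> Q \<le> 2 powr (- (s * real k))}"
    have finF: "finite F" unfolding F_def by (rule finite_subset[OF _ card_near_cubes(1)[of k p]]) blast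
    have FD: "Q \<in> dyadic_cubes k" if "Q \<in> F" for Q using that unfolding F_def near_cubes_def by simp
    have cF: "card F \<le> 4 ^ CARD('d)"
      unfolding F_def by (rule order_trans[OF card_mono[OF card_near_cubes(1)] card_near_cubes(2)]) blast
    have "V \<inter> E \<subseteq> \<Union>F"
    proof
      fix x assume x: "x \<in> V \<inter> E"
      have "\<bar>x $ i - p $ i\<bar> < 1 / 2 ^ k" for i
      proof -
        have "\<bar>(x - p) $ i\<bar> \<le> norm (x - p)" by (rule component_le_norm_cart)
        also have "\<dots> \<le> \<rho>" using dist[of x] x unfolding \<rho>_def dist_norm by simp
        finally show ?thesis using k(3) by simp
      qed
      moreover have "cube_at k x \<in> dyadic_cubes k" "measure \<nu> (cube_at k x) \<le> 2 powr (- (s * real k))"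
        using E[of x k] x k(1) cube_at_in_dyadic_cubes by auto
      ultimately have "cube_at k x \<in> F" unfolding F_def near_cubes_def using mem_cube_at[of x k] by blast
      then show "x \<in> \<Union>F" using mem_cube_at[of x k] by blast
    qed
    moreover have "\<Union>F \<in> sets \<nu>" using finF FD sets_nu_cubes by (intro sets.finite_Union) auto
    moreover have "measure \<nu> (\<Union>F) \<le> 4 ^ CARD('d) * 2 powr s * \<rho> powr s"
    proof -
      have "measure \<nu> (\<Union>F) \<le> (\<Sum>Q\<in>F. measure \<nu> Q)" using finF FD sets_nu_cubes by (intro measure_Union_le) auto
      also have "\<dots> \<le> (\<Sum>Q\<in>F. 2 powr (- (s * real k)))" unfolding F_def by (intro sum_mono) auto
      also have "\<dots> = real (card F) * 2 powr (- (s * real k))" by simp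
      also have "\<dots> \<le> 4 ^ CARD('d) * 2 powr (- (s * real k))"
        using of_nat_mono[OF cF, where 'a=real] by (intro mult_right_mono) auto
      \<comment> \<open>The side 2 ^ (- k) is twice the lower end of the dyadic range of \<rho>,
        hence the factor 2 powr s.\<close>
      also have "2 powr (- (s * real k)) = (2 * (1 / 2 ^ Suc k)) powr s"
      proof -
        have "1 / 2 ^ k = (2::real) powr (- real k)" by (simp add: powr_minus powr_realpow divide_inverse)
        then have "2 * (1 / 2 ^ Suc k) = (2::real) powr (- real k)" by simp
        then show ?thesis by (simp only: powr_powr) (simp add: mult.commute)
      qed
      also have "\<dots> \<le> (2 * \<rho>) powr s" using k(2) s by (intro powr_mono2) auto
      also have "\<dots> = 2 powr s * \<rho> powr s" by (simp add: powr_mult)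
      finally show ?thesis by (simp add: mult.assoc)
    qed
    ultimately show ?thesis unfolding \<rho>_def by blast
  qed
qed

text \<open>Suppose s < - \<beta>'. Some part E k of A, on which the cube bound holds from level k
  on, has positive measure. Every cover of A by sets of diameter at most 1 / 2 ^ (k + 1) covers E k,
  so its s-sum is at least \<nu>(E k) / C, which contradicts vanishing s-measure.\<close>

lemma hausdorff_dim_measure_ge:
  assumes d: "(\<beta> has_real_derivative \<beta>') (at 1)"
  shows "ereal (- \<beta>') \<le> hausdorff_dim_measure \<nu>"
  unfolding hausdorff_dim_measure_def
proof (rule INF_greatest)
  fix A :: "(real ^ 'd) set" assume A: "A \<in> {A \<in> sets borel. emeasure \<nu> A > 0}"
  then have As: "A \<in> sets \<nu>" and Apos: "0 < emeasure \<nu> A" using sets_nu by auto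
  show "ereal (- \<beta>') \<le> hausdorff_dim A"
    unfolding hausdorff_dim_def
  proof (rule INF_greatest)
    fix s assume "s \<in> {s. s > 0 \<and> hausdorff_measure s A = 0}"
    then have s: "0 < s" "hausdorff_measure s A = 0" by auto
    show "ereal (- \<beta>') \<le> ereal s"
    proof (rule ccontr)
      assume "\<not> ?thesis"
      then have "s < - \<beta>'" by simp
      from AE_measure_cube_le[OF d this]
      have ae: "AE x in \<nu>. \<forall>\<^sub>F n in sequentially. x \<in> half_open_unit_cube \<and> measure \<nu> (cube_at n x) \<le> 2 powr (- (s * real n))" .
      define E where "E k = A \<inter> (\<Inter>n\<in>{k..}. {x \<in> half_open_unit_cube. measure \<nu> (cube_at n x) \<le> 2 powr (- (s * real n))})" for k
      have Es: "E k \<in> sets \<nu>" for k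
        unfolding E_def by (rule sets.Int[OF As sets_INT_cube_condition[where R="\<lambda>n Q. measure \<nu> Q \<le> 2 powr (- (s * real n))"]])
      have "\<exists>k. emeasure \<nu> (E k) \<noteq> 0"
      proof (rule ccontr)
        assume "\<not> ?thesis"
        then have "\<And>k. AE x in \<nu>. x \<notin> E k" using Es by (intro AE_not_in) (auto simp: null_sets_def)
        then have "AE x in \<nu>. \<forall>k. x \<notin> E k" by (simp add: AE_all_countable)
        with ae have "AE x in \<nu>. x \<notin> A"
        proof eventually_elim
          case (elim x)
          from elim(1) obtain k where "\<forall>n\<ge>k. x \<in> half_open_unit_cube \<and> measure \<nu> (cube_at n x) \<le> 2 powr (- (s * real n))"
            unfolding eventually_sequentially by blast
          with elim(2) show ?case unfolding E_def by auto
        qed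
        then have "emeasure \<nu> A = 0" using As by (subst (asm) AE_iff_measurable[where N=A]) (auto dest: sets.sets_into_space)
        with Apos show False by simp
      qed
      then obtain k where k: "emeasure \<nu> (E k) \<noteq> 0" by blast
      define C where "C = 4 ^ CARD('d) * 2 powr s"
      have C: "0 < C" unfolding C_def by simp
      have "emeasure \<nu> (E k) / ennreal C \<le> hausdorff_premeasure s (1 / 2 ^ Suc k) A"
        unfolding hausdorff_premeasure_def
      proof (rule INF_greatest)
        fix U :: "nat \<Rightarrow> (real ^ 'd) set"
        assume "U \<in> {U. A \<subseteq> (\<Union>i. U i) \<and> (\<forall>i. bounded (U i) \<and> diameter (U i) \<le> 1 / 2 ^ Suc k)}"
        then have U: "A \<subseteq> (\<Union>i. U i)" "\<And>i. bounded (U i)" "\<And>i. diameter (U i) \<le> 1 / 2 ^ Suc k" by auto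
        \<comment> \<open>The members of a cover may fail to be measurable, so their traces on E k
          are enclosed in measurable sets before subadditivity is applied.\<close>
        have cov: "\<exists>W\<in>sets \<nu>. U i \<inter> E k \<subseteq> W \<and> measure \<nu> W \<le> C * diameter (U i) powr s" for i
          unfolding C_def
        proof (rule mass_distribution_cover[OF s(1) _ U(2,3)])
          fix x n assume "x \<in> E k" "k \<le> n"
          then show "x \<in> half_open_unit_cube \<and> measure \<nu> (cube_at n x) \<le> 2 powr (- (s * real n))"
            unfolding E_def by simp
        qed
        have "\<forall>i. \<exists>W. W \<in> sets \<nu> \<and> U i \<inter> E k \<subseteq> W \<and> measure \<nu> W \<le> C * diameter (U i) powr s"
          by (rule allI, rule cov[unfolded Bex_def])
        then have "\<exists>W. \<forall>i. W i \<in> sets \<nu> \<and> U i \<inter> E k \<subseteq> W i \<and> measure \<nu> (W i) \<le> C * diameter (U i) powr s"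
          by (rule choice)
        then obtain W where W_all: "\<forall>i. W i \<in> sets \<nu> \<and> U i \<inter> E k \<subseteq> W i \<and> measure \<nu> (W i) \<le> C * diameter (U i) powr s"
          by (rule exE)
        then have W: "\<And>i. W i \<in> sets \<nu>" "\<And>i. U i \<inter> E k \<subseteq> W i" "\<And>i. measure \<nu> (W i) \<le> C * diameter (U i) powr s"
          by simp_all
        have "E k \<subseteq> (\<Union>i. W i)"
        proof
          fix x assume x: "x \<in> E k"
          then have "x \<in> A" unfolding E_def by (rule IntD1)
          then obtain i where "x \<in> U i" using U(1) by blast
          then have "x \<in> W i" using W(2)[of i] x by blast
          then show "x \<in> (\<Union>i. W i)" by blast
        qed
        then have "emeasure \<nu> (E k) \<le> emeasure \<nu> (\<Union>i. W i)" using W(1) by (intro emeasure_mono) auto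
        also have "\<dots> \<le> (\<Sum>i. emeasure \<nu> (W i))" using W(1) by (intro emeasure_subadditive_countably) auto
        also have "\<dots> \<le> (\<Sum>i. ennreal C * ennreal (diameter (U i) powr s))"
        proof (intro suminf_le)
          fix i
          have "emeasure \<nu> (W i) \<le> ennreal (C * diameter (U i) powr s)"
            unfolding emeasure_eq_measure by (intro ennreal_leI W(3))
          then show "emeasure \<nu> (W i) \<le> ennreal C * ennreal (diameter (U i) powr s)" using C by (simp add: ennreal_mult)
        qed auto
        also have "\<dots> = ennreal C * (\<Sum>i. ennreal (diameter (U i) powr s))" by (rule ennreal_suminf_cmult)
        finally have le: "emeasure \<nu> (E k) \<le> ennreal C * (\<Sum>i. ennreal (diameter (U i) powr s))" .
        show "emeasure \<nu> (E k) / ennreal C \<le> (\<Sum>i. ennreal (diameter (U i) powr s))"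
          using divide_right_mono_ennreal[OF le, of "ennreal C"] C
          by (simp add: ennreal_times_divide[symmetric] mult.commute[of "ennreal C"] ennreal_mult_divide_eq)
      qed
      also have "\<dots> \<le> hausdorff_measure s A"
        unfolding hausdorff_measure_def by (intro SUP_upper) simp
      finally have "emeasure \<nu> (E k) / ennreal C \<le> 0" using s(2) by simp
      then show False using k C by (simp add: ennreal_divide_eq_0_iff)
    qed
  qed
qed

end

section \<open>The main theorem\<close>

context quantization
begin

lemma quantization_order_zero:
  assumes "ereal_has_derivative_at (crit_exp \<nu>) \<Delta> 0"
  shows "\<exists>\<beta>'. ereal_has_derivative_at (Lq_spectrum \<nu>) \<beta>' 1 \<and>
           lower_quant_dim N \<nu> 0 = upper_quant_dim N \<nu> 0 \<and>
           upper_quant_dim N \<nu> 0 = ereal (- \<beta>') \<and>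
           hausdorff_dim_measure \<nu> = ereal (- \<beta>')"
proof -
  have c: "(crit has_real_derivative \<Delta>) (at 0)"
    using assms unfolding ereal_has_derivative_at_def crit_def by (simp add: crit_def[abs_def])
  have b: "(\<beta> has_real_derivative 1 / \<Delta>) (at 1)" by (rule beta_has_derivative[OF c])
  have "\<forall>\<^sub>F q in nhds 1. 0 < (q::real)" using eventually_nhds_in_open[of "{0<..}" "1::real"] by simp
  then have "\<forall>\<^sub>F q in nhds 1. \<bar>Lq_spectrum \<nu> q\<bar> \<noteq> \<infinity>"
    by eventually_elim (simp add: Lq_spectrum_eq)
  then have "ereal_has_derivative_at (Lq_spectrum \<nu>) (1 / \<Delta>) 1"
    using b unfolding ereal_has_derivative_at_def by (simp add: \<beta>_def[abs_def])
  moreover have "hausdorff_dim_measure \<nu> = ereal (- (1 / \<Delta>))"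
    using hausdorff_dim_measure_le[OF b] hausdorff_dim_measure_ge[OF b] crit_derivative_neg[OF c]
    by (intro antisym) (auto simp: divide_le_0_iff)
  ultimately show ?thesis using quant_dim_0_eq[OF c] by (intro exI[of _ "1 / \<Delta>"]) auto
qed

end

text \<open>The complement of the support is the union of all null open sets; the Lindelof property
  reduces it to a countable union.\<close>

lemma emeasure_support_compl:
  fixes M :: "'a::second_countable_topology measure"
  assumes "sets M = sets borel"
  shows "emeasure M (- measure_support M) = 0"
proof -
  define F where "F = {U. open U \<and> emeasure M U = 0}"
  have "- measure_support M = \<Union>F"
    unfolding measure_support_def F_def by (auto simp: zero_less_iff_neq_zero)
  moreover obtain F' where F': "F' \<subseteq> F" "countable F'" "\<Union>F' = \<Union>F"
    using Lindelof[of F] unfolding F_def by blast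
  moreover have "(\<Union>U\<in>F'. U) \<in> null_sets M"
    using F' assms unfolding F_def by (intro null_sets_UN') (auto simp: null_sets_def)
  ultimately show ?thesis by (auto simp: null_sets_def)
qed

lemma quantizationI:
  fixes \<nu> :: "(real ^ 'd) measure"
  assumes "is_norm N" "prob_space \<nu>" "sets \<nu> = sets borel"
    "measure_support \<nu> \<subseteq> half_open_unit_cube" "dim_infty \<nu> > 0"
  shows "quantization \<nu> N"
proof -
  interpret prob_space \<nu> by fact
  have Us: "half_open_unit_cube \<in> sets \<nu>" using sets_half_open_unit_cube assms(3) by blast
  have sp: "space \<nu> = UNIV" using sets_eq_imp_space_eq[OF assms(3)] by simp
  have "open (- measure_support \<nu>)"
  proof -
    have "- measure_support \<nu> = \<Union>{U. open U \<and> emeasure \<nu> U = 0}"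
      unfolding measure_support_def by (auto simp: zero_less_iff_neq_zero)
    then show ?thesis by (simp add: open_Union)
  qed
  then have "- measure_support \<nu> \<in> sets \<nu>" using assms(3) by simp
  then have "emeasure \<nu> (- half_open_unit_cube) \<le> emeasure \<nu> (- measure_support \<nu>)"
    using assms(4) by (intro emeasure_mono) auto
  then have "measure \<nu> (- half_open_unit_cube) = 0"
    using emeasure_support_compl[OF assms(3)] by (simp add: measure_def)
  then have "measure \<nu> half_open_unit_cube = 1"
    using prob_compl[OF Us] unfolding sp by (simp add: Compl_eq_Diff_UNIV)
  with assms show ?thesis
    by (intro quantization.intro quant_measure.intro quant_measure_axioms.intro quantization_axioms.intro)
qed

theorem theorem1p5:
  fixes N :: "real ^ 'd \<Rightarrow> real" and \<nu> :: "(real ^ 'd) measure"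
  assumes norm: "is_norm N"
    and prob: "prob_space \<nu>"
    and borel: "sets \<nu> = sets borel"
    and compact: "compact (measure_support \<nu>)"
    and supp: "measure_support \<nu> \<subseteq> half_open_unit_cube"
    and dim_pos: "dim_infty \<nu> > 0"
  shows
    "(\<forall>r>0.
        ereal r * lower_coarse_dim \<nu> r / (1 - lower_coarse_dim \<nu> r) \<le> lower_quant_dim N \<nu> r \<and>
        lower_quant_dim N \<nu> r \<le> ereal r * lower_entropy_lim \<nu> r / (1 - lower_entropy_lim \<nu> r) \<and>
        ereal r * lower_entropy_lim \<nu> r / (1 - lower_entropy_lim \<nu> r)
          \<le> ereal r * upper_entropy \<nu> r / (1 - upper_entropy \<nu> r) \<and>
        ereal r * upper_entropy \<nu> r / (1 - upper_entropy \<nu> r) = upper_quant_dim N \<nu> r \<and>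
        upper_quant_dim N \<nu> r = ereal r * crit_exp \<nu> r / (1 - crit_exp \<nu> r) \<and>
        ereal r * crit_exp \<nu> r / (1 - crit_exp \<nu> r)
          = ereal r * upper_coarse_dim \<nu> r / (1 - upper_coarse_dim \<nu> r)) \<and>
     (\<forall>r. - dim_infty \<nu> < ereal r \<and> r < 0 \<longrightarrow>
        (ereal r * upper_coarse_dim \<nu> r / (1 - upper_coarse_dim \<nu> r)
           = ereal r * crit_exp \<nu> r / (1 - crit_exp \<nu> r) \<and>
         ereal r * crit_exp \<nu> r / (1 - crit_exp \<nu> r) = lower_quant_dim N \<nu> r \<and>
         lower_quant_dim N \<nu> r = ereal r * upper_entropy \<nu> r / (1 - upper_entropy \<nu> r)) \<and>
        (lower_coarse_dim \<nu> r > 1 \<longrightarrow>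
         ereal r * upper_entropy \<nu> r / (1 - upper_entropy \<nu> r)
           \<le> ereal r * lower_entropy_lim \<nu> r / (1 - lower_entropy_lim \<nu> r) \<and>
         ereal r * lower_entropy_lim \<nu> r / (1 - lower_entropy_lim \<nu> r) \<le> upper_quant_dim N \<nu> r \<and>
         upper_quant_dim N \<nu> r
           \<le> ereal r * lower_coarse_dim \<nu> r / (1 - lower_coarse_dim \<nu> r))) \<and>
     ((\<exists>D. ereal_has_derivative_at (crit_exp \<nu>) D 0) \<longrightarrow>
        (\<exists>\<beta>'. ereal_has_derivative_at (Lq_spectrum \<nu>) \<beta>' 1 \<and>
           lower_quant_dim N \<nu> 0 = upper_quant_dim N \<nu> 0 \<and>
           upper_quant_dim N \<nu> 0 = ereal (- \<beta>') \<and>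
           hausdorff_dim_measure \<nu> = ereal (- \<beta>')))"
proof -
  interpret quantization \<nu> N by (rule quantizationI) (fact norm prob borel supp dim_pos)+
  show ?thesis
    using quantization_positive_order quantization_negative_order quantization_order_zero by blast
qed

end
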